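(* For any $\lambda\in\mathbb{C}$, the block $\mathcal{O}_{[\lambda]}$ is wild.
   Context: All vector spaces and Lie algebras are over $\mathbb{C}$. Let $\mathfrak{W}=\mathrm{Der}_{\mathbb{C}}\,\mathbb{C}[x]$, the Lie algebra with basis $d_i=x^{i+1}\frac{\partial}{\partial x}$, $i\in\mathbb{Z}_{\ge -1}$, and bracket $[d_i,d_j]=(j-i)d_{i+j}$. Put $\mathfrak{W}^+=\mathrm{span}\{d_i\mid i\in\mathbb{Z}_{>0}\}$. A $\mathfrak{W}$-module $M$ is a weight module if $M=\bigoplus_{\lambda\in\mathbb{C}}M_\lambda$, where $M_\lambda=\{v\in M\mid d_0v=\lambda v\}$; then $\mathrm{Supp}(M)=\{\lambda\in\mathbb{C}\mid M_\lambda\ne 0\}$. Category $\mathcal{O}$ is the full subcategory of the category of left $U(\mathfrak{W})$-modules whose objects are the modules $M$ such that (a) $M$ is a finitely generated $U(\mathfrak{W})$-module; (b) $M$ is a weight module; (c) for each $v\in M$, the subspace $U(\mathfrak{W}^+)v$ is finite dimensional. For $\lambda\in\mathbb{C}$, $\mathcal{O}_{[\lambda]}$ is the full subcategory of $\mathcal{O}$ consisting of the modules $M$ with $\mathrm{Supp}(M)\subset\lambda+\mathbb{Z}$. (These are the blocks of $\mathcal{O}$.) Let $\mathbb{C}\langle x_1,x_2\rangle$ be the free associative algebra over $\mathbb{C}$ in two variables. An abelian category $\mathcal{C}$ is wild if there exists an exact functor from the category of finite dimensional representations of $\mathbb{C}\langle x_1,x_2\rangle$ to $\mathcal{C}$ which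 preserves indecomposability and takes non-isomorphic modules to non-isomorphic ones. *)

theory Defs
  imports
    "HOL-Computational_Algebra.Polynomial"
    "HOL-Library.FuncSet"
    "HOL-Algebra.Module"
    "HOL-Algebra.AbelCoset"
    "HOL-Decision_Procs.Algebra_Aux"
begin

section \<open>Vector spaces with a family of operators\<close>

abbreviation complex_ring :: "complex ring"
  where "complex_ring \<equiv> cring_class_ops"

text \<open>
  Both kinds of modules below are complex vector spaces with operators \<open>act M i\<close> indexed by a type.
  The fields \<open>mult\<close> and \<open>one\<close> inherited from the library record are unused, and so are
  the values of the operations outside the carrier.
\<close>

record ('i, 'v) rep = "(complex, 'v) module" +
  act :: "'i \<Rightarrow> 'v \<Rightarrow> 'v"

definition is_linear :: "('i, 'v) rep \<Rightarrow> ('i, 'w) rep \<Rightarrow> ('v \<Rightarrow> 'w) \<Rightarrow> bool" where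
  "is_linear M N f \<longleftrightarrow>
     f \<in> carrier M \<rightarrow> carrier N \<and>
     (\<forall>v\<in>carrier M. \<forall>w\<in>carrier M. f (v \<oplus>\<^bsub>M\<^esub> w) = f v \<oplus>\<^bsub>N\<^esub> f w) \<and>
     (\<forall>c. \<forall>v\<in>carrier M. f (c \<odot>\<^bsub>M\<^esub> v) = c \<odot>\<^bsub>N\<^esub> f v)"

definition is_rep :: "('i, 'v) rep \<Rightarrow> bool" where
  "is_rep M \<longleftrightarrow> Module.module complex_ring M \<and> (\<forall>i. is_linear M M (act M i))"

text \<open>Homomorphisms are extensional, so that equality of morphisms is equality on the carrier.\<close>

definition rep_hom :: "('i, 'v) rep \<Rightarrow> ('i, 'w) rep \<Rightarrow> ('v \<Rightarrow> 'w) set" where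
  "rep_hom M N = {f \<in> extensional (carrier M).
     is_linear M N f \<and> (\<forall>i. \<forall>v\<in>carrier M. f (act M i v) = act N i (f v))}"

definition rep_iso :: "('i, 'v) rep \<Rightarrow> ('i, 'w) rep \<Rightarrow> bool" where
  "rep_iso M N \<longleftrightarrow> (\<exists>f\<in>rep_hom M N. bij_betw f (carrier M) (carrier N))"

definition subrep :: "('i, 'v) rep \<Rightarrow> 'v set \<Rightarrow> bool" where
  "subrep M U \<longleftrightarrow> submodule U complex_ring M \<and> (\<forall>i. act M i ` U \<subseteq> U)"

definition indecomposable :: "('i, 'v) rep \<Rightarrow> bool" where
  "indecomposable M \<longleftrightarrow>
     carrier M \<noteq> {\<zero>\<^bsub>M\<^esub>} \<and>
     (\<forall>U V. subrep M U \<and> subrep M V \<and> U \<inter> V = {\<zero>\<^bsub>M\<^esub>} \<and> U <+>\<^bsub>M\<^esub> V = carrier M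
        \<longrightarrow> U = {\<zero>\<^bsub>M\<^esub>} \<or> V = {\<zero>\<^bsub>M\<^esub>})"

text \<open>
  The smallest linear subspace that contains \<open>S\<close> and is stable under the operators with index in
  \<open>I\<close>; for \<open>I = {}\<close> this is the linear span.
\<close>

definition generated :: "('i, 'v) rep \<Rightarrow> 'i set \<Rightarrow> 'v set \<Rightarrow> 'v set" where
  "generated M I S =
     \<Inter>{U. submodule U complex_ring M \<and> (\<forall>i\<in>I. act M i ` U \<subseteq> U) \<and> S \<subseteq> U}"

definition finite_dim :: "('i, 'v) rep \<Rightarrow> 'v set \<Rightarrow> bool" where
  "finite_dim M U \<longleftrightarrow> (\<exists>S. finite S \<and> S \<subseteq> carrier M \<and> generated M {} S = U)"

definition short_exact ::
    "('i, 'v) rep \<Rightarrow> ('v \<Rightarrow> 'v) \<Rightarrow> ('i, 'v) rep \<Rightarrow> ('v \<Rightarrow> 'v) \<Rightarrow> ('i, 'v) rep \<Rightarrow> bool" where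
  "short_exact A f B g C \<longleftrightarrow>
     f \<in> rep_hom A B \<and> g \<in> rep_hom B C \<and>
     inj_on f (carrier A) \<and>
     f ` carrier A = {b \<in> carrier B. g b = \<zero>\<^bsub>C\<^esub>} \<and>
     g ` carrier B = carrier C"


section \<open>Functors between full subcategories\<close>

text \<open>
  A full subcategory is given by its set of objects. A functor consists of an object map \<open>F\<close> and
  a morphism map \<open>\<Phi>\<close>, where \<open>\<Phi> M N f\<close> is the image of the morphism \<open>f\<close> from \<open>M\<close> to \<open>N\<close>.
\<close>

definition is_functor ::
    "('i, 'v) rep set \<Rightarrow> ('j, 'w) rep set \<Rightarrow> (('i, 'v) rep \<Rightarrow> ('j, 'w) rep) \<Rightarrow>
     (('i, 'v) rep \<Rightarrow> ('i, 'v) rep \<Rightarrow> ('v \<Rightarrow> 'v) \<Rightarrow> ('w \<Rightarrow> 'w)) \<Rightarrow> bool" where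
  "is_functor \<C> \<D> F \<Phi> \<longleftrightarrow>
     (\<forall>M\<in>\<C>. F M \<in> \<D>) \<and>
     (\<forall>M\<in>\<C>. \<forall>N\<in>\<C>. \<forall>f\<in>rep_hom M N. \<Phi> M N f \<in> rep_hom (F M) (F N)) \<and>
     (\<forall>M\<in>\<C>. \<Phi> M M (\<lambda>v\<in>carrier M. v) = (\<lambda>v\<in>carrier (F M). v)) \<and>
     (\<forall>L\<in>\<C>. \<forall>M\<in>\<C>. \<forall>N\<in>\<C>. \<forall>f\<in>rep_hom L M. \<forall>g\<in>rep_hom M N.
        \<Phi> L N (compose (carrier L) g f) = compose (carrier (F L)) (\<Phi> M N g) (\<Phi> L M f))"

definition exact_functor ::
    "('i, 'v) rep set \<Rightarrow> ('j, 'w) rep set \<Rightarrow> (('i, 'v) rep \<Rightarrow> ('j, 'w) rep) \<Rightarrow>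
     (('i, 'v) rep \<Rightarrow> ('i, 'v) rep \<Rightarrow> ('v \<Rightarrow> 'v) \<Rightarrow> ('w \<Rightarrow> 'w)) \<Rightarrow> bool" where
  "exact_functor \<C> \<D> F \<Phi> \<longleftrightarrow>
     is_functor \<C> \<D> F \<Phi> \<and>
     (\<forall>M\<in>\<C>. \<forall>N\<in>\<C>. \<forall>f\<in>rep_hom M N. \<forall>g\<in>rep_hom M N.
        \<Phi> M N (\<lambda>v\<in>carrier M. f v \<oplus>\<^bsub>N\<^esub> g v) =
        (\<lambda>v\<in>carrier (F M). \<Phi> M N f v \<oplus>\<^bsub>F N\<^esub> \<Phi> M N g v)) \<and>
     (\<forall>A\<in>\<C>. \<forall>B\<in>\<C>. \<forall>C\<in>\<C>. \<forall>f g. short_exact A f B g C \<longrightarrow>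
        short_exact (F A) (\<Phi> A B f) (F B) (\<Phi> B C g) (F C))"

text \<open>
  Exactness in a full subcategory closed under submodules and quotients, such as the blocks below, is
  exactness of the underlying maps.

  A representation of the free associative algebra on two generators is a vector space with two
  arbitrary linear operators.
\<close>

datatype free_gen = X1 | X2

definition fd_free_reps :: "(free_gen, 'v) rep set" where
  "fd_free_reps = {M. is_rep M \<and> finite_dim M (carrier M)}"

definition wild :: "('j, 'v) rep set \<Rightarrow> bool" where
  "wild \<D> \<longleftrightarrow>
     (\<exists>(F :: (free_gen, 'v) rep \<Rightarrow> ('j, 'v) rep) \<Phi>.
        exact_functor fd_free_reps \<D> F \<Phi> \<and>
        (\<forall>M\<in>fd_free_reps. indecomposable M \<longrightarrow> indecomposable (F M)) \<and>
        (\<forall>M\<in>fd_free_reps. \<forall>N\<in>fd_free_reps. \<not> rep_iso M N \<longrightarrow> \<not> rep_iso (F M) (F N)))"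


section \<open>The Lie algebra of derivations of the polynomial ring\<close>

text \<open>
  The derivation \<open>p \<partial>/\<partial>x\<close> is represented by the polynomial \<open>p\<close>.
\<close>

definition der :: "complex poly \<Rightarrow> complex poly \<Rightarrow> complex poly" where
  "der p = (\<lambda>q. p * pderiv q)"

definition bracket :: "complex poly \<Rightarrow> complex poly \<Rightarrow> complex poly" where
  "bracket p q = p * pderiv q - q * pderiv p"

definition d :: "int \<Rightarrow> complex poly" where
  "d i = monom 1 (nat (i + 1))"

lemma inj_der: "inj der"
proof (rule injI)
  fix p q assume "der p = der q"
  then have "der p [:0, 1:] = der q [:0, 1:]" by simp
  then show "p = q" by (simp add: der_def pderiv_pCons)
qed

lemma derivation_iff:
  fixes D :: "complex poly \<Rightarrow> complex poly"
  shows "(\<forall>p q. D (p + q) = D p + D q) \<and> (\<forall>c p. D (Polynomial.smult c p) = Polynomial.smult c (D p)) \<and>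
         (\<forall>p q. D (p * q) = D p * q + p * D q) \<longleftrightarrow> D \<in> range der" (is "?L \<longleftrightarrow> ?R")
proof
  assume ?L
  then have L: "D (p + q) = D p + D q" "D (Polynomial.smult c p) = Polynomial.smult c (D p)"
    "D (p * q) = D p * q + p * D q" for c p q
    by blast+
  have one: "D 1 = 0"
  proof -
    have "D (1 * 1) = D 1 * 1 + 1 * D 1" by (rule L)
    then show ?thesis by simp
  qed
  have zero: "D 0 = 0"
  proof -
    have "D (Polynomial.smult 0 0) = Polynomial.smult 0 (D 0)" by (rule L)
    then show ?thesis by simp
  qed
  have "D q = D [:0, 1:] * pderiv q" for q
  proof (induction q)
    case 0
    then show ?case by (simp add: zero)
  next
    case (pCons a q)
    have eq: "pCons a q = Polynomial.smult a 1 + [:0, 1:] * q" by simp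
    have "D (pCons a q) = D (Polynomial.smult a 1) + D ([:0, 1:] * q)"
      by (subst eq) (rule L)
    also have "\<dots> = Polynomial.smult a (D 1) + (D [:0, 1:] * q + [:0, 1:] * D q)"
      by (simp only: L)
    finally show ?case
      by (simp add: one pCons.IH pderiv_pCons algebra_simps)
  qed
  then have "D = der (D [:0, 1:])" unfolding der_def by (rule ext)
  then show ?R by blast
next
  assume ?R
  then show ?L
    by (auto simp: der_def pderiv_add pderiv_smult pderiv_mult algebra_simps)
qed

lemma der_bracket: "der (bracket p q) f = der p (der q f) - der q (der p f)"
  by (simp add: der_def bracket_def pderiv_mult algebra_simps)

lemma bracket_d:
  assumes "i \<ge> -1" "j \<ge> -1"
  shows "bracket (d i) (d j) = Polynomial.smult (of_int (j - i)) (d (i + j))"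
proof -
  define m n where "m = nat (i + 1)" and "n = nat (j + 1)"
  then have m: "i = int m - 1" and n: "j = int n - 1"
    using assms by simp_all
  have nat_pred: "nat (int k - 1) = k - Suc 0" for k
    by linarith
  show ?thesis
  proof (cases "m = 0 \<or> n = 0")
    case True
    then show ?thesis
      by (auto simp: m n bracket_def d_def pderiv_monom mult_monom Polynomial.smult_monom
          minus_monom nat_pred)
  next
    case False
    then obtain k l where "m = Suc k" "n = Suc l"
      by (metis not0_implies_Suc)
    then show ?thesis
      by (simp add: m n bracket_def d_def pderiv_monom mult_monom Polynomial.smult_monom
          diff_monom nat_add_distrib add.commute)
  qed
qed

text \<open>Left modules over the enveloping algebra are the same as modules over the Lie algebra.\<close>

definition witt_module :: "(complex poly, 'v) rep \<Rightarrow> bool" where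
  "witt_module M \<longleftrightarrow>
     is_rep M \<and>
     (\<forall>p q. \<forall>v\<in>carrier M. act M (p + q) v = act M p v \<oplus>\<^bsub>M\<^esub> act M q v) \<and>
     (\<forall>c p. \<forall>v\<in>carrier M. act M (Polynomial.smult c p) v = c \<odot>\<^bsub>M\<^esub> act M p v) \<and>
     (\<forall>p q. \<forall>v\<in>carrier M. act M (bracket p q) v =
        act M p (act M q v) \<ominus>\<^bsub>M\<^esub> act M q (act M p v))"

definition witt_plus :: "complex poly set" where
  "witt_plus = Modules.module.span Polynomial.smult (d ` {i. i > 0})"


section \<open>Category O\<close>

definition weight_space :: "(complex poly, 'v) rep \<Rightarrow> complex \<Rightarrow> 'v set" where
  "weight_space M \<mu> = {v \<in> carrier M. act M (d 0) v = \<mu> \<odot>\<^bsub>M\<^esub> v}"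

definition weight_module :: "(complex poly, 'v) rep \<Rightarrow> bool" where
  "weight_module M \<longleftrightarrow>
     (\<forall>v\<in>carrier M. \<exists>!f. (\<forall>\<mu>. f \<mu> \<in> weight_space M \<mu>) \<and> finite {\<mu>. f \<mu> \<noteq> \<zero>\<^bsub>M\<^esub>} \<and>
        v = (\<Oplus>\<^bsub>M\<^esub>\<mu>\<in>{\<mu>. f \<mu> \<noteq> \<zero>\<^bsub>M\<^esub>}. f \<mu>))"

definition Supp :: "(complex poly, 'v) rep \<Rightarrow> complex set" where
  "Supp M = {\<mu>. weight_space M \<mu> \<noteq> {\<zero>\<^bsub>M\<^esub>}}"

definition category_O :: "(complex poly, 'v) rep set" where
  "category_O = {M. witt_module M \<and>
     (\<exists>S. finite S \<and> S \<subseteq> carrier M \<and> generated M UNIV S = carrier M) \<and>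
     weight_module M \<and>
     (\<forall>v\<in>carrier M. finite_dim M (generated M witt_plus {v}))}"

definition block_O :: "complex \<Rightarrow> (complex poly, 'v) rep set" where
  "block_O \<mu> = {M \<in> category_O. Supp M \<subseteq> {\<mu> + of_int n | n. True}}"

end

theory Submission
  imports Defs "HOL-Library.Function_Algebras" "HOL-Library.Nat_Bijection"
begin

text \<open>
  The theorem holds because the representations of the free algebra on two generators embed fully
  faithfully and exactly into the block. The embedding is written down by hand.

  Let \<open>\<nu>\<close> be a complex number. Vector fields act on densities \<open>p(x) (dx)\<^sup>\<nu>\<close> by
  \<open>p \<mapsto> f p' + \<nu> f' p\<close>, which is \<open>lie \<nu> f\<close>. The linear functionals on polynomials that vanish on all
  multiples of some power of \<open>x\<close> (the polar parts, by the residue pairing) form the dual module; it is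
  the Verma module of highest weight \<open>-\<nu>\<close>. Let \<open>\<ell>\<close> be 2, 3 or 4. The transvectant of order \<open>\<ell> - 2\<close> of \<open>f'''\<close>
  and \<open>p\<close> is a one-cocycle with values in the differential operators from densities of weight \<open>\<nu>\<close> to
  densities of weight \<open>\<nu> + \<ell>\<close> (\<open>cocycle2_bracket\<close>, \<open>cocycle3_bracket\<close>, \<open>cocycle4_bracket\<close>). It vanishes on
  the span of \<open>d (-1)\<close>, \<open>d 0\<close>, \<open>d 1\<close>, and it gives an extension of Verma modules whose highest weights differ
  by \<open>\<ell>\<close>.

  Take six Verma modules, in slots \<open>0, \<dots>, 5\<close>, with highest weights \<open>k - \<nu>\<close> in slot \<open>k\<close>. The pairs of a
  slot in \<open>{0, 1, 2}\<close> and a slot in \<open>{3, 4, 5}\<close> whose distance is 2, 3 or 4 are the edges of a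
  bipartite graph: \<open>1-3\<close> and \<open>2-4\<close> of length 2, \<open>0-3\<close>, \<open>1-4\<close> and \<open>2-5\<close> of length 3, \<open>0-4\<close> and \<open>1-5\<close> of length 4.
  Given a vector space for each slot and a linear map for each edge, the sum of the Verma modules
  tensored with these spaces becomes a module, in which an edge acts by its cocycle tensored with
  its map. No slot is both a source and a target, so there are no composites of two edges and the
  cocycle identities are all that has to be checked.
  For a representation \<open>M\<close> put the space of \<open>M\<close> in every slot. The edges of length 2 and 3 form the path
  \<open>0-3-1-4-2-5\<close> through all slots, and they carry the identity; the two edges of length 4 carry the two
  generators of the free algebra. This is \<open>polar_rep\<close>.

  A homomorphism between two such modules commutes with \<open>d 0\<close> and \<open>d 1\<close>. If \<open>\<nu>\<close> has a large real part,
  the kernel of \<open>d 1\<close> in weight \<open>k - \<nu>\<close> is the highest weight space of slot \<open>k\<close> alone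
  (\<open>highest_weight_vector\<close>), so the homomorphism is given by one linear map for each slot. Commuting with
  \<open>d 2\<close> on highest weight vectors means compatibility with all seven edges
  (\<open>act_d2_coordinate\<close>): the path forces the six maps to be equal, and the other two edges say that the
  common map commutes with the generators. Hence the functor is full (\<open>polar_full\<close>), and a fully
  faithful exact functor preserves indecomposability and reflects isomorphism
  (\<open>wild_if_fully_faithful\<close>).

  The weights of \<open>polar_rep M\<close> are \<open>k - m - \<nu>\<close> with \<open>k\<close>, \<open>m\<close> natural, so \<open>\<nu>\<close> is taken to be an integer minus \<open>\<mu>\<close>.
  Since \<open>M\<close> is finite dimensional, the functionals can be encoded by sequences of complex numbers,
  and the module structure is transported to the prescribed type along this encoding.
\<close>

section \<open>Densities and extension cocycles\<close>

definition lie :: "complex \<Rightarrow> complex poly \<Rightarrow> complex poly \<Rightarrow> complex poly" where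
  "lie \<nu> f p = f * pderiv p + Polynomial.smult \<nu> (pderiv f * p)"

text \<open>
  Up to a scalar, the transvectants of orders 0, 1 and 2 of the third derivative of the vector field,
  a density of weight 2, with a density of weight \<open>\<nu>\<close>.
\<close>

definition cocycle2 :: "complex poly \<Rightarrow> complex poly \<Rightarrow> complex poly" where
  "cocycle2 f p = (pderiv ^^ 3) f * p"

definition cocycle3 :: "complex \<Rightarrow> complex poly \<Rightarrow> complex poly \<Rightarrow> complex poly" where
  "cocycle3 \<nu> f p = Polynomial.smult 2 ((pderiv ^^ 3) f * pderiv p) -
     Polynomial.smult \<nu> ((pderiv ^^ 4) f * p)"

definition cocycle4 :: "complex \<Rightarrow> complex poly \<Rightarrow> complex poly \<Rightarrow> complex poly" where
  "cocycle4 \<nu> f p = Polynomial.smult 10 ((pderiv ^^ 3) f * (pderiv ^^ 2) p) -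
     Polynomial.smult (5 * (2 * \<nu> + 1)) ((pderiv ^^ 4) f * pderiv p) +
     Polynomial.smult (\<nu> * (2 * \<nu> + 1)) ((pderiv ^^ 5) f * p)"

lemma pderiv_const_mult: "pderiv ([:c:] * p) = [:c:] * pderiv p"
  by (simp add: pderiv_smult)

text \<open>
  Scalars are written as constant polynomials, so that every identity below is an identity in a
  commutative ring between \<open>f\<close>, \<open>g\<close>, \<open>p\<close>, \<open>\<nu>\<close> and iterated derivatives.
\<close>

lemma smult_eq_const_mult:
  "Polynomial.smult c p = [:c:] * p" "[:a + b:] = [:a:] + [:b:]" "[:a * b:] = [:b:] * [:a:]"
  "[:1:] = 1" "[:numeral n:] = numeral n"
  by (simp_all add: one_pCons numeral_poly)

lemmas density_expand = lie_def bracket_def cocycle2_def cocycle3_def cocycle4_def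
  smult_eq_const_mult pderiv_add pderiv_diff pderiv_mult pderiv_const_mult eval_nat_numeral

text \<open>
  The Leibniz rule expands both sides of this and of the following three identities into the same
  differential polynomial.
\<close>

lemma lie_bracket:
  "lie \<nu> (bracket f g) p = lie \<nu> f (lie \<nu> g p) - lie \<nu> g (lie \<nu> f p)"
  by (simp add: density_expand algebra_simps del: mult_pCons_left mult_pCons_right)

lemma cocycle2_bracket:
  "cocycle2 (bracket f g) p =
     (lie (\<nu> + 2) f (cocycle2 g p) - cocycle2 g (lie \<nu> f p)) -
     (lie (\<nu> + 2) g (cocycle2 f p) - cocycle2 f (lie \<nu> g p))"
  by (simp add: density_expand algebra_simps del: mult_pCons_left mult_pCons_right)

lemma cocycle3_bracket:
  "cocycle3 \<nu> (bracket f g) p =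
     (lie (\<nu> + 3) f (cocycle3 \<nu> g p) - cocycle3 \<nu> g (lie \<nu> f p)) -
     (lie (\<nu> + 3) g (cocycle3 \<nu> f p) - cocycle3 \<nu> f (lie \<nu> g p))"
  by (simp add: density_expand algebra_simps del: mult_pCons_left mult_pCons_right)

lemma cocycle4_bracket:
  "cocycle4 \<nu> (bracket f g) p =
     (lie (\<nu> + 4) f (cocycle4 \<nu> g p) - cocycle4 \<nu> g (lie \<nu> f p)) -
     (lie (\<nu> + 4) g (cocycle4 \<nu> f p) - cocycle4 \<nu> f (lie \<nu> g p))"
  by (simp add: density_expand algebra_simps del: mult_pCons_left mult_pCons_right)

section \<open>Complex representations\<close>

locale representation =
  fixes M :: "('i, 'v) rep" (structure)
  assumes is_rep: "is_rep M"
begin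

sublocale Module.module complex_ring M
  using is_rep by (simp add: is_rep_def)

lemma scale_closed [simp]: "v \<in> carrier M \<Longrightarrow> c \<odot> v \<in> carrier M"
  by (simp add: smult_closed carrier_class)

lemma scale_add_left: "v \<in> carrier M \<Longrightarrow> (a + b) \<odot> v = a \<odot> v \<oplus> b \<odot> v"
  using smult_l_distr[of a b v] by (simp add: class_simps)

lemma scale_add_right:
  "v \<in> carrier M \<Longrightarrow> w \<in> carrier M \<Longrightarrow> c \<odot> (v \<oplus> w) = c \<odot> v \<oplus> c \<odot> w"
  using smult_r_distr[of c v w] by (simp add: class_simps)

lemma scale_scale: "v \<in> carrier M \<Longrightarrow> a \<odot> (b \<odot> v) = (a * b) \<odot> v"
  using smult_assoc1[of a b v] by (simp add: class_simps)

lemma scale_one [simp]: "v \<in> carrier M \<Longrightarrow> 1 \<odot> v = v"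
  using smult_one[of v] by (simp add: class_simps)

lemma scale_zero_left [simp]: "v \<in> carrier M \<Longrightarrow> 0 \<odot> v = \<zero>"
  using smult_l_null[of v] by (simp add: class_simps)

lemma scale_zero_right [simp]: "c \<odot> \<zero> = \<zero>"
  using smult_r_null[of c] by (simp add: class_simps)

lemma scale_minus_one: "v \<in> carrier M \<Longrightarrow> (- 1) \<odot> v = \<ominus> v"
  using smult_l_minus[of 1 v] by (simp add: class_simps)

lemma scale_eq_zero:
  assumes "c \<odot> v = \<zero>" "c \<noteq> 0" "v \<in> carrier M"
  shows "v = \<zero>"
  using scale_scale[of v "inverse c" c] assms by simp

lemma scale_left_cancel:
  assumes "a \<odot> v = b \<odot> v" "a \<noteq> b" "v \<in> carrier M"
  shows "v = \<zero>"
proof (rule scale_eq_zero)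
  have "(a - b) \<odot> v = a \<odot> v \<oplus> (-1) \<odot> (b \<odot> v)"
    using scale_add_left[of v a "- b"] assms(3) by (simp add: scale_scale)
  then show "(a - b) \<odot> v = \<zero>"
    using assms by (simp add: scale_minus_one r_neg)
qed (use assms in auto)

lemma act_linear: "is_linear M M (act M i)"
  using is_rep by (simp add: is_rep_def)

lemma submodule_iff:
  "submodule U complex_ring M \<longleftrightarrow> U \<subseteq> carrier M \<and> \<zero> \<in> U \<and>
     (\<forall>v\<in>U. \<forall>w\<in>U. v \<oplus> w \<in> U) \<and> (\<forall>c. \<forall>v\<in>U. c \<odot> v \<in> U)" (is "_ \<longleftrightarrow> ?R")
proof
  assume U: "submodule U complex_ring M"
  note E = submoduleE[OF U]
  obtain u where "u \<in> U" using E(2) by blast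
  then have "0 \<odot> u \<in> U" "u \<in> carrier M" using E(1,4) by (auto simp: carrier_class)
  then show ?R
    using E by (simp add: carrier_class)
next
  assume ?R
  then show "submodule U complex_ring M"
    by (intro submoduleI) (auto simp flip: scale_minus_one)
qed

lemmas submoduleD = submodule_iff[THEN iffD1, THEN conjunct1]
  submodule_iff[THEN iffD1, THEN conjunct2, THEN conjunct1]
  submodule_iff[THEN iffD1, THEN conjunct2, THEN conjunct2, THEN conjunct1, rule_format]
  submodule_iff[THEN iffD1, THEN conjunct2, THEN conjunct2, THEN conjunct2, rule_format]

lemma submodule_carrier: "submodule (carrier M) complex_ring M"
  by (simp add: submodule_iff)

lemma act_closed [simp]: "v \<in> carrier M \<Longrightarrow> act M i v \<in> carrier M"
  using act_linear[of i] by (auto simp: is_linear_def)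

lemma act_carrier: "act M i ` carrier M \<subseteq> carrier M"
  by auto

lemma submodule_Inter:
  assumes "\<And>U. U \<in> \<U> \<Longrightarrow> submodule U complex_ring M" "\<U> \<noteq> {}"
  shows "submodule (\<Inter>\<U>) complex_ring M"
proof -
  have *: "U \<subseteq> carrier M" "\<zero> \<in> U" "v \<in> U \<Longrightarrow> w \<in> U \<Longrightarrow> v \<oplus> w \<in> U" "v \<in> U \<Longrightarrow> c \<odot> v \<in> U"
    if "U \<in> \<U>" for U c v w
    using assms(1)[OF that] by (simp_all add: submodule_iff)
  obtain U where "U \<in> \<U>" using assms(2) by blast
  then show ?thesis
    unfolding submodule_iff using *(1) by (auto simp: *(2-4))
qed

lemma generated_submodule:
  assumes "S \<subseteq> carrier M"
  shows "submodule (generated M I S) complex_ring M"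
  unfolding generated_def
  using submodule_carrier act_carrier assms by (intro submodule_Inter) auto

lemma generated_subset_carrier: "S \<subseteq> carrier M \<Longrightarrow> generated M I S \<subseteq> carrier M"
  by (rule submoduleD(1)[OF generated_submodule])

end

lemma generated_superset: "S \<subseteq> generated M I S"
  by (auto simp: generated_def)

lemma generated_stable: "i \<in> I \<Longrightarrow> v \<in> generated M I S \<Longrightarrow> act M i v \<in> generated M I S"
  unfolding generated_def by blast

lemma generated_least:
  assumes "submodule U complex_ring M" "\<And>i. i \<in> I \<Longrightarrow> act M i ` U \<subseteq> U" "S \<subseteq> U"
  shows "generated M I S \<subseteq> U"
  using assms unfolding generated_def by blast

lemma is_repI:
  fixes M :: "('i, 'v) rep" (structure)
  assumes "\<zero> \<in> carrier M"
    "\<And>v w. v \<in> carrier M \<Longrightarrow> w \<in> carrier M \<Longrightarrow> v \<oplus> w \<in> carrier M"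
    "\<And>c v. v \<in> carrier M \<Longrightarrow> c \<odot> v \<in> carrier M"
    "\<And>u v w. u \<in> carrier M \<Longrightarrow> v \<in> carrier M \<Longrightarrow> w \<in> carrier M \<Longrightarrow>
       (u \<oplus> v) \<oplus> w = u \<oplus> (v \<oplus> w)"
    "\<And>v w. v \<in> carrier M \<Longrightarrow> w \<in> carrier M \<Longrightarrow> v \<oplus> w = w \<oplus> v"
    "\<And>v. v \<in> carrier M \<Longrightarrow> \<zero> \<oplus> v = v"
    "\<And>v. v \<in> carrier M \<Longrightarrow> 0 \<odot> v = \<zero>"
    "\<And>v. v \<in> carrier M \<Longrightarrow> 1 \<odot> v = v"
    "\<And>a b v. v \<in> carrier M \<Longrightarrow> (a + b) \<odot> v = a \<odot> v \<oplus> b \<odot> v"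
    "\<And>c v w. v \<in> carrier M \<Longrightarrow> w \<in> carrier M \<Longrightarrow> c \<odot> (v \<oplus> w) = c \<odot> v \<oplus> c \<odot> w"
    "\<And>a b v. v \<in> carrier M \<Longrightarrow> (a * b) \<odot> v = a \<odot> (b \<odot> v)"
    "\<And>i. is_linear M M (act M i)"
  shows "is_rep M"
proof -
  have "\<exists>w\<in>carrier M. w \<oplus> v = \<zero>" if "v \<in> carrier M" for v
    using assms(3)[of v "- 1"] assms(7)[of v] assms(8)[of v] assms(9)[of v "- 1" 1] that
    by (intro bexI[of _ "(- 1) \<odot> v"]) auto
  then have "abelian_group M"
    by (intro abelian_groupI) (use assms in auto)
  then have "Module.module complex_ring M"
    by (intro Module.moduleI cring_class) (use assms in \<open>auto simp: class_simps\<close>)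
  then show ?thesis
    using assms(12) by (simp add: is_rep_def)
qed

section \<open>Homomorphisms\<close>

lemma is_linearD:
  assumes "is_linear M N f"
  shows "v \<in> carrier M \<Longrightarrow> f v \<in> carrier N"
    and "v \<in> carrier M \<Longrightarrow> w \<in> carrier M \<Longrightarrow> f (v \<oplus>\<^bsub>M\<^esub> w) = f v \<oplus>\<^bsub>N\<^esub> f w"
    and "v \<in> carrier M \<Longrightarrow> f (c \<odot>\<^bsub>M\<^esub> v) = c \<odot>\<^bsub>N\<^esub> f v"
  using assms by (auto simp: is_linear_def)

lemma is_linear_zero:
  assumes "is_linear M N f" "is_rep M" "is_rep N"
  shows "f \<zero>\<^bsub>M\<^esub> = \<zero>\<^bsub>N\<^esub>"
proof -
  interpret M: representation M using assms by unfold_locales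
  interpret N: representation N using assms by unfold_locales
  show ?thesis
    using is_linearD(3)[OF assms(1), of "\<zero>\<^bsub>M\<^esub>" 0] is_linearD(1)[OF assms(1), of "\<zero>\<^bsub>M\<^esub>"] by simp
qed

lemma rep_homD:
  assumes "f \<in> rep_hom M N"
  shows "f \<in> extensional (carrier M)" and "is_linear M N f"
    and "v \<in> carrier M \<Longrightarrow> f v \<in> carrier N"
    and "v \<in> carrier M \<Longrightarrow> w \<in> carrier M \<Longrightarrow> f (v \<oplus>\<^bsub>M\<^esub> w) = f v \<oplus>\<^bsub>N\<^esub> f w"
    and "v \<in> carrier M \<Longrightarrow> f (c \<odot>\<^bsub>M\<^esub> v) = c \<odot>\<^bsub>N\<^esub> f v"
    and "v \<in> carrier M \<Longrightarrow> f (act M i v) = act N i (f v)"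
  using assms by (auto simp: rep_hom_def is_linear_def)

lemma rep_homI:
  assumes "f \<in> extensional (carrier M)"
    and "\<And>v. v \<in> carrier M \<Longrightarrow> f v \<in> carrier N"
    and "\<And>v w. v \<in> carrier M \<Longrightarrow> w \<in> carrier M \<Longrightarrow> f (v \<oplus>\<^bsub>M\<^esub> w) = f v \<oplus>\<^bsub>N\<^esub> f w"
    and "\<And>c v. v \<in> carrier M \<Longrightarrow> f (c \<odot>\<^bsub>M\<^esub> v) = c \<odot>\<^bsub>N\<^esub> f v"
    and "\<And>i v. v \<in> carrier M \<Longrightarrow> f (act M i v) = act N i (f v)"
  shows "f \<in> rep_hom M N"
  using assms by (auto simp: rep_hom_def is_linear_def)

lemma rep_hom_zero:
  "f \<in> rep_hom M N \<Longrightarrow> is_rep M \<Longrightarrow> is_rep N \<Longrightarrow> f \<zero>\<^bsub>M\<^esub> = \<zero>\<^bsub>N\<^esub>"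
  by (blast intro: is_linear_zero rep_homD(2))

lemma rep_hom_id: "is_rep M \<Longrightarrow> (\<lambda>v\<in>carrier M. v) \<in> rep_hom M M"
proof -
  assume "is_rep M"
  then interpret representation M by unfold_locales
  show ?thesis by (rule rep_homI) auto
qed

lemma rep_hom_compose:
  assumes "f \<in> rep_hom L M" "g \<in> rep_hom M N" "is_rep L"
  shows "compose (carrier L) g f \<in> rep_hom L N"
proof -
  interpret representation L using assms by unfold_locales
  show ?thesis
    by (rule rep_homI) (use assms in \<open>auto simp: compose_def rep_homD\<close>)
qed

lemma rep_hom_inverse:
  assumes f: "f \<in> rep_hom M N" "bij_betw f (carrier M) (carrier N)" and "is_rep M" "is_rep N"
  shows "restrict (inv_into (carrier M) f) (carrier N) \<in> rep_hom N M"
proof -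
  interpret M: representation M using assms by unfold_locales
  interpret N: representation N using assms by unfold_locales
  let ?g = "inv_into (carrier M) f"
  have inj: "inj_on f (carrier M)" and img: "f ` carrier M = carrier N"
    using f by (auto simp: bij_betw_def)
  have eqI: "?g b = a" if "a \<in> carrier M" "f a = b" for a b
    using inv_into_f_f[OF inj that(1)] that(2) by simp
  have g: "?g b \<in> carrier M" "f (?g b) = b" if "b \<in> carrier N" for b
    using that img by (auto simp: inv_into_into f_inv_into_f)
  show ?thesis
    by (rule rep_homI) (auto simp: g rep_homD[OF f(1)] intro!: eqI)
qed

lemma submodule_vimage:
  assumes "is_linear M N f" "is_rep M" "is_rep N" "submodule U complex_ring N"
  shows "submodule {v \<in> carrier M. f v \<in> U} complex_ring M"
proof -
  interpret M: representation M using assms by unfold_locales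
  interpret N: representation N using assms by unfold_locales
  show ?thesis
    using assms(4) unfolding M.submodule_iff N.submodule_iff
    by (auto simp: is_linearD[OF assms(1)] is_linear_zero[OF assms(1-3)])
qed

lemma submodule_image:
  assumes "is_linear M N f" "is_rep M" "is_rep N" "submodule U complex_ring M"
  shows "submodule (f ` U) complex_ring N"
proof -
  interpret M: representation M using assms by unfold_locales
  interpret N: representation N using assms by unfold_locales
  have U: "U \<subseteq> carrier M" "\<zero>\<^bsub>M\<^esub> \<in> U" "\<And>u v. u \<in> U \<Longrightarrow> v \<in> U \<Longrightarrow> u \<oplus>\<^bsub>M\<^esub> v \<in> U"
      "\<And>c v. v \<in> U \<Longrightarrow> c \<odot>\<^bsub>M\<^esub> v \<in> U"
    using assms(4) unfolding M.submodule_iff by auto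
  have "f u \<oplus>\<^bsub>N\<^esub> f v \<in> f ` U" if "u \<in> U" "v \<in> U" for u v
    using is_linearD(2)[OF assms(1), of u v] U that by (metis image_eqI subsetD)
  moreover have "c \<odot>\<^bsub>N\<^esub> f u \<in> f ` U" if "u \<in> U" for c u
    using is_linearD(3)[OF assms(1), of u c] U that by (metis image_eqI subsetD)
  moreover have "f ` U \<subseteq> carrier N"
    using is_linearD(1)[OF assms(1)] U(1) by auto
  moreover have "\<zero>\<^bsub>N\<^esub> \<in> f ` U"
    using is_linear_zero[OF assms(1-3)] U(2) by (metis image_eqI)
  ultimately show ?thesis
    unfolding N.submodule_iff by auto
qed

text \<open>
  The image of the generated subspace is stable and contains the image of the generators; its
  preimage has the same two properties. Taken with an empty index set, this covers linear spans.
\<close>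

lemma generated_image:
  assumes f: "f \<in> rep_hom M N" and "is_rep M" "is_rep N" and S: "S \<subseteq> carrier M"
  shows "generated N I (f ` S) = f ` generated M I S"
proof
  interpret M: representation M using assms by unfold_locales
  interpret N: representation N using assms by unfold_locales
  note lin = rep_homD(2)[OF f]
  have sub: "generated M I S \<subseteq> carrier M" by (rule M.generated_subset_carrier[OF S])
  have fS: "f ` S \<subseteq> carrier N" using S rep_homD(3)[OF f] by auto
  show "generated N I (f ` S) \<subseteq> f ` generated M I S"
  proof (rule generated_least)
    show "submodule (f ` generated M I S) complex_ring N"
      by (rule submodule_image[OF lin assms(2,3) M.generated_submodule[OF S]])
    show "act N i ` f ` generated M I S \<subseteq> f ` generated M I S" if "i \<in> I" for i
      using rep_homD(6)[OF f] sub generated_stable[OF that]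
      by (smt (verit, ccfv_threshold) image_iff image_subset_iff subset_iff)
    show "f ` S \<subseteq> f ` generated M I S"
      using generated_superset[of S M I] by blast
  qed
  have "generated M I S \<subseteq> {v \<in> carrier M. f v \<in> generated N I (f ` S)}"
  proof (rule generated_least)
    show "submodule {v \<in> carrier M. f v \<in> generated N I (f ` S)} complex_ring M"
      by (rule submodule_vimage[OF lin assms(2,3) N.generated_submodule[OF fS]])
    show "S \<subseteq> {v \<in> carrier M. f v \<in> generated N I (f ` S)}"
      using S generated_superset[of "f ` S" N I] by auto
  qed (auto simp: rep_homD(6)[OF f] intro: generated_stable)
  then show "f ` generated M I S \<subseteq> generated N I (f ` S)" by blast
qed

section \<open>Finite-dimensional spaces\<close>

context representation begin

lemma generated_insert_subset:
  assumes s: "s \<in> carrier M" and S: "S \<subseteq> carrier M"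
  shows "generated M {} (insert s S) \<subseteq> {c \<odot> s \<oplus> q |c q. q \<in> generated M {} S}"
proof (rule generated_least)
  let ?Q = "generated M {} S"
  have Q: "submodule ?Q complex_ring M" by (rule generated_submodule[OF S])
  note [simp] = submoduleD(2-4)[OF Q] and Q1 = subsetD[OF submoduleD(1)[OF Q]]
  show "submodule {c \<odot> s \<oplus> q |c q. q \<in> ?Q} complex_ring M"
    unfolding submodule_iff
  proof (intro conjI ballI allI)
    show "\<zero> \<in> {c \<odot> s \<oplus> q |c q. q \<in> ?Q}"
      using s by (intro CollectI exI[of _ 0] exI[of _ "\<zero>"]) auto
  next
    fix v w assume "v \<in> {c \<odot> s \<oplus> q |c q. q \<in> ?Q}" "w \<in> {c \<odot> s \<oplus> q |c q. q \<in> ?Q}"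
    then obtain a p b q where "v = a \<odot> s \<oplus> p" "w = b \<odot> s \<oplus> q" "p \<in> ?Q" "q \<in> ?Q" by blast
    then show "v \<oplus> w \<in> {c \<odot> s \<oplus> q |c q. q \<in> ?Q}"
      using s Q1 by (intro CollectI exI[of _ "a + b"] exI[of _ "p \<oplus> q"])
        (auto simp: scale_add_left M.a_ac)
  next
    fix c v assume "v \<in> {c \<odot> s \<oplus> q |c q. q \<in> ?Q}"
    then obtain a p where "v = a \<odot> s \<oplus> p" "p \<in> ?Q" by blast
    then show "c \<odot> v \<in> {c \<odot> s \<oplus> q |c q. q \<in> ?Q}"
      using s Q1 by (intro CollectI exI[of _ "c * a"] exI[of _ "c \<odot> p"])
        (auto simp: scale_add_right scale_scale)
  qed (use s Q1 in auto)
  have "s = 1 \<odot> s \<oplus> \<zero>" "q = 0 \<odot> s \<oplus> q" if "q \<in> ?Q" for q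
    using s Q1[OF that] by auto
  moreover have "\<zero> \<in> ?Q" by simp
  ultimately show "insert s S \<subseteq> {c \<odot> s \<oplus> q |c q. q \<in> ?Q}"
    using generated_superset[of S M "{}"] by blast
qed auto

text \<open>
  Induction on the spanning set: modulo its part inside the span of \<open>S\<close>, a subspace of the span of
  \<open>insert s S\<close> is at most one-dimensional, hence one more generator is enough.
\<close>

lemma finite_dim_subspace:
  assumes "finite S" "S \<subseteq> carrier M" "submodule U complex_ring M" "U \<subseteq> generated M {} S"
  shows "finite_dim M U"
  using assms
proof (induction S arbitrary: U rule: finite_induct)
  case empty
  have "generated M {} {} \<subseteq> {\<zero>}"
    by (rule generated_least) (auto simp: submodule_iff)
  moreover have "\<zero> \<in> U" "\<zero> \<in> generated M {} {}"
    using empty generated_submodule[of "{}" "{}"] by (simp_all add: submodule_iff)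
  ultimately have "U = generated M {} {}"
    using empty by auto
  then show ?case
    unfolding finite_dim_def by (intro exI[of _ "{}"]) auto
next
  case (insert s S)
  let ?Q = "generated M {} S"
  have s: "s \<in> carrier M" and S: "S \<subseteq> carrier M" using insert by auto
  have Q: "submodule ?Q complex_ring M" by (rule generated_submodule[OF S])
  note U = submoduleD[OF insert.prems(2)] and Qs = submoduleD[OF Q]
  have "submodule (U \<inter> ?Q) complex_ring M"
    using insert.prems(2) Q unfolding submodule_iff by auto
  then have "finite_dim M (U \<inter> ?Q)"
    using insert.IH[OF S] by simp
  then obtain T where T: "finite T" "T \<subseteq> carrier M" "generated M {} T = U \<inter> ?Q"
    unfolding finite_dim_def by blast
  have dec: "\<exists>c q. u = c \<odot> s \<oplus> q \<and> q \<in> ?Q" if "u \<in> U" for u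
    using generated_insert_subset[OF s S] insert.prems(3) that by blast
  show ?case
  proof (cases "U \<subseteq> ?Q")
    case True
    then have "U \<inter> ?Q = U" by blast
    then show ?thesis using \<open>finite_dim M (U \<inter> ?Q)\<close> by simp
  next
    case False
    then obtain u where u: "u \<in> U" "u \<notin> ?Q" by blast
    obtain c q where cq: "u = c \<odot> s \<oplus> q" "q \<in> ?Q" using dec[OF u(1)] by blast
    have c: "c \<noteq> 0"
    proof
      assume "c = 0"
      then have "u = q" using cq s Qs(1) by auto
      then show False using u cq by simp
    qed
    let ?W = "generated M {} (insert u T)"
    have W: "submodule ?W complex_ring M"
      using u U(1) T by (intro generated_submodule) auto
    have "U \<subseteq> ?W"
    proof
      fix v assume v: "v \<in> U"
      obtain a r where ar: "v = a \<odot> s \<oplus> r" "r \<in> ?Q" using dec[OF v] by blast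
      have carr: "r \<in> carrier M" "q \<in> carrier M" using ar cq Qs(1) by auto
      \<comment> \<open>Subtracting this multiple of \<open>u\<close> removes the component of \<open>v\<close> along \<open>s\<close>.\<close>
      let ?t = "- (a / c)"
      have uv: "u \<in> carrier M" "v \<in> carrier M" using u(1) v U(1) by auto
      have "?t \<odot> u = (- a) \<odot> s \<oplus> ?t \<odot> q"
        using cq carr s c by (simp add: scale_add_right scale_scale)
      then have "v \<oplus> ?t \<odot> u = (a \<odot> s \<oplus> (- a) \<odot> s) \<oplus> (r \<oplus> ?t \<odot> q)"
        using ar carr s by (simp add: M.a_ac)
      also have "a \<odot> s \<oplus> (- a) \<odot> s = \<zero>"
        using s by (simp flip: scale_add_left)
      finally have "v \<oplus> ?t \<odot> u = r \<oplus> ?t \<odot> q" using carr by simp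
      then have "v \<oplus> ?t \<odot> u \<in> U \<inter> ?Q"
        using Qs ar cq U v u(1) by (metis IntI)
      also have "\<dots> = generated M {} T" using T(3) by simp
      also have "\<dots> \<subseteq> ?W"
        unfolding generated_def by (rule Inter_anti_mono) auto
      finally have "v \<oplus> ?t \<odot> u \<in> ?W" .
      moreover have "u \<in> ?W" using generated_superset[of "insert u T" M "{}"] by blast
      ultimately have "(v \<oplus> ?t \<odot> u) \<oplus> (a / c) \<odot> u \<in> ?W"
        using submoduleD(3,4)[OF W] by blast
      also have "(v \<oplus> ?t \<odot> u) \<oplus> (a / c) \<odot> u = v \<oplus> (?t \<odot> u \<oplus> (a / c) \<odot> u)"
        using uv by (simp add: M.a_ac)
      also have "?t \<odot> u \<oplus> (a / c) \<odot> u = \<zero>"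
        using uv by (simp flip: scale_add_left)
      finally show "v \<in> ?W" using uv by simp
    qed
    moreover have "?W \<subseteq> U"
      using insert.prems(2) u T(3) generated_superset[of T M "{}"]
      by (intro generated_least) auto
    ultimately have "?W = U" by blast
    then show ?thesis
      unfolding finite_dim_def using T u U(1) by (intro exI[of _ "insert u T"]) auto
  qed
qed

text \<open>
  Linear combinations of a finite set depend on finitely many coefficients; an infinite sequence of
  coefficients serves all finite sets at once.
\<close>

lemma generated_parametrized:
  assumes "finite S" "S \<subseteq> carrier M"
  shows "\<exists>e :: (nat \<Rightarrow> complex) \<Rightarrow> 'v. generated M {} S \<subseteq> range e"
  using assms
proof (induction S rule: finite_induct)
  case empty
  have "generated M {} {} \<subseteq> {\<zero>}"
    by (rule generated_least) (auto simp: submodule_iff)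
  then show ?case by (intro exI[of _ "\<lambda>_. \<zero>"]) auto
next
  case (insert s S)
  then obtain e :: "(nat \<Rightarrow> complex) \<Rightarrow> 'v" where e: "generated M {} S \<subseteq> range e" by auto
  let ?e = "\<lambda>c. c 0 \<odot> s \<oplus> e (\<lambda>n. c (Suc n))"
  have "c \<odot> s \<oplus> q \<in> range ?e" if q: "q \<in> generated M {} S" for c q
  proof -
    obtain b where "q = e b" using q e by blast
    then show ?thesis by (intro image_eqI[of _ _ "case_nat c b"]) auto
  qed
  then have "{c \<odot> s \<oplus> q |c q. q \<in> generated M {} S} \<subseteq> range ?e" by blast
  with generated_insert_subset[of s S] insert.prems have "generated M {} (insert s S) \<subseteq> range ?e"
    by (meson insert_subset subset_trans)
  then show ?case by (intro exI[of _ ?e])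
qed

end

lemma finite_dim_embedding:
  fixes M :: "('i, 'v) rep"
  assumes "is_rep M" "finite_dim M (carrier M)"
  shows "\<exists>\<gamma> :: 'v \<Rightarrow> nat \<Rightarrow> complex. inj_on \<gamma> (carrier M)"
proof -
  interpret representation M using assms by unfold_locales
  obtain S where "finite S" "S \<subseteq> carrier M" "generated M {} S = carrier M"
    using assms unfolding finite_dim_def by blast
  with generated_parametrized[of S] obtain e :: "(nat \<Rightarrow> complex) \<Rightarrow> 'v" where "carrier M \<subseteq> range e"
    by auto
  then show ?thesis
    by (intro exI[of _ "inv_into UNIV e"]) (rule inj_on_inv_into)
qed


section \<open>Isomorphisms and transport of structure\<close>

definition isomorphism :: "('v \<Rightarrow> 'w) \<Rightarrow> ('i, 'v) rep \<Rightarrow> ('i, 'w) rep \<Rightarrow> bool" where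
  "isomorphism h M N \<longleftrightarrow> is_rep M \<and> is_rep N \<and> h \<in> rep_hom M N \<and> bij_betw h (carrier M) (carrier N)"

lemma isomorphismD:
  assumes "isomorphism h M N"
  shows "is_rep M" "is_rep N" "h \<in> rep_hom M N" "bij_betw h (carrier M) (carrier N)"
    "inj_on h (carrier M)" "h ` carrier M = carrier N"
  using assms by (auto simp: isomorphism_def bij_betw_def)

definition inverse_hom :: "('v \<Rightarrow> 'w) \<Rightarrow> ('i, 'v) rep \<Rightarrow> ('i, 'w) rep \<Rightarrow> 'w \<Rightarrow> 'v" where
  "inverse_hom h M N = restrict (inv_into (carrier M) h) (carrier N)"

lemma inverse_hom:
  assumes "isomorphism h M N"
  shows "isomorphism (inverse_hom h M N) N M"
    and "v \<in> carrier M \<Longrightarrow> inverse_hom h M N (h v) = v"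
    and "w \<in> carrier N \<Longrightarrow> h (inverse_hom h M N w) = w"
    and "w \<in> carrier N \<Longrightarrow> inverse_hom h M N w \<in> carrier M"
proof -
  note h = isomorphismD[OF assms]
  show "isomorphism (inverse_hom h M N) N M"
    unfolding isomorphism_def inverse_hom_def
    using h rep_hom_inverse[OF h(3,4,1,2)] bij_betw_inv_into[OF h(4)]
    by (simp add: bij_betw_cong[of "carrier N" "restrict (inv_into (carrier M) h) (carrier N)" "inv_into (carrier M) h"])
  show "v \<in> carrier M \<Longrightarrow> inverse_hom h M N (h v) = v"
    using h by (auto simp: inverse_hom_def inv_into_f_f)
  show "w \<in> carrier N \<Longrightarrow> h (inverse_hom h M N w) = w"
    using h by (simp add: inverse_hom_def f_inv_into_f)
  show "w \<in> carrier N \<Longrightarrow> inverse_hom h M N w \<in> carrier M"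
    using h by (metis inverse_hom_def inv_into_into restrict_apply')
qed

text \<open>
  The structure that makes the injection \<open>j\<close> an isomorphism onto its image.
\<close>

definition transport :: "('v \<Rightarrow> 'w) \<Rightarrow> ('i, 'v) rep \<Rightarrow> ('i, 'w) rep" where
  "transport j M = (let g = inv_into (carrier M) j in
     \<lparr>carrier = j ` carrier M, mult = undefined, one = undefined, zero = j \<zero>\<^bsub>M\<^esub>,
      add = \<lambda>v w. j (g v \<oplus>\<^bsub>M\<^esub> g w), smult = \<lambda>c v. j (c \<odot>\<^bsub>M\<^esub> g v), act = \<lambda>i v. j (act M i (g v))\<rparr>)"

lemma transport_isomorphism:
  assumes "is_rep M" and inj: "inj_on j (carrier M)"
  shows "isomorphism (restrict j (carrier M)) M (transport j M)"
proof -
  interpret representation M using assms by unfold_locales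
  note [simp] = inv_into_f_f[OF inj]
  let ?T = "transport j M"
  have [simp]: "carrier ?T = j ` carrier M" "zero ?T = j \<zero>\<^bsub>M\<^esub>"
    "v \<in> carrier M \<Longrightarrow> w \<in> carrier M \<Longrightarrow> j v \<oplus>\<^bsub>?T\<^esub> j w = j (v \<oplus>\<^bsub>M\<^esub> w)"
    "v \<in> carrier M \<Longrightarrow> c \<odot>\<^bsub>?T\<^esub> j v = j (c \<odot>\<^bsub>M\<^esub> v)"
    "v \<in> carrier M \<Longrightarrow> act ?T i (j v) = j (act M i v)" for v w c i
    by (simp_all add: transport_def Let_def)
  have act: "act M i (v \<oplus>\<^bsub>M\<^esub> w) = act M i v \<oplus>\<^bsub>M\<^esub> act M i w"
    "act M i (c \<odot>\<^bsub>M\<^esub> v) = c \<odot>\<^bsub>M\<^esub> act M i v" if "v \<in> carrier M" "w \<in> carrier M" for i v w c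
    using is_linearD[OF act_linear] that by auto
  have "is_rep ?T"
    by (rule is_repI) (auto simp: M.a_ac scale_add_left scale_add_right scale_scale
        is_linear_def act)
  moreover have "restrict j (carrier M) \<in> rep_hom M ?T"
    by (rule rep_homI) auto
  moreover have "bij_betw (restrict j (carrier M)) (carrier M) (carrier ?T)"
    using inj by (auto simp: bij_betw_def inj_on_def)
  ultimately show ?thesis
    using assms by (simp add: isomorphism_def)
qed

section \<open>Invariance of the block under isomorphism\<close>

lemma finsum_linear:
  assumes f: "is_linear M N f" "is_rep M" "is_rep N" and "finite A" "g \<in> A \<rightarrow> carrier M"
  shows "f (\<Oplus>\<^bsub>M\<^esub>x\<in>A. g x) = (\<Oplus>\<^bsub>N\<^esub>x\<in>A. f (g x))"
proof -
  interpret M: representation M using assms by unfold_locales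
  interpret N: representation N using assms by unfold_locales
  show ?thesis
    using assms(4,5)
  proof (induction A rule: finite_induct)
    case empty
    then show ?case using is_linear_zero[OF f] by simp
  next
    case (insert x A)
    then have "f (g y) \<in> carrier N" if "y \<in> insert x A" for y
      using is_linearD(1)[OF f(1)] that by blast
    with insert show ?case
      by (simp add: Pi_iff is_linearD(2)[OF f(1)] M.finsum_closed)
  qed
qed

lemma isomorphism_zero_iff:
  assumes "isomorphism h M N" "v \<in> carrier M"
  shows "h v = \<zero>\<^bsub>N\<^esub> \<longleftrightarrow> v = \<zero>\<^bsub>M\<^esub>"
proof -
  note h = isomorphismD[OF assms(1)]
  interpret M: representation M using h by unfold_locales
  show ?thesis
    using rep_hom_zero[OF h(3,1,2)] inj_onD[OF h(5), of v "\<zero>\<^bsub>M\<^esub>"] assms by auto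
qed

lemma weight_space_isomorphism:
  assumes h: "isomorphism h M N"
  shows "v \<in> weight_space M \<mu> \<Longrightarrow> h v \<in> weight_space N \<mu>"
  using isomorphismD(3)[OF h]
  by (auto simp: weight_space_def rep_homD(3,5) simp flip: rep_homD(6))

text \<open>
  The unique existence of \<open>f\<close> for every \<open>v\<close> is the definition of a weight module.
\<close>

definition weight_decomposition ::
    "(complex poly, 'v) rep \<Rightarrow> 'v \<Rightarrow> (complex \<Rightarrow> 'v) \<Rightarrow> bool" where
  "weight_decomposition M v f \<longleftrightarrow> (\<forall>\<mu>. f \<mu> \<in> weight_space M \<mu>) \<and> finite {\<mu>. f \<mu> \<noteq> \<zero>\<^bsub>M\<^esub>} \<and>
     v = (\<Oplus>\<^bsub>M\<^esub>\<mu>\<in>{\<mu>. f \<mu> \<noteq> \<zero>\<^bsub>M\<^esub>}. f \<mu>)"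

lemma weight_decomposition_isomorphism:
  assumes h: "isomorphism h M N" and f: "weight_decomposition M v f"
  shows "weight_decomposition N (h v) (h \<circ> f)"
proof -
  note hD = isomorphismD[OF h]
  have carr: "f \<mu> \<in> carrier M" for \<mu>
    using f by (auto simp: weight_decomposition_def weight_space_def)
  have supp: "{\<mu>. h (f \<mu>) \<noteq> \<zero>\<^bsub>N\<^esub>} = {\<mu>. f \<mu> \<noteq> \<zero>\<^bsub>M\<^esub>}"
    using isomorphism_zero_iff[OF h carr] by simp
  have "h v = (\<Oplus>\<^bsub>N\<^esub>\<mu>\<in>{\<mu>. f \<mu> \<noteq> \<zero>\<^bsub>M\<^esub>}. h (f \<mu>))"
    using f finsum_linear[OF rep_homD(2)[OF hD(3)] hD(1,2), of "{\<mu>. f \<mu> \<noteq> \<zero>\<^bsub>M\<^esub>}" f] carr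
    unfolding weight_decomposition_def by auto
  then show ?thesis
    using f weight_space_isomorphism[OF h] by (simp add: weight_decomposition_def supp)
qed

lemma weight_module_isomorphism:
  assumes h: "isomorphism h M N" and M: "weight_module M"
  shows "weight_module N"
proof -
  define g where "g = inverse_hom h M N"
  note g = inverse_hom[OF h, folded g_def]
  have "\<exists>!f. weight_decomposition N v f" if v: "v \<in> carrier N" for v
  proof -
    have "\<exists>!f. weight_decomposition M (g v) f"
      using M g(4)[OF v] unfolding weight_module_def weight_decomposition_def by blast
    then obtain f where f: "weight_decomposition M (g v) f"
      and uniq: "\<And>f'. weight_decomposition M (g v) f' \<Longrightarrow> f' = f" by blast
    show ?thesis
    proof (rule ex1I)
      show "weight_decomposition N v (h \<circ> f)"
        using weight_decomposition_isomorphism[OF h f] g(3)[OF v] by simp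
    next
      fix f' assume f': "weight_decomposition N v f'"
      then have "g \<circ> f' = f"
        using weight_decomposition_isomorphism[OF g(1)] uniq by blast
      moreover have "f' \<mu> \<in> carrier N" for \<mu>
        using f' by (auto simp: weight_decomposition_def weight_space_def)
      ultimately show "f' = h \<circ> f" using g(3) by (metis comp_apply ext)
    qed
  qed
  then show ?thesis
    unfolding weight_module_def weight_decomposition_def by blast
qed

lemma Supp_isomorphism:
  assumes h: "isomorphism h M N"
  shows "Supp N \<subseteq> Supp M"
proof
  fix \<mu> assume mu: "\<mu> \<in> Supp N"
  define g where "g = inverse_hom h M N"
  note g = inverse_hom[OF h, folded g_def]
  interpret N: representation N using isomorphismD(2)[OF h] by unfold_locales
  interpret M: representation M using isomorphismD(1)[OF h] by unfold_locales
  have "\<zero>\<^bsub>N\<^esub> \<in> weight_space N \<mu>"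
    using is_linear_zero[OF N.act_linear N.is_rep N.is_rep] by (simp add: weight_space_def)
  then obtain v where v: "v \<in> weight_space N \<mu>" "v \<noteq> \<zero>\<^bsub>N\<^esub>"
    using mu unfolding Supp_def by blast
  then have "g v \<in> weight_space M \<mu>" "g v \<noteq> \<zero>\<^bsub>M\<^esub>"
    using weight_space_isomorphism[OF g(1)] isomorphism_zero_iff[OF g(1)]
    by (auto simp: weight_space_def)
  then show "\<mu> \<in> Supp M" by (auto simp: Supp_def)
qed

lemma finite_dim_isomorphism:
  assumes h: "isomorphism h M N" and "finite_dim M U"
  shows "finite_dim N (h ` U)"
proof -
  note hD = isomorphismD[OF h]
  obtain S where "finite S" "S \<subseteq> carrier M" "generated M {} S = U"
    using assms(2) unfolding finite_dim_def by blast
  then show ?thesis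
    unfolding finite_dim_def using generated_image[OF hD(3,1,2), of S] hD(6)
    by (intro exI[of _ "h ` S"]) blast
qed

lemma rep_hom_diff:
  assumes "f \<in> rep_hom M N" "is_rep M" "is_rep N" "v \<in> carrier M" "w \<in> carrier M"
  shows "f (v \<ominus>\<^bsub>M\<^esub> w) = f v \<ominus>\<^bsub>N\<^esub> f w"
proof -
  interpret M: representation M using assms by unfold_locales
  interpret N: representation N using assms by unfold_locales
  show ?thesis
    using assms by (simp add: a_minus_def rep_homD flip: M.scale_minus_one N.scale_minus_one)
qed

lemma witt_module_isomorphism:
  assumes h: "isomorphism h M N" and M: "witt_module M"
  shows "witt_module N"
proof -
  note hD = isomorphismD[OF h]
  interpret M: representation M using hD by unfold_locales
  have act: "act N p (h v) = h (act M p v)" if "v \<in> carrier M" for p v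
    using rep_homD(6)[OF hD(3) that] by simp
  show ?thesis
    unfolding witt_module_def hD(6)[symmetric]
  proof (intro conjI allI ballI; (elim imageE)?)
    show "is_rep N" by (rule hD(2))
  next
    fix p q v w assume w: "w \<in> carrier M" and "v = h w"
    then show "act N (p + q) v = act N p v \<oplus>\<^bsub>N\<^esub> act N q v"
      "act N (bracket p q) v = act N p (act N q v) \<ominus>\<^bsub>N\<^esub> act N q (act N p v)"
      using M by (simp_all add: act witt_module_def rep_homD(4)[OF hD(3)] rep_hom_diff[OF hD(3,1,2)])
  next
    fix c p v w assume w: "w \<in> carrier M" and "v = h w"
    then show "act N (Polynomial.smult c p) v = c \<odot>\<^bsub>N\<^esub> act N p v"
      using M by (simp add: act witt_module_def rep_homD(5)[OF hD(3)])
  qed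
qed

lemma block_O_isomorphism:
  assumes h: "isomorphism h M N" and M: "M \<in> block_O \<mu>"
  shows "N \<in> block_O \<mu>"
proof -
  note hD = isomorphismD[OF h]
  have O: "witt_module M" "weight_module M" "Supp M \<subseteq> {\<mu> + of_int n | n. True}"
    "\<And>v. v \<in> carrier M \<Longrightarrow> finite_dim M (generated M witt_plus {v})"
    using M by (auto simp: block_O_def category_O_def)
  obtain S where S: "finite S" "S \<subseteq> carrier M" "generated M UNIV S = carrier M"
    using M by (auto simp: block_O_def category_O_def)
  have "finite_dim N (generated N witt_plus {v})" if v: "v \<in> carrier N" for v
  proof -
    obtain w where w: "w \<in> carrier M" "v = h w" using v hD(6) by blast
    then show ?thesis
      using finite_dim_isomorphism[OF h O(4)[OF w(1)]] generated_image[OF hD(3,1,2), of "{w}"]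
      by simp
  qed
  moreover have "generated N UNIV (h ` S) = carrier N"
    using generated_image[OF hD(3,1,2) S(2), of UNIV] S(3) hD(6) by simp
  moreover have "h ` S \<subseteq> carrier N" using S(2) hD(6) by blast
  ultimately show ?thesis
    using witt_module_isomorphism[OF h O(1)] weight_module_isomorphism[OF h O(2)]
      Supp_isomorphism[OF h] O(3) S(1)
    by (auto simp: block_O_def category_O_def)
qed

text \<open>
  Applied to a sum of weight vectors, the projection to weight \<open>\<eta>\<close> returns the summand of that weight, so
  a decomposition is unique. For existence, \<open>v\<close> minus the sum of its projections is annihilated by
  all projections, hence zero.
\<close>

lemma weight_moduleI:
  fixes \<pi> :: "complex \<Rightarrow> 'v \<Rightarrow> 'v"
  assumes "is_rep M"
    and lin: "\<And>\<eta>. is_linear M M (\<pi> \<eta>)"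
    and range: "\<And>\<eta> v. v \<in> carrier M \<Longrightarrow> \<pi> \<eta> v \<in> weight_space M \<eta>"
    and fixed: "\<And>\<eta> v. v \<in> weight_space M \<eta> \<Longrightarrow> \<pi> \<eta> v = v"
    and fin: "\<And>v. v \<in> carrier M \<Longrightarrow> finite {\<eta>. \<pi> \<eta> v \<noteq> \<zero>\<^bsub>M\<^esub>}"
    and other: "\<And>\<eta> \<theta> v. v \<in> weight_space M \<theta> \<Longrightarrow> \<eta> \<noteq> \<theta> \<Longrightarrow> \<pi> \<eta> v = \<zero>\<^bsub>M\<^esub>"
    and sep: "\<And>v. v \<in> carrier M \<Longrightarrow> (\<And>\<eta>. \<pi> \<eta> v = \<zero>\<^bsub>M\<^esub>) \<Longrightarrow> v = \<zero>\<^bsub>M\<^esub>"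
  shows "weight_module M"
proof -
  interpret representation M using assms(1) by unfold_locales
  have carr: "v \<in> carrier M" if "v \<in> weight_space M \<eta>" for v \<eta>
    using that by (simp add: weight_space_def)
  have proj_sum: "\<pi> \<eta> (\<Oplus>\<^bsub>M\<^esub>\<theta>\<in>{\<theta>. f \<theta> \<noteq> \<zero>\<^bsub>M\<^esub>}. f \<theta>) = f \<eta>"
    if f: "\<And>\<theta>. f \<theta> \<in> weight_space M \<theta>" and finf: "finite {\<theta>. f \<theta> \<noteq> \<zero>\<^bsub>M\<^esub>}" for f \<eta>
  proof -
    let ?A = "{\<theta>. f \<theta> \<noteq> \<zero>\<^bsub>M\<^esub>}"
    have "\<pi> \<eta> (\<Oplus>\<^bsub>M\<^esub>\<theta>\<in>?A. f \<theta>) = (\<Oplus>\<^bsub>M\<^esub>\<theta>\<in>?A. \<pi> \<eta> (f \<theta>))"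
      using finsum_linear[OF lin is_rep is_rep finf] carr[OF f] by blast
    also have "\<dots> = (\<Oplus>\<^bsub>M\<^esub>\<theta>\<in>?A. if \<eta> = \<theta> then f \<theta> else \<zero>\<^bsub>M\<^esub>)"
      using fixed[OF f] other[OF f] carr[OF f] by (intro finsum_cong') auto
    also have "\<dots> = f \<eta>"
    proof (cases "f \<eta> = \<zero>\<^bsub>M\<^esub>")
      case True
      then have "(\<Oplus>\<^bsub>M\<^esub>\<theta>\<in>?A. if \<eta> = \<theta> then f \<theta> else \<zero>\<^bsub>M\<^esub>) = (\<Oplus>\<^bsub>M\<^esub>\<theta>\<in>?A. \<zero>\<^bsub>M\<^esub>)"
        by (intro finsum_cong') auto
      then show ?thesis using True by simp
    next
      case False
      then show ?thesis
        using finsum_singleton[of \<eta> ?A f] finf carr[OF f] by auto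
    qed
    finally show ?thesis .
  qed
  have "\<exists>!f. weight_decomposition M v f" if v: "v \<in> carrier M" for v
  proof (rule ex1I)
    let ?A = "{\<eta>. \<pi> \<eta> v \<noteq> \<zero>\<^bsub>M\<^esub>}"
    define s where "s = (\<Oplus>\<^bsub>M\<^esub>\<eta>\<in>?A. \<pi> \<eta> v)"
    have s: "s \<in> carrier M"
      unfolding s_def using carr[OF range[OF v]] by (intro finsum_closed) auto
    have "\<pi> \<eta> s = \<pi> \<eta> v" for \<eta>
      unfolding s_def by (rule proj_sum) (use range[OF v] fin[OF v] in auto)
    then have "\<pi> \<eta> (v \<oplus>\<^bsub>M\<^esub> (-1) \<odot>\<^bsub>M\<^esub> s) = \<zero>\<^bsub>M\<^esub>" for \<eta>
      using v s M.r_neg[of "\<pi> \<eta> v"]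
      by (simp add: is_linearD[OF lin]) (simp add: scale_minus_one is_linearD(1)[OF lin])
    then have "v \<oplus>\<^bsub>M\<^esub> (-1) \<odot>\<^bsub>M\<^esub> s = \<zero>\<^bsub>M\<^esub>"
      using sep v s by simp
    then have "v = s"
      using v s by (metis M.add.inv_closed M.minus_equality M.minus_minus scale_minus_one M.a_comm)
    then show "weight_decomposition M v (\<lambda>\<eta>. \<pi> \<eta> v)"
      unfolding weight_decomposition_def using range[OF v] fin[OF v] by (simp add: s_def)
  next
    fix f assume "weight_decomposition M v f"
    then show "f = (\<lambda>\<eta>. \<pi> \<eta> v)"
      using proj_sum unfolding weight_decomposition_def by auto
  qed
  then show ?thesis
    unfolding weight_module_def weight_decomposition_def by blast
qed

section \<open>Fully faithful exact functors\<close>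

definition fully_faithful ::
    "('i, 'v) rep set \<Rightarrow> (('i, 'v) rep \<Rightarrow> ('j, 'w) rep) \<Rightarrow>
     (('i, 'v) rep \<Rightarrow> ('i, 'v) rep \<Rightarrow> ('v \<Rightarrow> 'v) \<Rightarrow> ('w \<Rightarrow> 'w)) \<Rightarrow> bool" where
  "fully_faithful \<C> F \<Phi> \<longleftrightarrow>
     (\<forall>M\<in>\<C>. \<forall>N\<in>\<C>. bij_betw (\<Phi> M N) (rep_hom M N) (rep_hom (F M) (F N)))"

lemma rep_hom_eqI:
  assumes "f \<in> rep_hom M N" "g \<in> rep_hom M N'" "\<And>v. v \<in> carrier M \<Longrightarrow> f v = g v"
  shows "f = g"
  using assms rep_homD(1) by (metis extensionalityI)

lemma rep_hom_zero_map:
  assumes "is_rep M" "is_rep N"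
  shows "(\<lambda>v\<in>carrier M. \<zero>\<^bsub>N\<^esub>) \<in> rep_hom M N"
proof -
  interpret M: representation M using assms by unfold_locales
  interpret N: representation N using assms by unfold_locales
  show ?thesis
    by (rule rep_homI) (auto simp: is_linear_zero[OF N.act_linear N.is_rep N.is_rep])
qed

lemma subrepD:
  assumes "subrep M U" "is_rep M"
  shows "U \<subseteq> carrier M" "\<zero>\<^bsub>M\<^esub> \<in> U" "v \<in> U \<Longrightarrow> w \<in> U \<Longrightarrow> v \<oplus>\<^bsub>M\<^esub> w \<in> U"
    "v \<in> U \<Longrightarrow> c \<odot>\<^bsub>M\<^esub> v \<in> U" "v \<in> U \<Longrightarrow> act M i v \<in> U"
proof -
  interpret representation M using assms by unfold_locales
  show "U \<subseteq> carrier M" "\<zero>\<^bsub>M\<^esub> \<in> U" "v \<in> U \<Longrightarrow> w \<in> U \<Longrightarrow> v \<oplus>\<^bsub>M\<^esub> w \<in> U"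
    "v \<in> U \<Longrightarrow> c \<odot>\<^bsub>M\<^esub> v \<in> U" "v \<in> U \<Longrightarrow> act M i v \<in> U"
    using assms(1) unfolding subrep_def submodule_iff by blast+
qed

lemma subrep_equalizer:
  assumes "f \<in> rep_hom M N" "g \<in> rep_hom M N" "is_rep M" "is_rep N"
  shows "subrep M {v \<in> carrier M. f v = g v}"
proof -
  interpret M: representation M using assms by unfold_locales
  show ?thesis
    using assms by (auto simp: subrep_def M.submodule_iff rep_homD rep_hom_zero)
qed

lemma in_set_add_iff: "v \<in> U <+>\<^bsub>M\<^esub> V \<longleftrightarrow> (\<exists>u\<in>U. \<exists>w\<in>V. v = u \<oplus>\<^bsub>M\<^esub> w)"
  by (auto simp: set_add_defs)

text \<open>
  A decomposition into two subrepresentations is encoded by the idempotent endomorphism that projects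
  onto the first one.
\<close>

lemma projection_along_complement:
  assumes "is_rep M" and U: "subrep M U" and V: "subrep M V"
    and int: "U \<inter> V = {\<zero>\<^bsub>M\<^esub>}" and sum: "U <+>\<^bsub>M\<^esub> V = carrier M"
  obtains e where "e \<in> rep_hom M M" "\<And>v. v \<in> U \<Longrightarrow> e v = v" "\<And>v. v \<in> V \<Longrightarrow> e v = \<zero>\<^bsub>M\<^esub>"
    "\<And>v. v \<in> carrier M \<Longrightarrow> e v \<in> U"
proof -
  interpret representation M using assms by unfold_locales
  note Ud = subrepD[OF U is_rep] and Vd = subrepD[OF V is_rep]
  define e where "e = (\<lambda>v\<in>carrier M. THE u. u \<in> U \<and> (\<exists>w\<in>V. v = u \<oplus>\<^bsub>M\<^esub> w))"
  have e: "e (u \<oplus>\<^bsub>M\<^esub> w) = u" if uw: "u \<in> U" "w \<in> V" for u w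
  proof -
    have "u' = u" if u': "u' \<in> U" "w' \<in> V" "u \<oplus>\<^bsub>M\<^esub> w = u' \<oplus>\<^bsub>M\<^esub> w'" for u' w'
    proof -
      have carr: "u \<in> carrier M" "u' \<in> carrier M" "w \<in> carrier M" "w' \<in> carrier M"
        using uw u' Ud(1) Vd(1) by auto
      have "u' \<oplus>\<^bsub>M\<^esub> \<ominus>\<^bsub>M\<^esub> u = (u' \<oplus>\<^bsub>M\<^esub> w') \<oplus>\<^bsub>M\<^esub> \<ominus>\<^bsub>M\<^esub> w' \<oplus>\<^bsub>M\<^esub> \<ominus>\<^bsub>M\<^esub> u"
        using carr by (simp add: M.a_assoc M.r_neg)
      also have "\<dots> = (u \<oplus>\<^bsub>M\<^esub> w) \<oplus>\<^bsub>M\<^esub> \<ominus>\<^bsub>M\<^esub> w' \<oplus>\<^bsub>M\<^esub> \<ominus>\<^bsub>M\<^esub> u"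
        using u'(3) by simp
      also have "\<dots> = (u \<oplus>\<^bsub>M\<^esub> \<ominus>\<^bsub>M\<^esub> u) \<oplus>\<^bsub>M\<^esub> (w \<oplus>\<^bsub>M\<^esub> \<ominus>\<^bsub>M\<^esub> w')"
        using carr by (simp add: M.a_ac del: M.r_neg)
      also have "\<dots> = w \<oplus>\<^bsub>M\<^esub> \<ominus>\<^bsub>M\<^esub> w'"
        using carr by (simp add: M.r_neg)
      finally have eq: "u' \<oplus>\<^bsub>M\<^esub> \<ominus>\<^bsub>M\<^esub> u = w \<oplus>\<^bsub>M\<^esub> \<ominus>\<^bsub>M\<^esub> w'" .
      have "u' \<oplus>\<^bsub>M\<^esub> \<ominus>\<^bsub>M\<^esub> u \<in> U" "w \<oplus>\<^bsub>M\<^esub> \<ominus>\<^bsub>M\<^esub> w' \<in> V"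
        using uw u' carr Ud(3,4) Vd(3,4) by (auto simp flip: scale_minus_one)
      then have "u' \<oplus>\<^bsub>M\<^esub> \<ominus>\<^bsub>M\<^esub> u = \<zero>\<^bsub>M\<^esub>" using eq int by auto
      then show "u' = u" using carr by (metis M.add.inv_closed M.minus_equality M.minus_minus)
    qed
    then show ?thesis
      unfolding e_def using uw Ud(1) Vd(1) by (subst restrict_apply') (auto intro!: the_equality)
  qed
  have dec: "\<exists>u\<in>U. \<exists>w\<in>V. v = u \<oplus>\<^bsub>M\<^esub> w" if "v \<in> carrier M" for v
    using that sum in_set_add_iff[of v M U V] by simp
  have act: "act M i (v \<oplus>\<^bsub>M\<^esub> w) = act M i v \<oplus>\<^bsub>M\<^esub> act M i w" if "v \<in> carrier M" "w \<in> carrier M" for i v w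
    using is_linearD(2)[OF act_linear] that by auto
  show ?thesis
  proof
    show "e \<in> rep_hom M M"
    proof (rule rep_homI)
      show "e \<in> extensional (carrier M)" by (simp add: e_def)
    next
      fix v w assume "v \<in> carrier M" "w \<in> carrier M"
      then obtain a b a' b' where *: "a \<in> U" "b \<in> V" "v = a \<oplus>\<^bsub>M\<^esub> b" "a' \<in> U" "b' \<in> V" "w = a' \<oplus>\<^bsub>M\<^esub> b'"
        using dec by metis
      then have carr: "a \<in> carrier M" "b \<in> carrier M" "a' \<in> carrier M" "b' \<in> carrier M"
        using Ud(1) Vd(1) by auto
      have "v \<oplus>\<^bsub>M\<^esub> w = (a \<oplus>\<^bsub>M\<^esub> a') \<oplus>\<^bsub>M\<^esub> (b \<oplus>\<^bsub>M\<^esub> b')"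
        using * carr by (simp add: M.a_ac)
      then show "e (v \<oplus>\<^bsub>M\<^esub> w) = e v \<oplus>\<^bsub>M\<^esub> e w" using * Ud(3) Vd(3) by (simp add: e)
    next
      fix v assume "v \<in> carrier M"
      then obtain a b where *: "a \<in> U" "b \<in> V" "v = a \<oplus>\<^bsub>M\<^esub> b" using dec by metis
      then have carr: "a \<in> carrier M" "b \<in> carrier M" using Ud(1) Vd(1) by auto
      show "e v \<in> carrier M" using * carr by (simp add: e)
      show "e (c \<odot>\<^bsub>M\<^esub> v) = c \<odot>\<^bsub>M\<^esub> e v" for c
        using * carr Ud(4) Vd(4) by (simp add: e scale_add_right)
      show "e (act M i v) = act M i (e v)" for i
        using * carr Ud(5) Vd(5) by (simp add: e act)
    qed
  next
    show "e v = v" if "v \<in> U" for v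
      using e[OF that Vd(2)] that Ud(1) by (metis M.r_zero subsetD)
    show "e v = \<zero>\<^bsub>M\<^esub>" if "v \<in> V" for v
      using e[OF Ud(2) that] that Vd(1) by (metis M.l_zero subsetD)
    show "e v \<in> U" if "v \<in> carrier M" for v
      using dec[OF that] e by auto
  qed
qed

text \<open>
  Idempotent endomorphisms lift along a fully faithful functor. If \<open>F M\<close> is the direct sum of \<open>U\<close> and
  \<open>V\<close>, the projection onto \<open>U\<close> comes from an idempotent of \<open>M\<close>, which is zero or the identity when \<open>M\<close> is
  indecomposable; so \<open>U\<close> or \<open>V\<close> is zero. In the same way an isomorphism between images comes from a pair of
  homomorphisms that are mutually inverse because the functor is faithful.
\<close>

theorem wild_if_fully_faithful:
  fixes F :: "(free_gen, 'v) rep \<Rightarrow> ('j, 'v) rep"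
  assumes exact: "exact_functor fd_free_reps \<D> F \<Phi>" and ff: "fully_faithful fd_free_reps F \<Phi>"
    and rep: "\<And>N. N \<in> \<D> \<Longrightarrow> is_rep N"
  shows "wild \<D>"
proof -
  let ?C = "fd_free_reps :: (free_gen, 'v) rep set"
  let ?id = "\<lambda>M. \<lambda>v\<in>carrier M. v"
  have repC: "is_rep M" if "M \<in> ?C" for M
    using that by (simp add: fd_free_reps_def)
  have repF: "is_rep (F M)" if "M \<in> ?C" for M
    using exact that rep by (simp add: exact_functor_def is_functor_def)
  have hom: "\<Phi> M N f \<in> rep_hom (F M) (F N)" if "M \<in> ?C" "N \<in> ?C" "f \<in> rep_hom M N" for M N f
    using exact that by (simp add: exact_functor_def is_functor_def)
  have id: "\<Phi> M M (?id M) = ?id (F M)" if "M \<in> ?C" for M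
    using exact that by (simp add: exact_functor_def is_functor_def)
  have comp: "\<Phi> L N (compose (carrier L) g f) = compose (carrier (F L)) (\<Phi> M N g) (\<Phi> L M f)"
    if "L \<in> ?C" "M \<in> ?C" "N \<in> ?C" "f \<in> rep_hom L M" "g \<in> rep_hom M N" for L M N f g
    using exact that by (simp add: exact_functor_def is_functor_def)
  have full: "\<exists>f\<in>rep_hom M N. \<Phi> M N f = g" if "M \<in> ?C" "N \<in> ?C" "g \<in> rep_hom (F M) (F N)" for M N g
  proof -
    have "g \<in> \<Phi> M N ` rep_hom M N"
      using ff that unfolding fully_faithful_def bij_betw_def by simp
    then show ?thesis by blast
  qed
  have faithful: "f = g"
    if "M \<in> ?C" "N \<in> ?C" "f \<in> rep_hom M N" "g \<in> rep_hom M N" "\<Phi> M N f = \<Phi> M N g" for M N f g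
    using ff that unfolding fully_faithful_def bij_betw_def inj_on_def by blast
  \<comment> \<open>Additivity sends the zero map to a map \<open>z\<close> with \<open>z + z = z\<close>.\<close>
  have zero: "\<Phi> M M (\<lambda>v\<in>carrier M. \<zero>\<^bsub>M\<^esub>) = (\<lambda>v\<in>carrier (F M). \<zero>\<^bsub>F M\<^esub>)" if M: "M \<in> ?C" for M
  proof -
    interpret M: representation M using repC[OF M] by unfold_locales
    interpret FM: representation "F M" using repF[OF M] by unfold_locales
    let ?z = "\<lambda>v\<in>carrier M. \<zero>\<^bsub>M\<^esub>"
    have z: "?z \<in> rep_hom M M" by (rule rep_hom_zero_map) (rule repC[OF M])+
    have "\<Phi> M M (\<lambda>v\<in>carrier M. ?z v \<oplus>\<^bsub>M\<^esub> ?z v) =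
        (\<lambda>v\<in>carrier (F M). \<Phi> M M ?z v \<oplus>\<^bsub>F M\<^esub> \<Phi> M M ?z v)"
      using exact M z unfolding exact_functor_def by blast
    moreover have "(\<lambda>v\<in>carrier M. ?z v \<oplus>\<^bsub>M\<^esub> ?z v) = ?z" by (auto simp: restrict_def)
    ultimately have dbl: "\<Phi> M M ?z = (\<lambda>v\<in>carrier (F M). \<Phi> M M ?z v \<oplus>\<^bsub>F M\<^esub> \<Phi> M M ?z v)" by simp
    have "\<Phi> M M ?z v = \<zero>\<^bsub>F M\<^esub>" if v: "v \<in> carrier (F M)" for v
    proof -
      have "\<Phi> M M ?z v = \<Phi> M M ?z v \<oplus>\<^bsub>F M\<^esub> \<Phi> M M ?z v"
        using fun_cong[OF dbl, of v] v by simp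
      then show ?thesis
        using rep_homD(3)[OF hom[OF M M z] v] by (metis FM.M.add.r_cancel_one')
    qed
    then show ?thesis
      using rep_homD(1)[OF hom[OF M M z]] by (auto simp: extensional_def restrict_def)
  qed
  have indec: "indecomposable (F M)" if M: "M \<in> ?C" and ind: "indecomposable M" for M
    unfolding indecomposable_def
  proof (intro conjI allI impI)
    interpret M: representation M using repC[OF M] by unfold_locales
    interpret FM: representation "F M" using repF[OF M] by unfold_locales
    note idhom = rep_hom_id[OF repC[OF M]]
      and zhom = rep_hom_zero_map[OF repC[OF M] repC[OF M]]
    show "carrier (F M) \<noteq> {\<zero>\<^bsub>F M\<^esub>}"
    proof
      assume "carrier (F M) = {\<zero>\<^bsub>F M\<^esub>}"
      then have "?id (F M) = (\<lambda>v\<in>carrier (F M). \<zero>\<^bsub>F M\<^esub>)" by auto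
      then have "?id M = (\<lambda>v\<in>carrier M. \<zero>\<^bsub>M\<^esub>)"
        using faithful[OF M M idhom zhom] id[OF M] zero[OF M] by simp
      then have "v = \<zero>\<^bsub>M\<^esub>" if "v \<in> carrier M" for v using that by (metis restrict_apply')
      then have "carrier M = {\<zero>\<^bsub>M\<^esub>}" using M.zero_closed by blast
      then show False using ind by (simp add: indecomposable_def)
    qed
    fix U V
    assume UV: "subrep (F M) U \<and> subrep (F M) V \<and> U \<inter> V = {\<zero>\<^bsub>F M\<^esub>} \<and> U <+>\<^bsub>F M\<^esub> V = carrier (F M)"
    then obtain e where e: "e \<in> rep_hom (F M) (F M)" "\<And>v. v \<in> U \<Longrightarrow> e v = v"
      "\<And>v. v \<in> V \<Longrightarrow> e v = \<zero>\<^bsub>F M\<^esub>" "\<And>v. v \<in> carrier (F M) \<Longrightarrow> e v \<in> U"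
      using projection_along_complement[OF repF[OF M], of U V] by metis
    have sub: "U \<subseteq> carrier (F M)" "V \<subseteq> carrier (F M)" "\<zero>\<^bsub>F M\<^esub> \<in> U" "\<zero>\<^bsub>F M\<^esub> \<in> V"
      using UV subrepD(1,2)[OF _ repF[OF M]] by blast+
    obtain f where f: "f \<in> rep_hom M M" "\<Phi> M M f = e" using full[OF M M e(1)] by blast
    have "compose (carrier (F M)) e e = e"
      using rep_homD(1)[OF e(1)] e(2,4) by (auto simp: compose_def extensional_def fun_eq_iff)
    then have "\<Phi> M M (compose (carrier M) f f) = \<Phi> M M f"
      using comp[OF M M M f(1) f(1)] f(2) by simp
    then have "compose (carrier M) f f = f"
      using faithful[OF M M] rep_hom_compose[OF f(1) f(1) repC[OF M]] f(1) by blast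
    then have ff: "f (f v) = f v" if "v \<in> carrier M" for v
      using that by (metis compose_eq)
    note fD = rep_homD[OF f(1)]
    let ?U = "{v \<in> carrier M. f v = ?id M v}" and ?V = "{v \<in> carrier M. f v = (\<lambda>v\<in>carrier M. \<zero>\<^bsub>M\<^esub>) v}"
    have sU: "subrep M ?U" and sV: "subrep M ?V"
      by (rule subrep_equalizer[OF f(1) _ repC[OF M] repC[OF M]], rule idhom zhom)+
    have compl: "v \<oplus>\<^bsub>M\<^esub> (-1) \<odot>\<^bsub>M\<^esub> f v \<in> ?V" "v = f v \<oplus>\<^bsub>M\<^esub> (v \<oplus>\<^bsub>M\<^esub> (-1) \<odot>\<^bsub>M\<^esub> f v)"
      if v: "v \<in> carrier M" for v
    proof -
      have "f v \<in> carrier M" using fD(3) v by blast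
      then show "v \<oplus>\<^bsub>M\<^esub> (-1) \<odot>\<^bsub>M\<^esub> f v \<in> ?V"
        using v by (simp add: fD(4,5) ff) (simp add: M.scale_minus_one M.M.r_neg)
      have "f v \<oplus>\<^bsub>M\<^esub> (v \<oplus>\<^bsub>M\<^esub> \<ominus>\<^bsub>M\<^esub> f v) = v \<oplus>\<^bsub>M\<^esub> (f v \<oplus>\<^bsub>M\<^esub> \<ominus>\<^bsub>M\<^esub> f v)"
        using v \<open>f v \<in> carrier M\<close> by (simp add: M.M.a_lcomm del: M.M.r_neg)
      then show "v = f v \<oplus>\<^bsub>M\<^esub> (v \<oplus>\<^bsub>M\<^esub> (-1) \<odot>\<^bsub>M\<^esub> f v)"
        using v \<open>f v \<in> carrier M\<close> by (simp add: M.scale_minus_one M.M.r_neg)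
    qed
    have "?U \<inter> ?V = {\<zero>\<^bsub>M\<^esub>}"
      using subrepD(2)[OF sU repC[OF M]] by auto
    moreover have "?U <+>\<^bsub>M\<^esub> ?V = carrier M"
    proof
      show "?U <+>\<^bsub>M\<^esub> ?V \<subseteq> carrier M"
        unfolding in_set_add_iff subset_iff by auto
      show "carrier M \<subseteq> ?U <+>\<^bsub>M\<^esub> ?V"
      proof
        fix v assume v: "v \<in> carrier M"
        have "f v \<in> ?U" using fD(3)[OF v] ff[OF v] by simp
        then show "v \<in> ?U <+>\<^bsub>M\<^esub> ?V"
          unfolding in_set_add_iff using compl[OF v] by blast
      qed
    qed
    ultimately have "?U = {\<zero>\<^bsub>M\<^esub>} \<or> ?V = {\<zero>\<^bsub>M\<^esub>}"
      using ind sU sV unfolding indecomposable_def by blast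
    then show "U = {\<zero>\<^bsub>F M\<^esub>} \<or> V = {\<zero>\<^bsub>F M\<^esub>}"
    proof
      assume "?U = {\<zero>\<^bsub>M\<^esub>}"
      moreover have "f v \<in> ?U" if "v \<in> carrier M" for v using fD(3)[OF that] ff[OF that] by simp
      ultimately have "f = (\<lambda>v\<in>carrier M. \<zero>\<^bsub>M\<^esub>)"
        using rep_hom_eqI[OF f(1) zhom] by (metis (no_types, lifting) restrict_apply' singletonD)
      then have "e = (\<lambda>v\<in>carrier (F M). \<zero>\<^bsub>F M\<^esub>)" using zero[OF M] f(2) by simp
      then have "v = \<zero>\<^bsub>F M\<^esub>" if "v \<in> U" for v
        using e(2)[OF that] sub(1) that by auto
      then have "U = {\<zero>\<^bsub>F M\<^esub>}" using sub(3) by blast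
      then show ?thesis ..
    next
      assume V0: "?V = {\<zero>\<^bsub>M\<^esub>}"
      have "f v = v" if v: "v \<in> carrier M" for v
      proof -
        have "v \<oplus>\<^bsub>M\<^esub> (-1) \<odot>\<^bsub>M\<^esub> f v = \<zero>\<^bsub>M\<^esub>" using compl(1)[OF v] V0 by blast
        then show ?thesis using compl(2)[OF v] fD(3)[OF v] by simp
      qed
      then have "f = ?id M"
        using rep_hom_eqI[OF f(1) idhom] by simp
      then have "e = ?id (F M)" using id[OF M] f(2) by simp
      then have "v = \<zero>\<^bsub>F M\<^esub>" if "v \<in> V" for v
        using e(3)[OF that] sub(2) that by auto
      then have "V = {\<zero>\<^bsub>F M\<^esub>}" using sub(4) by blast
      then show ?thesis ..
    qed
  qed
  have iso: "rep_iso M N" if M: "M \<in> ?C" and N: "N \<in> ?C" and FMN: "rep_iso (F M) (F N)" for M N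
  proof -
    obtain h where h: "h \<in> rep_hom (F M) (F N)" "bij_betw h (carrier (F M)) (carrier (F N))"
      using FMN by (auto simp: rep_iso_def)
    then have hi: "isomorphism h (F M) (F N)"
      using repF M N by (simp add: isomorphism_def)
    define k where "k = inverse_hom h (F M) (F N)"
    note k = inverse_hom[OF hi, folded k_def]
    have khom: "k \<in> rep_hom (F N) (F M)" using isomorphismD(3)[OF k(1)] .
    obtain f where f: "f \<in> rep_hom M N" "\<Phi> M N f = h" using full[OF M N h(1)] by blast
    obtain g where g: "g \<in> rep_hom N M" "\<Phi> N M g = k" using full[OF N M khom] by blast
    have "compose (carrier (F M)) k h = ?id (F M)" "compose (carrier (F N)) h k = ?id (F N)"
      using k(2,3) by (auto simp: compose_def restrict_def fun_eq_iff)
    then have "\<Phi> M M (compose (carrier M) g f) = \<Phi> M M (?id M)"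
      "\<Phi> N N (compose (carrier N) f g) = \<Phi> N N (?id N)"
      using comp[OF M N M f(1) g(1)] comp[OF N M N g(1) f(1)] f(2) g(2) id M N by simp_all
    then have "compose (carrier M) g f = ?id M" "compose (carrier N) f g = ?id N"
      using faithful[OF M M] faithful[OF N N] rep_hom_compose[OF f(1) g(1)] rep_hom_compose[OF g(1) f(1)]
        rep_hom_id repC M N by blast+
    then have "\<forall>v\<in>carrier M. g (f v) = v" "\<forall>w\<in>carrier N. f (g w) = w"
      by (metis compose_eq restrict_apply')+
    then have "bij_betw f (carrier M) (carrier N)"
      using rep_homD(3)[OF f(1)] rep_homD(3)[OF g(1)]
      by (intro bij_betw_byWitness[where f' = g]) auto
    then show ?thesis using f(1) by (auto simp: rep_iso_def)
  qed
  show ?thesis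
    unfolding wild_def using exact indec iso by blast
qed

text \<open>
  The homomorphism that corresponds to \<open>f\<close> when its source is identified with \<open>M'\<close> by \<open>h\<close> and its target
  is mapped by \<open>k\<close>.
\<close>

definition conjugate_hom ::
    "('v \<Rightarrow> 'w) \<Rightarrow> ('i, 'v) rep \<Rightarrow> ('i, 'w) rep \<Rightarrow> ('v \<Rightarrow> 'w) \<Rightarrow> ('v \<Rightarrow> 'v) \<Rightarrow> 'w \<Rightarrow> 'w" where
  "conjugate_hom h M M' k f = (\<lambda>v\<in>carrier M'. k (f (inverse_hom h M M' v)))"

lemma conjugate_hom_apply:
  assumes "isomorphism h M M'" "v \<in> carrier M"
  shows "conjugate_hom h M M' k f (h v) = k (f v)"
  using assms isomorphismD(6)[OF assms(1)] inverse_hom(2)[OF assms]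
  by (auto simp: conjugate_hom_def)

lemma conjugate_hom_eqI:
  assumes h: "isomorphism h M M'" and f': "f' \<in> extensional (carrier M')"
    and "\<And>v. v \<in> carrier M \<Longrightarrow> f' (h v) = k (f v)"
  shows "conjugate_hom h M M' k f = f'"
proof (rule extensionalityI[OF _ f'])
  show "conjugate_hom h M M' k f \<in> extensional (carrier M')"
    by (simp add: conjugate_hom_def)
  show "conjugate_hom h M M' k f w = f' w" if w: "w \<in> carrier M'" for w
    using w assms(3)[OF inverse_hom(4)[OF h w]] inverse_hom(3)[OF h w]
    by (simp add: conjugate_hom_def)
qed

lemma conjugate_hom_in_rep_hom:
  assumes h: "isomorphism h M M'" and k: "isomorphism k N N'" and f: "f \<in> rep_hom M N"
  shows "conjugate_hom h M M' k f \<in> rep_hom M' N'"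
proof -
  note hD = isomorphismD[OF inverse_hom(1)[OF h]] and kD = isomorphismD[OF k]
  let ?g = "inverse_hom h M M'"
  have "conjugate_hom h M M' k f = compose (carrier M') (compose (carrier M) k f) ?g"
    using inverse_hom(4)[OF h] by (auto simp: conjugate_hom_def compose_def)
  then show ?thesis
    using rep_hom_compose[OF hD(3) rep_hom_compose[OF f kD(3) hD(2)] hD(1)] by simp
qed

lemma conjugate_hom_bij_betw:
  assumes h: "isomorphism h M M'" and k: "isomorphism k N N'"
  shows "bij_betw (conjugate_hom h M M' k) (rep_hom M N) (rep_hom M' N')"
proof (rule bij_betw_byWitness)
  let ?h = "inverse_hom h M M'" and ?k = "inverse_hom k N N'"
  note h' = inverse_hom[OF h] and k' = inverse_hom[OF k]
  show "\<forall>f\<in>rep_hom M N. conjugate_hom ?h M' M ?k (conjugate_hom h M M' k f) = f"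
  proof
    fix f assume f: "f \<in> rep_hom M N"
    show "conjugate_hom ?h M' M ?k (conjugate_hom h M M' k f) = f"
    proof (rule conjugate_hom_eqI[OF h'(1) rep_homD(1)[OF f]])
      fix w assume w: "w \<in> carrier M'"
      then show "f (?h w) = ?k (conjugate_hom h M M' k f w)"
        using k'(2) rep_homD(3)[OF f] h'(4) by (simp add: conjugate_hom_def)
    qed
  qed
  show "\<forall>f\<in>rep_hom M' N'. conjugate_hom h M M' k (conjugate_hom ?h M' M ?k f) = f"
  proof
    fix f assume f: "f \<in> rep_hom M' N'"
    show "conjugate_hom h M M' k (conjugate_hom ?h M' M ?k f) = f"
    proof (rule conjugate_hom_eqI[OF h rep_homD(1)[OF f]])
      fix v assume v: "v \<in> carrier M"
      have hv: "h v \<in> carrier M'" using v isomorphismD(6)[OF h] by blast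
      show "f (h v) = k (conjugate_hom ?h M' M ?k f v)"
        using conjugate_hom_apply[OF h'(1) hv, of ?k f] k'(3) rep_homD(3)[OF f hv] h'(2)[OF v]
        by simp
    qed
  qed
  show "conjugate_hom h M M' k ` rep_hom M N \<subseteq> rep_hom M' N'"
    using conjugate_hom_in_rep_hom[OF h k] by blast
  show "conjugate_hom ?h M' M ?k ` rep_hom M' N' \<subseteq> rep_hom M N"
    using conjugate_hom_in_rep_hom[OF h'(1) k'(1)] by blast
qed

lemma short_exact_conjugate:
  assumes a: "isomorphism a A A'" and b: "isomorphism b B B'" and c: "isomorphism c C C'"
    and ex: "short_exact A f B g C"
  shows "short_exact A' (conjugate_hom a A A' b f) B' (conjugate_hom b B B' c g) C'"
proof -
  note aD = isomorphismD[OF a] and bD = isomorphismD[OF b] and cD = isomorphismD[OF c]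
  let ?f = "conjugate_hom a A A' b f" and ?g = "conjugate_hom b B B' c g"
  have f: "f \<in> rep_hom A B" "inj_on f (carrier A)" "f ` carrier A = {v \<in> carrier B. g v = \<zero>\<^bsub>C\<^esub>}"
    and g: "g \<in> rep_hom B C" "g ` carrier B = carrier C"
    using ex by (auto simp: short_exact_def)
  have fa: "?f (a v) = b (f v)" if "v \<in> carrier A" for v by (rule conjugate_hom_apply[OF a that])
  have gb: "?g (b v) = c (g v)" if "v \<in> carrier B" for v by (rule conjugate_hom_apply[OF b that])
  have "inj_on ?f (carrier A')"
    unfolding aD(6)[symmetric]
  proof (rule inj_onI, elim imageE)
    fix x y v w assume *: "?f x = ?f y" "x = a v" "v \<in> carrier A" "y = a w" "w \<in> carrier A"
    then have "f v = f w"
      using fa inj_onD[OF bD(5)] rep_homD(3)[OF f(1)] by auto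
    then show "x = y" using * inj_onD[OF f(2)] by blast
  qed
  moreover have "?f ` carrier A' = b ` f ` carrier A"
    unfolding aD(6)[symmetric] image_image using fa by auto
  moreover have "b ` f ` carrier A = {v \<in> carrier B'. ?g v = \<zero>\<^bsub>C'\<^esub>}"
    unfolding f(3) bD(6)[symmetric]
    using gb isomorphism_zero_iff[OF c] rep_homD(3)[OF g(1)] by force
  moreover have "?g ` carrier B' = carrier C'"
    unfolding bD(6)[symmetric] cD(6)[symmetric] g(2)[symmetric] image_image using gb by auto
  ultimately show ?thesis
    using conjugate_hom_in_rep_hom[OF a b f(1)] conjugate_hom_in_rep_hom[OF b c g(1)]
    by (simp add: short_exact_def)
qed

text \<open>
  The values of a functor may be replaced by isomorphic ones. This moves a functor whose values live
  on a convenient type to one with values on a prescribed type.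
\<close>

lemma exact_functor_isomorphism:
  fixes F :: "('i, 'v) rep \<Rightarrow> ('j, 'w) rep" and F' :: "('i, 'v) rep \<Rightarrow> ('j, 'u) rep"
  assumes ex: "exact_functor \<C> \<D> F \<Phi>" and ff: "fully_faithful \<C> F \<Phi>"
    and rep: "\<And>M. M \<in> \<C> \<Longrightarrow> is_rep M"
    and h: "\<And>M. M \<in> \<C> \<Longrightarrow> isomorphism (h M) (F M) (F' M)"
    and D': "\<And>M. M \<in> \<C> \<Longrightarrow> F' M \<in> \<D>'"
  defines "\<Phi>' \<equiv> \<lambda>M N f. conjugate_hom (h M) (F M) (F' M) (h N) (\<Phi> M N f)"
  shows "exact_functor \<C> \<D>' F' \<Phi>'" and "fully_faithful \<C> F' \<Phi>'"
proof -
  have hom: "\<Phi> M N f \<in> rep_hom (F M) (F N)" if "M \<in> \<C>" "N \<in> \<C>" "f \<in> rep_hom M N" for M N f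
    using ex that by (simp add: exact_functor_def is_functor_def)
  have hom': "\<Phi>' M N f \<in> rep_hom (F' M) (F' N)" if "M \<in> \<C>" "N \<in> \<C>" "f \<in> rep_hom M N" for M N f
    unfolding \<Phi>'_def by (rule conjugate_hom_in_rep_hom[OF h h hom]) fact+
  have app: "\<Phi>' M N f (h M v) = h N (\<Phi> M N f v)" if "M \<in> \<C>" "v \<in> carrier (F M)" for M N f v
    unfolding \<Phi>'_def by (rule conjugate_hom_apply[OF h]) fact+
  have conj: "\<Phi>' M N f = conjugate_hom (h M) (F M) (F' M) (h N) (\<Phi> M N f)" for M N f
    by (simp add: \<Phi>'_def)
  have hin: "h M v \<in> carrier (F' M)" if "M \<in> \<C>" "v \<in> carrier (F M)" for M v
    using isomorphismD(6)[OF h[OF that(1)]] that(2) by blast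
  have id: "\<Phi>' M M (\<lambda>v\<in>carrier M. v) = (\<lambda>v\<in>carrier (F' M). v)" if M: "M \<in> \<C>" for M
  proof -
    have "\<Phi> M M (\<lambda>v\<in>carrier M. v) = (\<lambda>v\<in>carrier (F M). v)"
      using ex M by (simp add: exact_functor_def is_functor_def)
    then show ?thesis
      unfolding \<Phi>'_def using hin[OF M] by (intro conjugate_hom_eqI[OF h[OF M]]) auto
  qed
  have comp: "\<Phi>' L N (compose (carrier L) g f) = compose (carrier (F' L)) (\<Phi>' M N g) (\<Phi>' L M f)"
    if L: "L \<in> \<C>" and M: "M \<in> \<C>" and N: "N \<in> \<C>" and f: "f \<in> rep_hom L M" and g: "g \<in> rep_hom M N"
    for L M N f g
  proof -
    have *: "\<Phi> L N (compose (carrier L) g f) = compose (carrier (F L)) (\<Phi> M N g) (\<Phi> L M f)"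
      using ex that by (simp add: exact_functor_def is_functor_def)
    show ?thesis
      unfolding conj[of L N]
    proof (rule conjugate_hom_eqI[OF h[OF L]])
      fix v assume v: "v \<in> carrier (F L)"
      then show "compose (carrier (F' L)) (\<Phi>' M N g) (\<Phi>' L M f) (h L v) =
          h N (\<Phi> L N (compose (carrier L) g f) v)"
        using hin[OF L v] rep_homD(3)[OF hom[OF L M f] v] by (simp add: * compose_eq app L M)
    qed simp
  qed
  have add: "\<Phi>' M N (\<lambda>v\<in>carrier M. f v \<oplus>\<^bsub>N\<^esub> g v) =
        (\<lambda>v\<in>carrier (F' M). \<Phi>' M N f v \<oplus>\<^bsub>F' N\<^esub> \<Phi>' M N g v)"
    if M: "M \<in> \<C>" and N: "N \<in> \<C>" and f: "f \<in> rep_hom M N" and g: "g \<in> rep_hom M N" for M N f g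
  proof -
    have *: "\<Phi> M N (\<lambda>v\<in>carrier M. f v \<oplus>\<^bsub>N\<^esub> g v) =
        (\<lambda>v\<in>carrier (F M). \<Phi> M N f v \<oplus>\<^bsub>F N\<^esub> \<Phi> M N g v)"
      using ex that by (simp add: exact_functor_def)
    show ?thesis
      unfolding conj[of M N "\<lambda>v\<in>carrier M. f v \<oplus>\<^bsub>N\<^esub> g v"]
    proof (rule conjugate_hom_eqI[OF h[OF M]])
      fix v assume v: "v \<in> carrier (F M)"
      note fg = rep_homD(3)[OF hom[OF M N f] v] rep_homD(3)[OF hom[OF M N g] v]
      show "(\<lambda>v\<in>carrier (F' M). \<Phi>' M N f v \<oplus>\<^bsub>F' N\<^esub> \<Phi>' M N g v) (h M v) =
          h N (\<Phi> M N (\<lambda>v\<in>carrier M. f v \<oplus>\<^bsub>N\<^esub> g v) v)"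
        using hin[OF M v] v fg
        by (simp add: * app M rep_homD(4)[OF isomorphismD(3)[OF h[OF N]]])
    qed simp
  qed
  have exact: "short_exact (F' A) (\<Phi>' A B f) (F' B) (\<Phi>' B C g) (F' C)"
    if "A \<in> \<C>" "B \<in> \<C>" "C \<in> \<C>" "short_exact A f B g C" for A B C f g
    unfolding \<Phi>'_def
    by (rule short_exact_conjugate[OF h h h]) (use ex that in \<open>simp_all add: exact_functor_def\<close>)
  show "exact_functor \<C> \<D>' F' \<Phi>'"
    unfolding exact_functor_def is_functor_def using D' hom' id comp add exact by blast
  show "fully_faithful \<C> F' \<Phi>'"
    unfolding fully_faithful_def
  proof (intro ballI)
    fix M N assume M: "M \<in> \<C>" and N: "N \<in> \<C>"
    have "bij_betw (\<Phi> M N) (rep_hom M N) (rep_hom (F M) (F N))"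
      using ff M N by (simp add: fully_faithful_def)
    from bij_betw_trans[OF this conjugate_hom_bij_betw[OF h[OF M] h[OF N]]]
    show "bij_betw (\<Phi>' M N) (rep_hom M N) (rep_hom (F' M) (F' N))"
      by (simp add: \<Phi>'_def comp_def)
  qed
qed

section \<open>Six coupled spaces of polynomials\<close>

lemma lie_linear:
  "lie \<nu> f (p + q) = lie \<nu> f p + lie \<nu> f q" "lie \<nu> f (p - q) = lie \<nu> f p - lie \<nu> f q"
  "lie \<nu> f (- p) = - lie \<nu> f p" "lie \<nu> f (Polynomial.smult c p) = Polynomial.smult c (lie \<nu> f p)"
  "lie \<nu> f 0 = 0" "lie \<nu> (f + g) p = lie \<nu> f p + lie \<nu> g p"
  "lie \<nu> (Polynomial.smult c f) p = Polynomial.smult c (lie \<nu> f p)"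
  by (simp_all add: lie_def pderiv_add pderiv_diff pderiv_minus pderiv_smult smult_add_right
      smult_diff_right algebra_simps)

lemma pderiv_iter_linear:
  "(pderiv ^^ n) (p + q) = (pderiv ^^ n) p + (pderiv ^^ n) (q :: complex poly)"
  "(pderiv ^^ n) (Polynomial.smult c p) = Polynomial.smult c ((pderiv ^^ n) (p :: complex poly))"
  "(pderiv ^^ n) (- p) = - (pderiv ^^ n) (p :: complex poly)" "(pderiv ^^ n) (0 :: complex poly) = 0"
  by (induction n) (simp_all add: pderiv_add pderiv_smult pderiv_minus)

lemma cocycle_linear:
  "cocycle2 f (p + q) = cocycle2 f p + cocycle2 f q" "cocycle2 f (- p) = - cocycle2 f p"
  "cocycle2 f 0 = 0"
  "cocycle2 f (Polynomial.smult c p) = Polynomial.smult c (cocycle2 f p)"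
  "cocycle2 (f + g) p = cocycle2 f p + cocycle2 g p"
  "cocycle2 (Polynomial.smult c f) p = Polynomial.smult c (cocycle2 f p)"
  "cocycle3 \<nu> f (p + q) = cocycle3 \<nu> f p + cocycle3 \<nu> f q" "cocycle3 \<nu> f (- p) = - cocycle3 \<nu> f p"
  "cocycle3 \<nu> f 0 = 0"
  "cocycle3 \<nu> f (Polynomial.smult c p) = Polynomial.smult c (cocycle3 \<nu> f p)"
  "cocycle3 \<nu> (f + g) p = cocycle3 \<nu> f p + cocycle3 \<nu> g p"
  "cocycle3 \<nu> (Polynomial.smult c f) p = Polynomial.smult c (cocycle3 \<nu> f p)"
  "cocycle4 \<nu> f (p + q) = cocycle4 \<nu> f p + cocycle4 \<nu> f q" "cocycle4 \<nu> f (- p) = - cocycle4 \<nu> f p"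
  "cocycle4 \<nu> f 0 = 0"
  "cocycle4 \<nu> f (Polynomial.smult c p) = Polynomial.smult c (cocycle4 \<nu> f p)"
  "cocycle4 \<nu> (f + g) p = cocycle4 \<nu> f p + cocycle4 \<nu> g p"
  "cocycle4 \<nu> (Polynomial.smult c f) p = Polynomial.smult c (cocycle4 \<nu> f p)"
  by (simp_all add: cocycle2_def cocycle3_def cocycle4_def pderiv_iter_linear pderiv_add pderiv_minus
      pderiv_smult smult_add_right smult_diff_right ring_distribs ac_simps)

definition vector_scale :: "complex \<Rightarrow> (nat \<Rightarrow> complex poly) \<Rightarrow> nat \<Rightarrow> complex poly" where
  "vector_scale c p = (\<lambda>k. Polynomial.smult c (p k))"

text \<open>
  Divisibility by \<open>x\<^sup>n\<close> measures the order of vanishing at zero; a functional of the module below is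
  zero on all vectors of sufficiently high order.
\<close>

abbreviation low :: "nat \<Rightarrow> complex poly \<Rightarrow> bool" where
  "low n q \<equiv> monom 1 n dvd q"

lemma low_mono: "low n q \<Longrightarrow> m \<le> n \<Longrightarrow> low m q"
  by (auto simp: monom_1_dvd_iff')

lemma low_pderiv: "low n q \<Longrightarrow> low (n - 1) (pderiv q)"
  by (auto simp: monom_1_dvd_iff' coeff_pderiv)

lemma low_lie: "low n q \<Longrightarrow> low (n - 1) (lie \<nu> f q)"
  unfolding lie_def using low_pderiv[of n q] low_mono[of n q "n - 1"]
  by (intro dvd_add dvd_mult dvd_smult) auto

text \<open>
  A vector field that vanishes to second order at zero does not decrease the order of vanishing.
\<close>

lemma low_lie_of_square:
  assumes "low n q" "low 2 f"
  shows "low n (lie \<nu> f q)"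
proof -
  have "low (Suc (n - 1)) (f * pderiv q)"
    using mult_dvd_mono[OF low_mono[OF assms(2), of 1] low_pderiv[OF assms(1)]]
    by (simp add: mult_monom)
  then have "low n (f * pderiv q)" by (rule low_mono) simp
  then show ?thesis
    unfolding lie_def using assms(1) by (intro dvd_add dvd_smult) auto
qed

lemma low_cocycle2: "low n q \<Longrightarrow> low n (cocycle2 f q)"
  unfolding cocycle2_def by (rule dvd_mult)

lemma low_cocycle3: "low n q \<Longrightarrow> low (n - 1) (cocycle3 \<nu> f q)"
  unfolding cocycle3_def using low_pderiv[of n q] low_mono[of n q "n - 1"]
  by (intro dvd_diff dvd_mult dvd_smult) auto

lemma low_cocycle4: "low n q \<Longrightarrow> low (n - 2) (cocycle4 \<nu> f q)"
  unfolding cocycle4_def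
  using low_pderiv[OF low_pderiv, of n q] low_mono[OF low_pderiv, of n q "n - 2"]
    low_mono[of n q "n - 2"]
  by (intro dvd_add dvd_diff dvd_mult dvd_smult) (auto simp: numeral_2_eq_2)

locale polar =
  fixes \<nu> :: complex
begin

definition wt :: "nat \<Rightarrow> complex" where
  "wt k = \<nu> - of_nat k"

text \<open>
  A vector \<open>p\<close> consists of one polynomial \<open>p k\<close>, a density of weight \<open>wt k\<close>, for each slot \<open>k < 6\<close>; the
  functionals do not see the entries beyond. The operators are transposed to the action on functionals: they carry
  the target slots \<open>3, 4, 5\<close> to the source slots \<open>0, 1, 2\<close>, along the edges of length 2 and 3 for \<open>opA\<close>,
  which contains the action of \<open>f\<close> inside each slot with the sign of the dual module, and along one edge
  of length 4 for each of \<open>opX\<close> and \<open>opY\<close>.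
\<close>

definition opA :: "complex poly \<Rightarrow> (nat \<Rightarrow> complex poly) \<Rightarrow> nat \<Rightarrow> complex poly" where
  "opA f p = (\<lambda>k. (if k = 1 \<or> k = 2 then cocycle2 f (p (k + 2)) else 0) +
     (if k < 3 then cocycle3 (wt (k + 3)) f (p (k + 3)) else 0) - lie (wt k) f (p k))"

definition opX :: "complex poly \<Rightarrow> (nat \<Rightarrow> complex poly) \<Rightarrow> nat \<Rightarrow> complex poly" where
  "opX f p = (\<lambda>k. if k = 0 then cocycle4 (wt 4) f (p 4) else 0)"

definition opY :: "complex poly \<Rightarrow> (nat \<Rightarrow> complex poly) \<Rightarrow> nat \<Rightarrow> complex poly" where
  "opY f p = (\<lambda>k. if k = 1 then cocycle4 (wt 5) f (p 5) else 0)"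

lemmas op_defs = opA_def opX_def opY_def

lemma op_linear:
  "opA f (p + q) = opA f p + opA f q" "opA f (vector_scale c p) = vector_scale c (opA f p)"
  "opX f (p + q) = opX f p + opX f q" "opX f (vector_scale c p) = vector_scale c (opX f p)"
  "opY f (p + q) = opY f p + opY f q" "opY f (vector_scale c p) = vector_scale c (opY f p)"
  "opA (f + g) p = opA f p + opA g p" "opA (Polynomial.smult c f) p = vector_scale c (opA f p)"
  "opX (f + g) p = opX f p + opX g p" "opX (Polynomial.smult c f) p = vector_scale c (opX f p)"
  "opY (f + g) p = opY f p + opY g p" "opY (Polynomial.smult c f) p = vector_scale c (opY f p)"
  by (auto simp: op_defs vector_scale_def fun_eq_iff lie_linear cocycle_linear smult_add_right smult_diff_right)

text \<open>
  Together with the next three lemmas this says that \<open>opA f + X\<^sub>1 opX f + X\<^sub>2 opY f\<close>, with operators \<open>X\<^sub>1\<close>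
  and \<open>X\<^sub>2\<close> on another space, defines a module whatever these are. The order of \<open>f\<close> and \<open>g\<close> on the right is that
  of the transposed action.
\<close>

lemma opA_bracket: "opA (bracket f g) p = opA g (opA f p) - opA f (opA g p)"
proof
  fix k
  have *: "wt k = wt (k + 2) + 2" "wt k = wt (k + 3) + 3"
    by (simp_all add: wt_def)
  show "opA (bracket f g) p k = (opA g (opA f p) - opA f (opA g p)) k"
    using cocycle2_bracket[of f g "p (k + 2)" "wt (k + 2)"] cocycle3_bracket[of "wt (k + 3)" f g "p (k + 3)"]
      lie_bracket[of "wt k" f g "p k"]
    unfolding *[symmetric]
    by (auto simp: op_defs lie_linear cocycle_linear)
qed

lemma opX_bracket:
  "opX (bracket f g) p = (opX g (opA f p) + opA g (opX f p)) - (opX f (opA g p) + opA f (opX g p))"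
proof
  fix k
  have *: "wt 0 = wt 4 + 4" by (simp add: wt_def)
  show "opX (bracket f g) p k =
      ((opX g (opA f p) + opA g (opX f p)) - (opX f (opA g p) + opA f (opX g p))) k"
    using cocycle4_bracket[of "wt 4" f g "p 4"]
    unfolding *[symmetric]
    by (auto simp: op_defs lie_linear cocycle_linear)
qed

lemma opY_bracket:
  "opY (bracket f g) p = (opY g (opA f p) + opA g (opY f p)) - (opY f (opA g p) + opA f (opY g p))"
proof
  fix k
  have *: "wt (Suc 0) = wt 5 + 4" by (simp add: wt_def)
  show "opY (bracket f g) p k =
      ((opY g (opA f p) + opA g (opY f p)) - (opY f (opA g p) + opA f (opY g p))) k"
    using cocycle4_bracket[of "wt 5" f g "p 5"]
    unfolding *[symmetric]
    by (auto simp: op_defs lie_linear cocycle_linear)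
qed

lemma opXY_zero: "opX f (opX g p) = 0" "opX f (opY g p) = 0" "opY f (opX g p) = 0" "opY f (opY g p) = 0"
  by (auto simp: op_defs fun_eq_iff cocycle_linear)

lemma op_low:
  assumes "\<And>k. k < 6 \<Longrightarrow> low (n + 2) (p k)" "k < 6"
  shows "low n (opA f p k)" "low n (opX f p k)" "low n (opY f p k)"
proof -
  have *: "low n (lie (wt j) f (p j))" "low n (cocycle2 f (p j))" "low n (cocycle3 (wt j) f (p j))"
    "low n (cocycle4 (wt j) f (p j))" if "j < 6" for j
    using low_mono[OF low_lie[OF assms(1)[OF that]], of n] low_mono[OF low_cocycle2[OF assms(1)[OF that]], of n]
      low_mono[OF low_cocycle3[OF assms(1)[OF that]], of n] low_cocycle4[OF assms(1)[OF that]] by auto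
  show "low n (opA f p k)"
    unfolding opA_def using assms(2) by (intro dvd_diff dvd_add) (auto intro!: *)
  show "low n (opX f p k)" "low n (opY f p k)"
    unfolding opX_def opY_def by (auto intro!: *)
qed

text \<open>
  An edge of length \<open>\<ell>\<close> costs up to \<open>\<ell> - 2\<close> orders of vanishing but starts from a slot in which \<open>\<ell>\<close> more are
  required. In terms of weights: an operator that raises weights maps a sum of high weight spaces to
  itself.
\<close>

lemma op_low_staircase:
  assumes p: "\<And>k. k < 6 \<Longrightarrow> low (n + k) (p k)" and f: "low 2 f" and "k < 6"
  shows "low (n + k) (opA f p k)" "low (n + k) (opX f p k)" "low (n + k) (opY f p k)"
proof -
  have "low (n + k) (lie (wt k) f (p k))"
    using low_lie_of_square[OF p f] assms by simp
  moreover have "low (n + k) (cocycle2 f (p (k + 2)))" if "k < 4"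
    using low_mono[OF low_cocycle2[OF p], of "k + 2" "n + k"] that by simp
  moreover have "low (n + k) (cocycle3 (wt (k + 3)) f (p (k + 3)))" if "k < 3"
    using low_mono[OF low_cocycle3[OF p], of "k + 3" "n + k"] that by simp
  ultimately show "low (n + k) (opA f p k)"
    unfolding opA_def by (intro dvd_diff dvd_add) auto
  have "low (n + k) (cocycle4 (wt (k + 4)) f (p (k + 4)))" if "k < 2"
    using low_mono[OF low_cocycle4[OF p], of "k + 4" "n + k"] that by simp
  from this show "low (n + k) (opX f p k)" "low (n + k) (opY f p k)"
    unfolding opX_def opY_def using assms(3)
    by (auto simp: numeral_eq_Suc)
qed

end

section \<open>Functionals with values in a representation\<close>

definition functionals :: "('i, 'v) rep \<Rightarrow> ((nat \<Rightarrow> complex poly) \<Rightarrow> 'v) set" where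
  "functionals M = {w. (\<forall>p. w p \<in> carrier M) \<and> (\<forall>p q. w (p + q) = w p \<oplus>\<^bsub>M\<^esub> w q) \<and>
     (\<forall>c p. w (vector_scale c p) = c \<odot>\<^bsub>M\<^esub> w p) \<and> (\<exists>n. \<forall>p. (\<forall>k<6. low n (p k)) \<longrightarrow> w p = \<zero>\<^bsub>M\<^esub>)}"

lemma functionalsD:
  assumes "w \<in> functionals M"
  shows "w p \<in> carrier M" "w (p + q) = w p \<oplus>\<^bsub>M\<^esub> w q" "w (vector_scale c p) = c \<odot>\<^bsub>M\<^esub> w p"
    "\<exists>n. \<forall>p. (\<forall>k<6. low n (p k)) \<longrightarrow> w p = \<zero>\<^bsub>M\<^esub>"
  using assms by (simp_all add: functionals_def)

lemma functionals_zero: "w \<in> functionals M \<Longrightarrow> w 0 = \<zero>\<^bsub>M\<^esub>"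
  using functionalsD(4)[of w M] by auto

lemma functionalsI:
  assumes "\<And>p. w p \<in> carrier M" "\<And>p q. w (p + q) = w p \<oplus>\<^bsub>M\<^esub> w q"
    "\<And>c p. w (vector_scale c p) = c \<odot>\<^bsub>M\<^esub> w p" "\<And>p. (\<And>k. k < 6 \<Longrightarrow> low n (p k)) \<Longrightarrow> w p = \<zero>\<^bsub>M\<^esub>"
  shows "w \<in> functionals M"
  using assms by (auto simp: functionals_def)

definition unit_vector :: "nat \<Rightarrow> nat \<Rightarrow> nat \<Rightarrow> complex poly" where
  "unit_vector k m = (\<lambda>j. if j = k then monom 1 m else 0)"

text \<open>
  The functional with value \<open>v\<close> at \<open>unit_vector k m\<close> and zero at the other unit vectors. As a polar part
  it is the multiple of \<open>v\<close> by the power of \<open>x\<close> with exponent \<open>-m-1\<close> in slot \<open>k\<close>, and it is a highest weight vector of that slot for \<open>m = 0\<close>.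
\<close>

definition coordinate :: "('i, 'v) rep \<Rightarrow> nat \<Rightarrow> nat \<Rightarrow> 'v \<Rightarrow> (nat \<Rightarrow> complex poly) \<Rightarrow> 'v" where
  "coordinate M k m v = (\<lambda>p. coeff (p k) m \<odot>\<^bsub>M\<^esub> v)"

context representation begin

lemma coordinate_functional [simp]:
  assumes "v \<in> carrier M" "k < 6"
  shows "coordinate M k m v \<in> functionals M"
proof (rule functionalsI[where n = "Suc m"])
  show "coordinate M k m v p = \<zero>" if "\<And>k. k < 6 \<Longrightarrow> low (Suc m) (p k)" for p
    using that[OF assms(2)] assms(1) by (simp add: coordinate_def monom_1_dvd_iff')
qed (use assms in \<open>auto simp: coordinate_def vector_scale_def scale_add_left scale_scale\<close>)

text \<open>
  Induction on the polynomial peels off its constant coefficient; the power of \<open>x\<close> in front of the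
  induction statement absorbs the shift of degrees.
\<close>

lemma functional_slot:
  assumes w: "w \<in> functionals M" and units: "\<And>m. w (unit_vector k m) = \<zero>"
  shows "w (\<lambda>j. if j = k then q else 0) = \<zero>"
proof -
  have "w (\<lambda>j. if j = k then monom 1 m * q else 0) = \<zero>" for m
  proof (induction q arbitrary: m)
    case 0
    have "(\<lambda>j. if j = k then monom 1 m * 0 else 0) = (0 :: nat \<Rightarrow> complex poly)"
      by (auto simp: fun_eq_iff)
    then show ?case using functionals_zero[OF w] by simp
  next
    case (pCons a q)
    have "monom 1 m * pCons a q = Polynomial.smult a (monom 1 m) + monom 1 (Suc m) * q"
      by (simp add: monom_Suc mult_pCons_right)
    then have "(\<lambda>j. if j = k then monom 1 m * pCons a q else 0) =
        vector_scale a (unit_vector k m) + (\<lambda>j. if j = k then monom 1 (Suc m) * q else 0)"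
      unfolding fun_eq_iff vector_scale_def unit_vector_def plus_fun_apply by (metis add.right_neutral smult_0_right)
    then show ?case
      using pCons.IH[of "Suc m"] units[of m] by (simp add: functionalsD(2,3)[OF w])
  qed
  moreover have "monom 1 0 * q = q" by (simp add: monom_0)
  ultimately show ?thesis by metis
qed

lemma functional_eq_zeroI:
  assumes w: "w \<in> functionals M" and units: "\<And>k m. k < 6 \<Longrightarrow> w (unit_vector k m) = \<zero>"
  shows "w p = \<zero>"
proof -
  have part: "w (\<lambda>k. if k < j then p k else 0) = \<zero>" if "j \<le> 6" for j
    using that
  proof (induction j)
    case 0
    then show ?case using functionals_zero[OF w] by (simp add: zero_fun_def)
  next
    case (Suc j)
    have "(\<lambda>k. if k < Suc j then p k else 0) =
        (\<lambda>k. if k < j then p k else 0) + (\<lambda>k. if k = j then p j else 0)"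
      by (auto simp: fun_eq_iff)
    then show ?case
      using Suc functional_slot[OF w units, of j "p j"] by (simp add: functionalsD(2)[OF w])
  qed
  have "p = (\<lambda>k. if k < 6 then p k else 0) + (\<lambda>k. if k < 6 then 0 else p k)"
    by (auto simp: fun_eq_iff)
  then have "w p = w (\<lambda>k. if k < 6 then p k else 0) \<oplus> w (\<lambda>k. if k < 6 then 0 else p k)"
    using functionalsD(2)[OF w] by metis
  moreover have "w (\<lambda>k. if k < 6 then 0 else p k) = \<zero>"
    using functionalsD(4)[OF w] by auto
  ultimately show ?thesis using part[of 6] by simp
qed

lemma functional_add:
  assumes u: "u \<in> functionals M" and w: "w \<in> functionals M"
  shows "(\<lambda>p. u p \<oplus> w p) \<in> functionals M"
proof -
  obtain m where m: "\<forall>p. (\<forall>k<6. low m (p k)) \<longrightarrow> u p = \<zero>"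
    using functionalsD(4)[OF u] ..
  obtain n where n: "\<forall>p. (\<forall>k<6. low n (p k)) \<longrightarrow> w p = \<zero>"
    using functionalsD(4)[OF w] ..
  show ?thesis
  proof (rule functionalsI[where n = "max m n"])
    show "u p \<oplus> w p = \<zero>" if p: "\<And>k. k < 6 \<Longrightarrow> low (max m n) (p k)" for p
    proof -
      have "u p = \<zero>" "w p = \<zero>"
        using m n low_mono[OF p] by simp_all
      then show ?thesis by simp
    qed
  qed (simp_all add: functionalsD[OF u] functionalsD[OF w] M.a_ac scale_add_right)
qed

lemma functional_scale:
  assumes w: "w \<in> functionals M"
  shows "(\<lambda>p. c \<odot> w p) \<in> functionals M"
proof -
  obtain n where "\<forall>p. (\<forall>k<6. low n (p k)) \<longrightarrow> w p = \<zero>"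
    using functionalsD(4)[OF w] ..
  then show ?thesis
    by (intro functionalsI[where n = n])
      (simp_all add: functionalsD[OF w] scale_add_right scale_scale mult.commute)
qed

lemma functional_zero_map: "(\<lambda>p. \<zero>) \<in> functionals M"
  by (rule functionalsI) auto

lemma functional_diff:
  assumes w: "w \<in> functionals M"
  shows "w (p - q) = w p \<ominus> w q"
proof -
  have "p - q = p + vector_scale (- 1) q" by (auto simp: vector_scale_def fun_eq_iff)
  then have "w (p - q) = w p \<oplus> (- 1) \<odot> w q"
    by (simp only: functionalsD(2,3)[OF w])
  then show ?thesis
    by (simp add: functionalsD(1)[OF w] scale_minus_one a_minus_def)
qed

lemma functional_eqI:
  assumes u: "u \<in> functionals M" and w: "w \<in> functionals M"
    and units: "\<And>k m. k < 6 \<Longrightarrow> u (unit_vector k m) = w (unit_vector k m)"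
  shows "u = w"
proof
  fix p
  have "(\<lambda>p. u p \<oplus> (-1) \<odot> w p) \<in> functionals M"
    by (intro functional_add functional_scale u w)
  then have "u p \<oplus> (-1) \<odot> w p = \<zero>"
    by (rule functional_eq_zeroI)
      (simp add: units functionalsD(1)[OF w] scale_minus_one M.r_neg)
  then show "u p = w p"
    using functionalsD(1)[OF u, of p] functionalsD(1)[OF w, of p]
    by (metis M.add.inv_closed M.minus_equality M.minus_minus scale_minus_one)
qed

end

section \<open>The module attached to a representation of the free algebra\<close>

context polar begin

definition polar_rep :: "(free_gen, 'v) rep \<Rightarrow> (complex poly, (nat \<Rightarrow> complex poly) \<Rightarrow> 'v) rep" where
  "polar_rep M = \<lparr>carrier = functionals M, mult = undefined, one = undefined,
     zero = (\<lambda>p. \<zero>\<^bsub>M\<^esub>), add = (\<lambda>u w p. u p \<oplus>\<^bsub>M\<^esub> w p), smult = (\<lambda>c w p. c \<odot>\<^bsub>M\<^esub> w p),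
     act = (\<lambda>f w p. w (opA f p) \<oplus>\<^bsub>M\<^esub> (act M X1 (w (opX f p)) \<oplus>\<^bsub>M\<^esub> act M X2 (w (opY f p))))\<rparr>"

lemma polar_rep_simps [simp]:
  "carrier (polar_rep M) = functionals M" "\<zero>\<^bsub>polar_rep M\<^esub> = (\<lambda>p. \<zero>\<^bsub>M\<^esub>)"
  "u \<oplus>\<^bsub>polar_rep M\<^esub> w = (\<lambda>p. u p \<oplus>\<^bsub>M\<^esub> w p)" "c \<odot>\<^bsub>polar_rep M\<^esub> w = (\<lambda>p. c \<odot>\<^bsub>M\<^esub> w p)"
  by (simp_all add: polar_rep_def)

lemma act_polar_rep:
  "act (polar_rep M) f w =
     (\<lambda>p. w (opA f p) \<oplus>\<^bsub>M\<^esub> (act M X1 (w (opX f p)) \<oplus>\<^bsub>M\<^esub> act M X2 (w (opY f p))))"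
  by (simp add: polar_rep_def)

end

locale polar_at = polar \<nu> + representation M
  for \<nu> :: complex and M :: "(free_gen, 'v) rep" (structure)
begin

lemma act_lin [simp]:
  "v \<in> carrier M \<Longrightarrow> w \<in> carrier M \<Longrightarrow> act M i (v \<oplus> w) = act M i v \<oplus> act M i w"
  "v \<in> carrier M \<Longrightarrow> act M i (c \<odot> v) = c \<odot> act M i v"
  "act M i \<zero> = \<zero>"
  using is_linearD(2,3)[OF act_linear] is_linear_zero[OF act_linear is_rep is_rep] by auto

lemma act_polar_closed:
  assumes w: "w \<in> functionals M"
  shows "act (polar_rep M) f w \<in> functionals M"
proof -
  obtain n where n: "\<forall>p. (\<forall>k<6. low n (p k)) \<longrightarrow> w p = \<zero>"
    using functionalsD(4)[OF w] ..
  show ?thesis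
    unfolding act_polar_rep
    by (rule functionalsI[where n = "n + 2"])
      (auto simp: functionalsD(1-3)[OF w] op_linear M.a_ac scale_add_right n op_low)
qed

text \<open>
  The products of two edges of length 4 are zero, so no terms quadratic in \<open>X1\<close> and \<open>X2\<close> survive and the
  result has the shape of the action itself.
\<close>

lemma act_act_polar:
  assumes w: "w \<in> functionals M"
  shows "act (polar_rep M) f (act (polar_rep M) g w) p =
    w (opA g (opA f p)) \<oplus> (act M X1 (w (opX g (opA f p) + opA g (opX f p))) \<oplus>
      act M X2 (w (opY g (opA f p) + opA g (opY f p))))"
  by (simp add: act_polar_rep opXY_zero functionals_zero[OF w] functionalsD(1,2)[OF w] M.a_ac)

lemma polar_rep_is_rep: "is_rep (polar_rep M)"
proof (rule is_repI)
  show "is_linear (polar_rep M) (polar_rep M) (act (polar_rep M) f)" for f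
    unfolding is_linear_def
    by (auto simp: act_polar_closed) (auto simp: act_polar_rep functionalsD(1) M.a_ac scale_add_right fun_eq_iff)
qed (auto simp: functional_zero_map functional_add functional_scale functionalsD(1) M.a_ac
    scale_add_left scale_add_right scale_scale fun_eq_iff)

sublocale P: representation "polar_rep M"
  by unfold_locales (rule polar_rep_is_rep)

lemma polar_minus: "w \<in> functionals M \<Longrightarrow> \<ominus>\<^bsub>polar_rep M\<^esub> w = (\<lambda>p. \<ominus> w p)"
  using P.scale_minus_one[of w] by (simp add: functionalsD(1) scale_minus_one)

lemma polar_rep_witt_module: "witt_module (polar_rep M)"
  unfolding witt_module_def
proof (intro conjI allI ballI)
  fix f g w assume "w \<in> carrier (polar_rep M)"
  then have w: "w \<in> functionals M" by simp
  note [simp] = functionalsD(1)[OF w]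
  show "act (polar_rep M) (f + g) w = act (polar_rep M) f w \<oplus>\<^bsub>polar_rep M\<^esub> act (polar_rep M) g w"
    by (simp add: act_polar_rep op_linear functionalsD[OF w] M.a_ac)
  show "act (polar_rep M) (bracket f g) w =
      act (polar_rep M) f (act (polar_rep M) g w) \<ominus>\<^bsub>polar_rep M\<^esub> act (polar_rep M) g (act (polar_rep M) f w)"
    by (simp add: a_minus_def polar_minus act_polar_closed w)
      (simp add: act_act_polar[OF w] act_polar_rep[of M "bracket f g"] opA_bracket opX_bracket opY_bracket
        functional_diff[OF w] a_minus_def scale_add_right M.a_ac flip: scale_minus_one)
next
  fix c f w assume "w \<in> carrier (polar_rep M)"
  then have w: "w \<in> functionals M" by simp
  show "act (polar_rep M) (Polynomial.smult c f) w = c \<odot>\<^bsub>polar_rep M\<^esub> act (polar_rep M) f w"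
    by (simp add: act_polar_rep op_linear functionalsD[OF w] scale_add_right)
qed (rule polar_rep_is_rep)

text \<open>
  A functional that vanishes at order \<open>r k\<close> in slot \<open>k\<close> is the sum of its coordinates of degree less than
  \<open>r k\<close>. The induction removes one of them at a time and thereby lowers one \<open>r k\<close> by one. The orders may
  differ from slot to slot because local finiteness needs a staircase.
\<close>

lemma polar_span:
  assumes U: "submodule U complex_ring (polar_rep M)"
    and e: "\<And>k m v. k < 6 \<Longrightarrow> m < r k \<Longrightarrow> v \<in> carrier M \<Longrightarrow> coordinate M k m v \<in> U"
    and w: "w \<in> functionals M" and van: "\<And>p. (\<And>k. k < 6 \<Longrightarrow> low (r k) (p k)) \<Longrightarrow> w p = \<zero>"
  shows "w \<in> U"
  using e w van
proof (induction "\<Sum>k<6. r k" arbitrary: r w rule: less_induct)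
  case less
  show ?case
  proof (cases "\<exists>k<6. r k > 0")
    case False
    then have "w p = \<zero>" for p by (intro less.prems(3)) auto
    then have "w = \<zero>\<^bsub>polar_rep M\<^esub>" by (simp add: fun_eq_iff)
    then show ?thesis using P.submoduleD(2)[OF U] by simp
  next
    case True
    then obtain k where k: "k < 6" "r k > 0" by blast
    note w = less.prems(2)
    define m where "m = r k - 1"
    define s where "s = r(k := m)"
    define v where "v = w (unit_vector k m)"
    have v: "v \<in> carrier M" by (simp add: v_def functionalsD(1)[OF w])
    let ?c = "coordinate M k m v"
    let ?w = "w \<oplus>\<^bsub>polar_rep M\<^esub> (- 1) \<odot>\<^bsub>polar_rep M\<^esub> ?c"
    have wv: "w p = coeff (p k) m \<odot> v" if p: "\<And>j. j < 6 \<Longrightarrow> low (s j) (p j)" for p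
    proof -
      \<comment> \<open>Replacing \<open>p\<close> by \<open>?q\<close> clears the only coefficient below order \<open>r k\<close>.\<close>
      let ?q = "p + vector_scale (- coeff (p k) m) (unit_vector k m)"
      have "w ?q = \<zero>"
      proof (rule less.prems(3))
        fix j assume j: "j < (6 :: nat)"
        show "low (r j) (?q j)"
          using p[OF j] k(2) by (auto simp: s_def m_def vector_scale_def unit_vector_def monom_1_dvd_iff' not_less_eq less_Suc_eq
             split: if_splits)
      qed
      then have "w p \<oplus> (- coeff (p k) m) \<odot> v = \<zero>"
        by (simp add: functionalsD(2,3)[OF w] v_def)
      then have "(w p \<oplus> (- coeff (p k) m) \<odot> v) \<oplus> coeff (p k) m \<odot> v = coeff (p k) m \<odot> v"
        using v by simp
      then show ?thesis
        using v functionalsD(1)[OF w, of p]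
        by (simp add: M.a_assoc flip: scale_add_left)
    qed
    have c: "?c \<in> U" using less.prems(1)[OF k(1) _ v, of m] k by (simp add: m_def)
    have cf: "?c \<in> functionals M" using v k(1) by simp
    have wf: "?w \<in> functionals M"
      using w cf by (simp add: functional_add functional_scale)
    have "?w \<in> U"
    proof (rule less.hyps[of s])
      show "(\<Sum>k<6. s k) < (\<Sum>k<6. r k)"
        using k by (intro sum_strict_mono_ex1) (auto simp: s_def m_def)
      show "coordinate M j i u \<in> U" if "j < 6" "i < s j" "u \<in> carrier M" for j i u
        using less.prems(1)[of j i u] that by (auto simp: s_def m_def split: if_splits)
      show "?w \<in> functionals M" by (rule wf)
      show "?w p = \<zero>" if "\<And>j. j < 6 \<Longrightarrow> low (s j) (p j)" for p
        using wv[OF that] v by (simp add: coordinate_def scale_scale flip: scale_add_left)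
    qed
    then have "?w \<oplus>\<^bsub>polar_rep M\<^esub> ?c \<in> U"
      using P.submoduleD(3)[OF U _ c] by blast
    also have "?w \<oplus>\<^bsub>polar_rep M\<^esub> ?c = w \<oplus>\<^bsub>polar_rep M\<^esub> ((- 1) \<odot>\<^bsub>polar_rep M\<^esub> ?c \<oplus>\<^bsub>polar_rep M\<^esub> 1 \<odot>\<^bsub>polar_rep M\<^esub> ?c)"
      using P.M.a_assoc[of w "(- 1) \<odot>\<^bsub>polar_rep M\<^esub> ?c" ?c] P.scale_one[of ?c] P.scale_closed[of ?c "- 1"] w cf
      by (simp del: polar_rep_simps(3,4))
    also have "\<dots> = w"
      using w cf P.scale_add_left[of ?c "- 1" 1] P.M.r_zero[of w] P.scale_zero_left[of ?c]
      by (simp del: polar_rep_simps(2,3,4))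
    finally show ?thesis .
  qed
qed

lemma polar_span_all:
  assumes U: "submodule U complex_ring (polar_rep M)"
    and e: "\<And>k m v. k < 6 \<Longrightarrow> v \<in> carrier M \<Longrightarrow> coordinate M k m v \<in> U"
  shows "U = functionals M"
proof
  show "U \<subseteq> functionals M" using P.submoduleD(1)[OF U] by simp
  show "functionals M \<subseteq> U"
  proof
    fix w assume w: "w \<in> functionals M"
    obtain n where n: "\<forall>p. (\<forall>k<6. low n (p k)) \<longrightarrow> w p = \<zero>"
      using functionalsD(4)[OF w] ..
    show "w \<in> U"
      by (rule polar_span[OF U e w, where r = "\<lambda>_. n"]) (simp_all add: n)
  qed
qed

end

section \<open>Membership in the block\<close>

lemma d_values: "d (-1) = 1" "d 0 = monom 1 1" "d 1 = monom 1 2" "d 2 = monom 1 3"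
  by (simp_all add: d_def one_pCons monom_0 eval_nat_numeral)

lemma pderiv_iter_monom_zero: "m < n \<Longrightarrow> (pderiv ^^ n) (monom c m :: complex poly) = 0"
proof (induction n arbitrary: c m)
  case (Suc n)
  then show ?case
    by (cases m) (auto simp: funpow_Suc_right pderiv_monom simp del: funpow.simps)
qed simp

lemma witt_plus_low:
  assumes "f \<in> witt_plus"
  shows "low 2 f"
proof -
  interpret Modules.module "Polynomial.smult :: complex \<Rightarrow> complex poly \<Rightarrow> complex poly"
    by unfold_locales (simp_all add: smult_add_right smult_add_left)
  have "span (d ` {i. i > 0}) \<subseteq> {f. low 2 f}"
  proof (rule span_minimal)
    show "d ` {i. i > 0} \<subseteq> {f. low 2 f}"
      by (auto simp: d_def monom_1_dvd_iff')
    show "subspace {f :: complex poly. low 2 f}"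
      by (auto simp: subspace_def intro: dvd_smult)
  qed
  then show ?thesis using assms by (auto simp: witt_plus_def)
qed

text \<open>
  The cocycles involve only derivatives of order at least three of the vector field, so the subalgebra
  spanned by \<open>d (-1)\<close>, \<open>d 0\<close> and \<open>d 1\<close> acts inside each slot.
\<close>

lemma (in polar) op_monom_low:
  assumes "m < 3"
  shows "opA (monom 1 m) p = (\<lambda>k. - lie (wt k) (monom 1 m) (p k))"
    "opX (monom 1 m) p = 0" "opY (monom 1 m) p = 0"
  using assms
  by (auto simp: op_defs cocycle2_def cocycle3_def cocycle4_def pderiv_iter_monom_zero fun_eq_iff)

lemma coeff_lie_x: "coeff (lie \<nu> (monom 1 1) q) m = (of_nat m + \<nu>) * coeff q m"
proof -
  have "pderiv (monom 1 1) = (1 :: complex poly)"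
    by (simp add: pderiv_monom monom_0 flip: one_pCons)
  then show ?thesis
    unfolding lie_def coeff_add coeff_monom_mult coeff_pderiv coeff_smult
    by (cases m) (simp_all add: ring_distribs)
qed

context polar_at begin

lemma act_polar_low:
  assumes "w \<in> functionals M" "m < 3"
  shows "act (polar_rep M) (monom 1 m) w = (\<lambda>p. w (\<lambda>k. - lie (wt k) (monom 1 m) (p k)))"
  by (simp add: act_polar_rep op_monom_low[OF assms(2)] functionals_zero[OF assms(1)] functionalsD(1)[OF assms(1)])

lemma act_d0_unit:
  assumes w: "w \<in> functionals M"
  shows "act (polar_rep M) (d 0) w (unit_vector k m) = (- (of_nat m + wt k)) \<odot> w (unit_vector k m)"
proof -
  have "(\<lambda>j. - lie (wt j) (monom 1 1) (unit_vector k m j)) = vector_scale (- (of_nat m + wt k)) (unit_vector k m)"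
    by (auto simp: vector_scale_def unit_vector_def fun_eq_iff poly_eq_iff coeff_lie_x lie_linear simp del: One_nat_def)
  then show ?thesis
    using act_polar_low[OF w, of 1] by (simp add: d_values functionalsD(3)[OF w])
qed

text \<open>
  Slot \<open>k\<close> contains at most one monomial that is paired with functionals of weight \<open>\<eta>\<close>. Composition with
  this truncation is the projection to the weight space.
\<close>

definition weight_part :: "complex \<Rightarrow> (nat \<Rightarrow> complex poly) \<Rightarrow> nat \<Rightarrow> complex poly" where
  "weight_part \<eta> p = (\<lambda>k. if \<exists>m. \<eta> = - (of_nat m + wt k)
     then let m = (THE m. \<eta> = - (of_nat m + wt k)) in monom (coeff (p k) m) m else 0)"

lemma coeff_weight_part:
  "coeff (weight_part \<eta> p k) m = (if \<eta> = - (of_nat m + wt k) then coeff (p k) m else 0)"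
proof (cases "\<exists>m. \<eta> = - (of_nat m + wt k)")
  case True
  then obtain n where n: "\<eta> = - (of_nat n + wt k)" by blast
  then have "(THE m. \<eta> = - (of_nat m + wt k)) = n" by (intro the_equality) auto
  with n True show ?thesis by (auto simp: weight_part_def Let_def)
qed (auto simp: weight_part_def)

lemma weight_part_linear:
  "weight_part \<eta> (p + q) = weight_part \<eta> p + weight_part \<eta> q"
  "weight_part \<eta> (vector_scale c p) = vector_scale c (weight_part \<eta> p)"
  by (auto simp: fun_eq_iff poly_eq_iff coeff_weight_part vector_scale_def)

lemma weight_part_unit:
  "weight_part \<eta> (unit_vector k m) = (if \<eta> = - (of_nat m + wt k) then unit_vector k m else 0)"
  by (auto simp: fun_eq_iff poly_eq_iff coeff_weight_part unit_vector_def coeff_monom)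

lemma weight_part_functional:
  assumes w: "w \<in> functionals M"
  shows "(\<lambda>p. w (weight_part \<eta> p)) \<in> functionals M"
proof -
  obtain n where n: "\<forall>p. (\<forall>k<6. low n (p k)) \<longrightarrow> w p = \<zero>"
    using functionalsD(4)[OF w] ..
  show ?thesis
    by (rule functionalsI[where n = n])
      (auto simp: functionalsD(1-3)[OF w] weight_part_linear n monom_1_dvd_iff' coeff_weight_part)
qed

lemma weight_part_unit_of_weight:
  assumes w: "w \<in> weight_space (polar_rep M) \<eta>" 
  shows "w (weight_part \<theta> (unit_vector k m)) = (if \<theta> = \<eta> then w (unit_vector k m) else \<zero>)"
proof -
  have wf: "w \<in> functionals M" and eq: "act (polar_rep M) (d 0) w = (\<lambda>p. \<eta> \<odot> w p)"
    using w by (auto simp: weight_space_def)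
  have "w (unit_vector k m) = \<zero>" if "\<eta> \<noteq> - (of_nat m + wt k)"
    using scale_left_cancel[OF _ that] act_d0_unit[OF wf] functionalsD(1)[OF wf] by (simp add: eq)
  then show ?thesis
    by (auto simp: weight_part_unit functionals_zero[OF wf])
qed

lemma polar_rep_weight_module: "weight_module (polar_rep M)"
proof (rule weight_moduleI[OF polar_rep_is_rep])
  let ?\<pi> = "\<lambda>\<eta> w p. w (weight_part \<eta> p)"
  show "is_linear (polar_rep M) (polar_rep M) (?\<pi> \<eta>)" for \<eta>
    by (auto simp: is_linear_def weight_part_functional)
  show "?\<pi> \<eta> w \<in> weight_space (polar_rep M) \<eta>" if "w \<in> carrier (polar_rep M)" for w \<eta>
  proof -
    have w: "w \<in> functionals M" using that by simp
    note wf = weight_part_functional[OF w, of \<eta>]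
    have "act (polar_rep M) (d 0) (?\<pi> \<eta> w) = (\<lambda>p. \<eta> \<odot> ?\<pi> \<eta> w p)"
      by (rule functional_eqI)
        (auto simp: act_polar_closed wf functional_scale act_d0_unit weight_part_unit functionals_zero[OF w])
    then show ?thesis using wf by (simp add: weight_space_def)
  qed
  show "?\<pi> \<eta> w = w" if w: "w \<in> weight_space (polar_rep M) \<eta>" for w \<eta>
  proof -
    have "w \<in> functionals M" using w by (simp add: weight_space_def)
    then show ?thesis
      by (intro functional_eqI) (auto simp: weight_part_functional weight_part_unit_of_weight[OF w])
  qed
  show "?\<pi> \<eta> w = \<zero>\<^bsub>polar_rep M\<^esub>" if w: "w \<in> weight_space (polar_rep M) \<theta>" "\<eta> \<noteq> \<theta>" for w \<eta> \<theta>
  proof -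
    have "w \<in> functionals M" using w by (simp add: weight_space_def)
    then have "?\<pi> \<eta> w = (\<lambda>p. \<zero>)"
      by (intro functional_eqI)
        (use w in \<open>auto simp: weight_part_functional functional_zero_map weight_part_unit_of_weight[OF w(1)]\<close>)
    then show ?thesis by simp
  qed
  show "finite {\<eta>. ?\<pi> \<eta> w \<noteq> \<zero>\<^bsub>polar_rep M\<^esub>}" if "w \<in> carrier (polar_rep M)" for w
  proof -
    have w: "w \<in> functionals M" using that by simp
    obtain n where n: "\<forall>p. (\<forall>k<6. low n (p k)) \<longrightarrow> w p = \<zero>"
      using functionalsD(4)[OF w] ..
    let ?A = "(\<lambda>(m, k). - (of_nat m + wt k)) ` ({..<n} \<times> {..<6})"
    have "?\<pi> \<eta> w = (\<lambda>p. \<zero>)" if "\<eta> \<notin> ?A" for \<eta>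
    proof
      fix p
      have "low n (weight_part \<eta> p k)" if "k < 6" for k
        using \<open>\<eta> \<notin> ?A\<close> that by (auto simp: monom_1_dvd_iff' coeff_weight_part image_iff)
      then show "w (weight_part \<eta> p) = \<zero>" using n by blast
    qed
    then have "{\<eta>. ?\<pi> \<eta> w \<noteq> \<zero>\<^bsub>polar_rep M\<^esub>} \<subseteq> ?A" by auto
    then show ?thesis by (rule finite_subset) simp
  qed
  show "w = \<zero>\<^bsub>polar_rep M\<^esub>"
    if "w \<in> carrier (polar_rep M)" and zero: "\<And>\<eta>. ?\<pi> \<eta> w = \<zero>\<^bsub>polar_rep M\<^esub>" for w
  proof -
    have w: "w \<in> functionals M" using that by simp
    have "w (unit_vector k m) = \<zero>" for k m
      using fun_cong[OF zero[of "- (of_nat m + wt k)"], of "unit_vector k m"] by (simp add: weight_part_unit)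
    then have "w = (\<lambda>p. \<zero>)"
      by (intro functional_eqI[OF w functional_zero_map])
    then show ?thesis by simp
  qed
qed

lemma Supp_polar_rep: "Supp (polar_rep M) \<subseteq> {- (of_nat m + wt k) |m k. True}"
proof
  fix \<eta> assume "\<eta> \<in> Supp (polar_rep M)"
  moreover have "\<zero>\<^bsub>polar_rep M\<^esub> \<in> weight_space (polar_rep M) \<eta>"
    using is_linear_zero[OF P.act_linear P.is_rep P.is_rep] P.zero_closed P.scale_zero_right
    unfolding weight_space_def by (metis (mono_tags, lifting) mem_Collect_eq)
  ultimately obtain w where w: "w \<in> weight_space (polar_rep M) \<eta>" "w \<noteq> \<zero>\<^bsub>polar_rep M\<^esub>"
    unfolding Supp_def by blast
  then have wf: "w \<in> functionals M" by (simp add: weight_space_def)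
  then obtain k m where km: "w (unit_vector k m) \<noteq> \<zero>"
    using functional_eqI[OF wf functional_zero_map] w(2) by auto
  have "w (weight_part \<eta> (unit_vector k m)) \<noteq> \<zero>"
    using weight_part_unit_of_weight[OF w(1), of \<eta> k m] km by simp
  then have "\<eta> = - (of_nat m + wt k)"
    by (auto simp: weight_part_unit functionals_zero[OF wf] split: if_splits)
  then show "\<eta> \<in> {- (of_nat m + wt k) |m k. True}" by blast
qed

lemma act_lowering_coordinate:
  assumes "v \<in> carrier M" "k < 6"
  shows "act (polar_rep M) (d (-1)) (coordinate M k m v) =
    (- of_nat (Suc m)) \<odot>\<^bsub>polar_rep M\<^esub> coordinate M k (Suc m) v"
proof -
  have "d (-1) = monom 1 0" by (simp add: d_values one_pCons monom_0)
  then show ?thesis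
    using act_polar_low[OF coordinate_functional[OF assms, of m], of 0] assms
    by (simp add: coordinate_def lie_def pderiv_monom coeff_pderiv scale_scale monom_0 fun_eq_iff
        algebra_simps flip: one_pCons)
qed

lemma coordinate_add:
  "v \<in> carrier M \<Longrightarrow> w \<in> carrier M \<Longrightarrow>
     coordinate M k m (v \<oplus> w) = coordinate M k m v \<oplus>\<^bsub>polar_rep M\<^esub> coordinate M k m w"
  "v \<in> carrier M \<Longrightarrow> coordinate M k m (c \<odot> v) = c \<odot>\<^bsub>polar_rep M\<^esub> coordinate M k m v"
  "coordinate M k m \<zero> = \<zero>\<^bsub>polar_rep M\<^esub>"
  by (simp_all add: coordinate_def scale_add_right scale_scale mult.commute)

lemma coordinates_of_spanning_set:
  assumes U: "submodule U complex_ring (polar_rep M)"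
    and S: "S \<subseteq> carrier M" "generated M {} S = carrier M"
    and sU: "\<And>s. s \<in> S \<Longrightarrow> coordinate M k m s \<in> U" and v: "v \<in> carrier M"
  shows "coordinate M k m v \<in> U"
proof -
  have "submodule {v \<in> carrier M. coordinate M k m v \<in> U} complex_ring M"
    unfolding submodule_iff using P.submoduleD(2-4)[OF U]
    by (auto simp: coordinate_add simp del: polar_rep_simps)
  then have "generated M {} S \<subseteq> {v \<in> carrier M. coordinate M k m v \<in> U}"
    by (rule generated_least) (use S sU in auto)
  then show ?thesis using S v by auto
qed

text \<open>
  In each slot the lowering operator \<open>d (-1)\<close> takes a coordinate of degree \<open>m\<close> to a nonzero multiple of the one
  of degree \<open>m + 1\<close>, hence the highest weight vectors generate the module.
\<close>

lemma polar_rep_generated: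
  assumes U: "subrep (polar_rep M) U"
    and e: "\<And>k v. k < 6 \<Longrightarrow> v \<in> carrier M \<Longrightarrow> coordinate M k 0 v \<in> U"
  shows "U = functionals M"
proof (rule polar_span_all)
  note Ud = subrepD[OF U polar_rep_is_rep]
  show "submodule U complex_ring (polar_rep M)" using U by (simp add: subrep_def)
  show "coordinate M k m v \<in> U" if kv: "k < 6" "v \<in> carrier M" for k m v
  proof (induction m)
    case (Suc m)
    let ?c = "coordinate M k (Suc m) v"
    have "(- of_nat (Suc m)) \<odot>\<^bsub>polar_rep M\<^esub> ?c \<in> U"
      using Ud(5)[OF Suc] act_lowering_coordinate[OF kv(2,1)] by metis
    then have "inverse (- of_nat (Suc m)) \<odot>\<^bsub>polar_rep M\<^esub> ((- of_nat (Suc m)) \<odot>\<^bsub>polar_rep M\<^esub> ?c) \<in> U"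
      by (rule Ud(4))
    moreover have "inverse (- of_nat (Suc m)) * (- of_nat (Suc m)) = (1 :: complex)"
      by (metis left_inverse neg_equal_0_iff_equal of_nat_neq_0)
    ultimately show ?case
      using P.scale_scale[of ?c] P.scale_one[of ?c] kv by (simp del: polar_rep_simps(2-4) of_nat_Suc)
  qed (rule e[OF kv])
qed

lemma polar_rep_finitely_generated:
  assumes "finite_dim M (carrier M)"
  shows "\<exists>S. finite S \<and> S \<subseteq> carrier (polar_rep M) \<and> generated (polar_rep M) UNIV S = carrier (polar_rep M)"
proof -
  obtain S where S: "finite S" "S \<subseteq> carrier M" "generated M {} S = carrier M"
    using assms unfolding finite_dim_def by blast
  let ?S = "(\<lambda>(k, s). coordinate M k 0 s) ` ({..<6} \<times> S)"
  let ?U = "generated (polar_rep M) UNIV ?S"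
  have sub: "?S \<subseteq> carrier (polar_rep M)" using S(2) by auto
  have U: "submodule ?U complex_ring (polar_rep M)" by (rule P.generated_submodule[OF sub])
  have "subrep (polar_rep M) ?U"
    unfolding subrep_def using U by (auto intro: generated_stable)
  moreover have "coordinate M k 0 v \<in> ?U" if "k < 6" "v \<in> carrier M" for k v
    by (rule coordinates_of_spanning_set[OF U S(2,3) _ that(2)])
      (use generated_superset[of ?S "polar_rep M" UNIV] that(1) in auto)
  ultimately have "?U = functionals M" by (rule polar_rep_generated)
  then show ?thesis using S(1) sub by (intro exI[of _ ?S]) simp
qed

text \<open>
  The functionals that vanish on the staircase \<open>n + k\<close> form a finite-dimensional space that is stable
  under the positive part.
\<close>

lemma polar_rep_locally_finite:
  assumes "finite_dim M (carrier M)" and "w \<in> functionals M"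
  shows "finite_dim (polar_rep M) (generated (polar_rep M) witt_plus {w})"
proof -
  obtain S where S: "finite S" "S \<subseteq> carrier M" "generated M {} S = carrier M"
    using assms unfolding finite_dim_def by blast
  obtain n where n: "\<forall>p. (\<forall>k<6. low n (p k)) \<longrightarrow> w p = \<zero>"
    using functionalsD(4)[OF assms(2)] ..
  let ?L = "{u \<in> functionals M. \<forall>p. (\<forall>k<6. low (n + k) (p k)) \<longrightarrow> u p = \<zero>}"
  have L: "submodule ?L complex_ring (polar_rep M)"
    unfolding P.submodule_iff
    by (auto simp: functional_add functional_scale functional_zero_map)
  have stable: "act (polar_rep M) f ` ?L \<subseteq> ?L" if "f \<in> witt_plus" for f
  proof (safe)
    fix u assume u: "u \<in> functionals M" "\<forall>p. (\<forall>k<6. low (n + k) (p k)) \<longrightarrow> u p = \<zero>"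
    show "act (polar_rep M) f u \<in> functionals M" by (rule act_polar_closed[OF u(1)])
    fix p :: "nat \<Rightarrow> complex poly" assume p: "\<forall>k<6. low (n + k) (p k)"
    show "act (polar_rep M) f u p = \<zero>"
      using op_low_staircase[of n p f] p u(2) witt_plus_low[OF that] by (simp add: act_polar_rep)
  qed
  have "w p = \<zero>" if p: "\<forall>k<6. low (n + k) (p k)" for p
  proof -
    have "low n (p k)" if "k < 6" for k
      using p that low_mono[of "n + k" "p k" n] by simp
    then show ?thesis using n by blast
  qed
  then have "w \<in> ?L" using assms(2) by simp
  then have gen: "generated (polar_rep M) witt_plus {w} \<subseteq> ?L"
    using L stable by (intro generated_least) auto
  let ?T = "(\<lambda>(k, m, s). coordinate M k m s) ` ({..<6} \<times> {..<n + 6} \<times> S)"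
  have T: "?T \<subseteq> carrier (polar_rep M)" using S(2) by auto
  have U: "submodule (generated (polar_rep M) {} ?T) complex_ring (polar_rep M)"
    by (rule P.generated_submodule[OF T])
  have "coordinate M k m v \<in> generated (polar_rep M) {} ?T"
    if "k < 6" "m < n + k" "v \<in> carrier M" for k m v
  proof (rule coordinates_of_spanning_set[OF U S(2,3) _ that(3)])
    fix s assume "s \<in> S"
    then have "coordinate M k m s \<in> ?T"
      using that by (intro image_eqI[of _ _ "(k, m, s)"]) auto
    then show "coordinate M k m s \<in> generated (polar_rep M) {} ?T"
      using generated_superset[of ?T "polar_rep M" "{}"] by blast
  qed
  then have "?L \<subseteq> generated (polar_rep M) {} ?T"
    using polar_span[OF U, where r = "\<lambda>k. n + k"] by auto
  then show ?thesis
    using S(1) T gen assms(2)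
    by (intro P.finite_dim_subspace[of ?T] P.generated_submodule) auto
qed

lemma polar_rep_in_block:
  assumes "finite_dim M (carrier M)" and \<nu>: "\<nu> = of_int K - \<mu>"
  shows "polar_rep M \<in> block_O \<mu>"
proof -
  have "- (of_nat m + wt k) = \<mu> + of_int (int k - int m - K)" for m k
    unfolding wt_def by (simp add: \<nu>)
  then have "{- (of_nat m + wt k) |m k. True} \<subseteq> {\<mu> + of_int n |n. True}"
    by blast
  with Supp_polar_rep have "Supp (polar_rep M) \<subseteq> {\<mu> + of_int n |n. True}"
    by (rule subset_trans)
  then show ?thesis
    using polar_rep_witt_module polar_rep_weight_module polar_rep_finitely_generated[OF assms(1)]
      polar_rep_locally_finite[OF assms(1)]
    by (auto simp: block_O_def category_O_def)
qed

end

section \<open>Functoriality and exactness\<close>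

definition polar_map :: "(free_gen, 'v) rep \<Rightarrow> ('v \<Rightarrow> 'v) \<Rightarrow>
    ((nat \<Rightarrow> complex poly) \<Rightarrow> 'v) \<Rightarrow> (nat \<Rightarrow> complex poly) \<Rightarrow> 'v" where
  "polar_map M f = (\<lambda>w\<in>functionals M. \<lambda>p. f (w p))"

lemma functional_map:
  assumes f: "f \<in> rep_hom M N" "is_rep M" "is_rep N" and w: "w \<in> functionals M"
  shows "(\<lambda>p. f (w p)) \<in> functionals N"
proof -
  obtain n where n: "\<forall>p. (\<forall>k<6. low n (p k)) \<longrightarrow> w p = \<zero>\<^bsub>M\<^esub>"
    using functionalsD(4)[OF w] ..
  show ?thesis
    by (rule functionalsI[where n = n])
      (simp_all add: functionalsD(1-3)[OF w] rep_homD[OF f(1)] rep_hom_zero[OF f] n)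
qed

text \<open>
  A functional with values in the image of an injective homomorphism lifts through it, and the lift
  vanishes wherever the functional does. This gives exactness in the middle.
\<close>

lemma functional_pullback:
  assumes f: "f \<in> rep_hom M N" "is_rep M" "is_rep N" and inj: "inj_on f (carrier M)"
    and w: "w \<in> functionals N" and img: "\<And>p. w p \<in> f ` carrier M"
  shows "\<exists>u\<in>functionals M. w = (\<lambda>p. f (u p))"
proof -
  interpret M: representation M using f by unfold_locales
  obtain n where n: "\<forall>p. (\<forall>k<6. low n (p k)) \<longrightarrow> w p = \<zero>\<^bsub>N\<^esub>"
    using functionalsD(4)[OF w] ..
  define u where "u = (\<lambda>p. inv_into (carrier M) f (w p))"
  have u: "u p \<in> carrier M" "f (u p) = w p" for p
    using img[of p] by (simp_all add: u_def inv_into_into f_inv_into_f)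
  have eqI: "u p = v" if "v \<in> carrier M" "f v = w p" for p v
    using inj_onD[OF inj, of "u p" v] u that by simp
  have "u \<in> functionals M"
    by (rule functionalsI[where n = n])
      (auto simp: u n functionalsD(2,3)[OF w] rep_homD[OF f(1)] rep_hom_zero[OF f] intro!: eqI)
  then show ?thesis using u(2) by (intro bexI[of _ u]) auto
qed

context polar begin

lemma polar_at: "is_rep M \<Longrightarrow> polar_at M"
  by unfold_locales

lemma polar_map_hom:
  assumes f: "f \<in> rep_hom M N" and M: "is_rep M" and N: "is_rep N"
  shows "polar_map M f \<in> rep_hom (polar_rep M) (polar_rep N)"
proof -
  interpret M: polar_at \<nu> M by (rule polar_at[OF M])
  interpret N: polar_at \<nu> N by (rule polar_at[OF N])
  show ?thesis
  proof (rule rep_homI)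
    fix u w assume "u \<in> carrier (polar_rep M)" "w \<in> carrier (polar_rep M)"
    then show "polar_map M f (u \<oplus>\<^bsub>polar_rep M\<^esub> w) = polar_map M f u \<oplus>\<^bsub>polar_rep N\<^esub> polar_map M f w"
      by (simp add: polar_map_def M.functional_add functionalsD(1) rep_homD[OF f])
  next
    fix u assume u: "u \<in> carrier (polar_rep M)"
    show "polar_map M f u \<in> carrier (polar_rep N)"
      using u by (simp add: polar_map_def functional_map[OF f M N])
    show "polar_map M f (c \<odot>\<^bsub>polar_rep M\<^esub> u) = c \<odot>\<^bsub>polar_rep N\<^esub> polar_map M f u" for c
      using u by (simp add: polar_map_def M.functional_scale functionalsD(1) rep_homD[OF f])
    show "polar_map M f (act (polar_rep M) g u) = act (polar_rep N) g (polar_map M f u)" for g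
      using u M.act_polar_closed[of u g]
      by (simp add: polar_map_def) (simp add: act_polar_rep functionalsD(1) rep_homD[OF f])
  qed (simp add: polar_map_def)
qed

text \<open>
  For the surjectivity of the second map it suffices to reach the coordinates, since the image is a
  subspace and the coordinates span.
\<close>

lemma polar_map_exact:
  assumes ex: "short_exact A f B g C" and A: "is_rep A" and B: "is_rep B" and C: "is_rep C"
  shows "short_exact (polar_rep A) (polar_map A f) (polar_rep B) (polar_map B g) (polar_rep C)"
proof -
  interpret A: polar_at \<nu> A by (rule polar_at[OF A])
  interpret B: polar_at \<nu> B by (rule polar_at[OF B])
  interpret C: polar_at \<nu> C by (rule polar_at[OF C])
  have f: "f \<in> rep_hom A B" "inj_on f (carrier A)" "f ` carrier A = {v \<in> carrier B. g v = \<zero>\<^bsub>C\<^esub>}"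
    and g: "g \<in> rep_hom B C" "g ` carrier B = carrier C"
    using ex by (auto simp: short_exact_def)
  have gf: "g (f v) = \<zero>\<^bsub>C\<^esub>" if "v \<in> carrier A" for v using f(3) that by blast
  have "inj_on (polar_map A f) (functionals A)"
  proof (rule inj_onI)
    fix u w assume u: "u \<in> functionals A" and w: "w \<in> functionals A" and "polar_map A f u = polar_map A f w"
    then have "f (u p) = f (w p)" for p by (simp add: polar_map_def fun_eq_iff)
    then show "u = w"
      using inj_onD[OF f(2)] functionalsD(1)[OF u] functionalsD(1)[OF w] by (intro ext) blast
  qed
  moreover have "polar_map A f ` functionals A = {w \<in> functionals B. polar_map B g w = (\<lambda>p. \<zero>\<^bsub>C\<^esub>)}" (is "?I = ?K")
  proof
    show "?I \<subseteq> ?K"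
      using functional_map[OF f(1) A B] gf by (auto simp: polar_map_def functionalsD(1))
    show "?K \<subseteq> ?I"
    proof
      fix w assume w: "w \<in> ?K"
      then have "g (w p) = \<zero>\<^bsub>C\<^esub>" "w p \<in> carrier B" for p
        by (auto simp: polar_map_def fun_eq_iff functionalsD(1))
      then have "w p \<in> f ` carrier A" for p using f(3) by blast
      then obtain u where "u \<in> functionals A" "w = (\<lambda>p. f (u p))"
        using functional_pullback[OF f(1) A B f(2)] w by blast
      then show "w \<in> ?I" by (intro image_eqI[of _ _ u]) (simp_all add: polar_map_def)
    qed
  qed
  moreover have "polar_map B g ` functionals B = functionals C"
  proof (rule C.polar_span_all)
    have "submodule (polar_map B g ` carrier (polar_rep B)) complex_ring (polar_rep C)"
      by (rule submodule_image[OF rep_homD(2)[OF polar_map_hom[OF g(1) B C]] B.polar_rep_is_rep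
          C.polar_rep_is_rep B.P.submodule_carrier])
    then show "submodule (polar_map B g ` functionals B) complex_ring (polar_rep C)" by simp
    fix k m v assume k: "k < (6 :: nat)" and "v \<in> carrier C"
    then obtain b where b: "b \<in> carrier B" "v = g b" using g(2) by blast
    then have "coordinate C k m v = polar_map B g (coordinate B k m b)"
      using B.coordinate_functional[OF b(1) k]
      by (simp add: polar_map_def) (simp add: coordinate_def rep_homD(5)[OF g(1) b(1)])
    then show "coordinate C k m v \<in> polar_map B g ` functionals B"
      using B.coordinate_functional[OF b(1) k] by blast
  qed
  ultimately show ?thesis
    using polar_map_hom[OF f(1) A B] polar_map_hom[OF g(1) B C] by (simp add: short_exact_def)
qed

lemma polar_exact_functor:
  assumes \<nu>: "\<nu> = of_int K - \<mu>"
  shows "exact_functor (fd_free_reps :: (free_gen, 'v) rep set) (block_O \<mu>) polar_rep (\<lambda>M N. polar_map M)"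
  unfolding exact_functor_def is_functor_def
proof (intro conjI ballI allI impI)
  fix M N L :: "(free_gen, 'v) rep"
  assume "M \<in> fd_free_reps" 
  then have M: "is_rep M" "finite_dim M (carrier M)" by (auto simp: fd_free_reps_def)
  interpret M: polar_at \<nu> M by (rule polar_at[OF M(1)])
  show "polar_rep M \<in> block_O \<mu>" by (rule M.polar_rep_in_block[OF M(2) \<nu>])
  show "polar_map M (\<lambda>v\<in>carrier M. v) = (\<lambda>v\<in>carrier (polar_rep M). v)"
    by (auto simp: polar_map_def fun_eq_iff functionalsD(1))
  assume "N \<in> fd_free_reps"
  then have N: "is_rep N" by (auto simp: fd_free_reps_def)
  show "polar_map M f \<in> rep_hom (polar_rep M) (polar_rep N)" if "f \<in> rep_hom M N" for f
    by (rule polar_map_hom[OF that M(1) N])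
  show "polar_map M (\<lambda>v\<in>carrier M. f v \<oplus>\<^bsub>N\<^esub> g v) =
      (\<lambda>v\<in>carrier (polar_rep M). polar_map M f v \<oplus>\<^bsub>polar_rep N\<^esub> polar_map M g v)" for f g
    by (auto simp: polar_map_def fun_eq_iff functionalsD(1))
next
  fix L M N :: "(free_gen, 'v) rep" and f g
  assume "L \<in> fd_free_reps" "M \<in> fd_free_reps" and f: "f \<in> rep_hom L M" and g: "g \<in> rep_hom M N"
  then have L: "is_rep L" and M: "is_rep M" by (auto simp: fd_free_reps_def)
  show "polar_map L (compose (carrier L) g f) =
      compose (carrier (polar_rep L)) (polar_map M g) (polar_map L f)"
    using functional_map[OF f L M]
    by (auto simp: polar_map_def fun_eq_iff compose_def functionalsD(1))
next
  fix A B C :: "(free_gen, 'v) rep" and f g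
  assume "A \<in> fd_free_reps" "B \<in> fd_free_reps" "C \<in> fd_free_reps" "short_exact A f B g C"
  then show "short_exact (polar_rep A) (polar_map A f) (polar_rep B) (polar_map B g) (polar_rep C)"
    by (intro polar_map_exact) (auto simp: fd_free_reps_def)
qed

end

section \<open>Full faithfulness\<close>

context polar_at begin

lemma coordinate_unit:
  "v \<in> carrier M \<Longrightarrow> coordinate M k m v (unit_vector j n) = (if j = k \<and> n = m then v else \<zero>)"
  by (auto simp: coordinate_def unit_vector_def coeff_monom)

text \<open>
  A coordinate of degree \<open>n + 1\<close> in slot \<open>j\<close> is sent by \<open>d 1\<close> to \<open>-(n + 2 wt j)\<close> times the one of degree \<open>n\<close>. The
  scalar is nonzero, so a vector annihilated by \<open>d 1\<close> has only coordinates of degree zero; these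
  have different weights in different slots.
\<close>

lemma highest_weight_vector:
  assumes k: "k < 6" and nondeg: "\<And>j m. j < 6 \<Longrightarrow> of_nat m + 2 * wt j \<noteq> 0"
    and u: "u \<in> functionals M" and wt: "act (polar_rep M) (d 0) u = (- wt k) \<odot>\<^bsub>polar_rep M\<^esub> u"
    and sing: "act (polar_rep M) (d 1) u = \<zero>\<^bsub>polar_rep M\<^esub>"
  shows "u = coordinate M k 0 (u (unit_vector k 0))"
proof (rule functional_eqI[OF u])
  have uc: "u p \<in> carrier M" for p by (rule functionalsD(1)[OF u])
  show "coordinate M k 0 (u (unit_vector k 0)) \<in> functionals M"
    using k uc by simp
  fix j m assume j: "j < (6 :: nat)"
  have "u (unit_vector j m) = \<zero>" if "m = Suc n" for n
  proof -
    have "(\<lambda>i. - lie (wt i) (monom 1 2) (unit_vector j n i)) = vector_scale (- (of_nat n + 2 * wt j)) (unit_vector j (Suc n))"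
      by (cases n) (auto simp: vector_scale_def unit_vector_def fun_eq_iff lie_def pderiv_monom mult_monom
          Polynomial.smult_monom add_monom minus_monom diff_monom mult.commute simp del: One_nat_def)
    then have "(- (of_nat n + 2 * wt j)) \<odot> u (unit_vector j (Suc n)) = \<zero>"
      using fun_cong[OF sing, of "unit_vector j n"]
      by (simp add: d_values act_polar_low[OF u] functionalsD(3)[OF u])
    then show ?thesis
      using scale_eq_zero nondeg[OF j, of n] uc that by (metis neg_equal_0_iff_equal)
  qed
  moreover have "u (unit_vector j 0) = \<zero>" if "j \<noteq> k"
  proof (rule scale_left_cancel)
    show "(- wt j) \<odot> u (unit_vector j 0) = (- wt k) \<odot> u (unit_vector j 0)"
      using fun_cong[OF wt, of "unit_vector j 0"] act_d0_unit[OF u, of j 0] by simp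
    show "- wt j \<noteq> - wt k" using that by (simp add: wt_def)
  qed (rule uc)
  ultimately show "u (unit_vector j m) = coordinate M k 0 (u (unit_vector k 0)) (unit_vector j m)"
    using uc by (cases m) (auto simp: coordinate_unit)
qed

lemma act_d0_coordinate:
  assumes "v \<in> carrier M" "k < 6"
  shows "act (polar_rep M) (d 0) (coordinate M k 0 v) = (- wt k) \<odot>\<^bsub>polar_rep M\<^esub> coordinate M k 0 v"
proof -
  have "act (polar_rep M) (d 0) (coordinate M k 0 v) = (\<lambda>p. (- wt k) \<odot> coordinate M k 0 v p)"
    using assms
    by (intro functional_eqI) (auto simp: act_polar_closed functional_scale act_d0_unit coordinate_unit)
  then show ?thesis by simp
qed

lemma act_d1_coordinate:
  assumes "v \<in> carrier M" "k < 6"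
  shows "act (polar_rep M) (d 1) (coordinate M k 0 v) = \<zero>\<^bsub>polar_rep M\<^esub>"
  using assms act_polar_low[OF coordinate_functional[OF assms, of 0], of 2]
  by (simp add: d_values coordinate_def lie_def pderiv_monom coeff_mult fun_eq_iff)

text \<open>
  The operator \<open>d 2\<close> is the first one that sees the cocycles. Every edge that leaves a slot contributes one
  term, and the terms are linearly independent: an edge of length \<open>\<ell>\<close> to slot \<open>k\<close> lands in degree \<open>\<ell> - 2\<close>.
  The terms of one line therefore can be compared separately.
\<close>

lemma act_d2_coordinate:
  assumes v: "v \<in> carrier M"
  shows
    "act (polar_rep M) (d 2) (coordinate M 0 0 v) =
      12 \<odot>\<^bsub>polar_rep M\<^esub> coordinate M 3 1 v \<oplus>\<^bsub>polar_rep M\<^esub> 120 \<odot>\<^bsub>polar_rep M\<^esub> coordinate M 4 2 (act M X1 v)"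
    "act (polar_rep M) (d 2) (coordinate M 1 0 v) =
      6 \<odot>\<^bsub>polar_rep M\<^esub> coordinate M 3 0 v \<oplus>\<^bsub>polar_rep M\<^esub> (12 \<odot>\<^bsub>polar_rep M\<^esub> coordinate M 4 1 v
        \<oplus>\<^bsub>polar_rep M\<^esub> 120 \<odot>\<^bsub>polar_rep M\<^esub> coordinate M 5 2 (act M X2 v))"
    "act (polar_rep M) (d 2) (coordinate M 2 0 v) =
      6 \<odot>\<^bsub>polar_rep M\<^esub> coordinate M 4 0 v \<oplus>\<^bsub>polar_rep M\<^esub> 12 \<odot>\<^bsub>polar_rep M\<^esub> coordinate M 5 1 v"
proof -
  have [simp]: "pderiv (monom 1 3 :: complex poly) = monom 3 2"
    "(pderiv ^^ 3) (monom 1 3 :: complex poly) = monom 6 0"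
    "(pderiv ^^ 4) (monom 1 3 :: complex poly) = 0"
    "(pderiv ^^ 5) (monom 1 3 :: complex poly) = 0"
    by (simp_all add: pderiv_monom eval_nat_numeral)
  have [simp]: "coeff (monom c 0 * q) n = c * coeff q n" for c and q :: "complex poly" and n
    by (simp add: monom_0)
  have [simp]: "coeff ((pderiv ^^ 2) q) 0 = 2 * coeff q 2" for q :: "complex poly"
    by (simp add: coeff_pderiv eval_nat_numeral)
  note s = act_polar_rep d_values coordinate_def op_defs lie_def cocycle2_def cocycle3_def cocycle4_def
    coeff_monom_mult coeff_pderiv scale_scale
  show "act (polar_rep M) (d 2) (coordinate M 0 0 v) =
      12 \<odot>\<^bsub>polar_rep M\<^esub> coordinate M 3 1 v \<oplus>\<^bsub>polar_rep M\<^esub> 120 \<odot>\<^bsub>polar_rep M\<^esub> coordinate M 4 2 (act M X1 v)"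
    using v by (simp add: s fun_eq_iff)
  show "act (polar_rep M) (d 2) (coordinate M 1 0 v) =
      6 \<odot>\<^bsub>polar_rep M\<^esub> coordinate M 3 0 v \<oplus>\<^bsub>polar_rep M\<^esub> (12 \<odot>\<^bsub>polar_rep M\<^esub> coordinate M 4 1 v
        \<oplus>\<^bsub>polar_rep M\<^esub> 120 \<odot>\<^bsub>polar_rep M\<^esub> coordinate M 5 2 (act M X2 v))"
    using v by (simp add: s fun_eq_iff scale_add_left M.a_assoc) (simp add: numeral_3_eq_3)
  show "act (polar_rep M) (d 2) (coordinate M 2 0 v) =
      6 \<odot>\<^bsub>polar_rep M\<^esub> coordinate M 4 0 v \<oplus>\<^bsub>polar_rep M\<^esub> 12 \<odot>\<^bsub>polar_rep M\<^esub> coordinate M 5 1 v"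
    using v by (simp add: s fun_eq_iff scale_add_left)
qed

end

lemma (in representation) scale_cancel:
  assumes "c \<odot> v = c \<odot> w" "c \<noteq> 0" "v \<in> carrier M" "w \<in> carrier M"
  shows "v = w"
proof -
  have "inverse c \<odot> (c \<odot> u) = u" if "u \<in> carrier M" for u
    using that assms(2) by (simp add: scale_scale)
  then show ?thesis using assms(1,3,4) by metis
qed

context polar begin

text \<open>
  The values on highest weight vectors define maps \<open>\<phi> k\<close>. Comparing the terms of \<open>d 2\<close> edge by edge
  makes them equal along the path \<open>0-3-1-4-2-5\<close> and turns the edges \<open>0-4\<close> and \<open>1-5\<close> into commutation with \<open>X1\<close>
  and \<open>X2\<close>. The module is generated by highest weight vectors, so the resulting homomorphism induces \<open>\<Psi>\<close>.
\<close>

lemma polar_full: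
  assumes M: "is_rep M" and N: "is_rep N" and nondeg: "\<And>j m. j < 6 \<Longrightarrow> of_nat m + 2 * wt j \<noteq> 0"
    and \<Psi>: "\<Psi> \<in> rep_hom (polar_rep M) (polar_rep N)"
  shows "\<exists>f\<in>rep_hom M N. polar_map M f = \<Psi>"
proof -
  interpret M: polar_at \<nu> M by (rule polar_at[OF M])
  interpret N: polar_at \<nu> N by (rule polar_at[OF N])
  note \<Psi>D = rep_homD[OF \<Psi>]
  define \<phi> where "\<phi> k v = \<Psi> (coordinate M k 0 v) (unit_vector k 0)" for k v
  have cM: "coordinate M k m v \<in> carrier (polar_rep M)" if "v \<in> carrier M" "k < 6" for k m v
    using that by simp
  have \<Psi>fun: "\<Psi> (coordinate M k m v) \<in> functionals N" if "v \<in> carrier M" "k < 6" for k m v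
    using \<Psi>D(3)[OF cM[OF that]] by simp
  have \<phi>N: "\<phi> k v \<in> carrier N" if "v \<in> carrier M" "k < 6" for k v
    using functionalsD(1)[OF \<Psi>fun[OF that]] by (simp add: \<phi>_def)
  have \<Psi>0: "\<Psi> (coordinate M k 0 v) = coordinate N k 0 (\<phi> k v)" if v: "v \<in> carrier M" and k: "k < 6" for k v
    unfolding \<phi>_def
  proof (rule N.highest_weight_vector[OF k nondeg \<Psi>fun[OF v k]])
    show "act (polar_rep N) (d 0) (\<Psi> (coordinate M k 0 v)) = (- wt k) \<odot>\<^bsub>polar_rep N\<^esub> \<Psi> (coordinate M k 0 v)"
      using \<Psi>D(6)[OF cM[OF v k], of "d 0" 0] M.act_d0_coordinate[OF v k] \<Psi>D(5)[OF cM[OF v k], of "- wt k" 0]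
      by metis
    show "act (polar_rep N) (d 1) (\<Psi> (coordinate M k 0 v)) = \<zero>\<^bsub>polar_rep N\<^esub>"
      using \<Psi>D(6)[OF cM[OF v k], of "d 1" 0] M.act_d1_coordinate[OF v k]
        rep_hom_zero[OF \<Psi> M.polar_rep_is_rep N.polar_rep_is_rep] by metis
  qed
  have \<Psi>m: "\<Psi> (coordinate M k m v) = coordinate N k m (\<phi> k v)" if v: "v \<in> carrier M" and k: "k < 6" for k m v
  proof (induction m)
    case 0
    then show ?case by (rule \<Psi>0[OF v k])
  next
    case (Suc m)
    let ?a = "- of_nat (Suc m) :: complex"
    have "?a \<odot>\<^bsub>polar_rep N\<^esub> \<Psi> (coordinate M k (Suc m) v) = \<Psi> (act (polar_rep M) (d (-1)) (coordinate M k m v))"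
      unfolding M.act_lowering_coordinate[OF v k] by (rule \<Psi>D(5)[OF cM[OF v k], symmetric])
    also have "\<dots> = act (polar_rep N) (d (-1)) (coordinate N k m (\<phi> k v))"
      using \<Psi>D(6)[OF cM[OF v k]] Suc by simp
    also have "\<dots> = ?a \<odot>\<^bsub>polar_rep N\<^esub> coordinate N k (Suc m) (\<phi> k v)"
      by (rule N.act_lowering_coordinate[OF \<phi>N[OF v k] k])
    finally show ?case
    proof (rule N.P.scale_cancel)
      show "?a \<noteq> 0" by (metis neg_equal_0_iff_equal of_nat_neq_0)
    qed (use \<Psi>fun[OF v k] \<phi>N[OF v k] k in simp_all)
  qed
  have \<phi>add: "\<phi> k (v \<oplus>\<^bsub>M\<^esub> w) = \<phi> k v \<oplus>\<^bsub>N\<^esub> \<phi> k w" if "v \<in> carrier M" "w \<in> carrier M" "k < 6" for k v w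
    using \<Psi>D(4)[OF cM[of v k 0] cM[of w k 0]] that
    by (simp add: \<phi>_def M.coordinate_add del: polar_rep_simps(3)) simp
  have \<phi>vector_scale: "\<phi> k (c \<odot>\<^bsub>M\<^esub> v) = c \<odot>\<^bsub>N\<^esub> \<phi> k v" if "v \<in> carrier M" "k < 6" for k v c
    using \<Psi>D(5)[OF cM[of v k 0]] that
    by (simp add: \<phi>_def M.coordinate_add del: polar_rep_simps(4)) simp
  have \<phi>0: "\<phi> 3 v = \<phi> 0 v" "\<phi> 4 (act M X1 v) = act N X1 (\<phi> 0 v)"
    and \<phi>1: "\<phi> 3 v = \<phi> 1 v" "\<phi> 4 v = \<phi> 1 v" "\<phi> 5 (act M X2 v) = act N X2 (\<phi> 1 v)"
    and \<phi>2: "\<phi> 4 v = \<phi> 2 v" "\<phi> 5 v = \<phi> 2 v" if v: "v \<in> carrier M" for v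
  proof -
    have raise: "\<Psi> (act (polar_rep M) (d 2) (coordinate M k 0 v)) = act (polar_rep N) (d 2) (coordinate N k 0 (\<phi> k v))"
      if "k < 6" for k
      using \<Psi>D(6)[OF cM[OF v that]] \<Psi>0[OF v that] by simp
    have sM: "c \<odot>\<^bsub>polar_rep M\<^esub> coordinate M k m u \<in> carrier (polar_rep M)"
      "\<Psi> (c \<odot>\<^bsub>polar_rep M\<^esub> coordinate M k m u) = c \<odot>\<^bsub>polar_rep N\<^esub> coordinate N k m (\<phi> k u)"
      if "u \<in> carrier M" "k < 6" for c k m u
      using M.P.scale_closed[OF cM[OF that]] \<Psi>D(5)[OF cM[OF that]] \<Psi>m[OF that] by simp_all
    have xM: "act M i v \<in> carrier M" for i using v by simp
    note v\<phi> = \<phi>N[OF v] \<phi>N[OF xM] N.act_closed[OF \<phi>N[OF v]]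
    note expand = M.act_d2_coordinate[OF v] N.act_d2_coordinate[OF \<phi>N[OF v]] \<Psi>D(4) M.P.add.m_closed sM
    have *: "12 \<odot>\<^bsub>polar_rep N\<^esub> coordinate N 3 1 (\<phi> 3 v) \<oplus>\<^bsub>polar_rep N\<^esub>
        120 \<odot>\<^bsub>polar_rep N\<^esub> coordinate N 4 2 (\<phi> 4 (act M X1 v)) =
      12 \<odot>\<^bsub>polar_rep N\<^esub> coordinate N 3 1 (\<phi> 0 v) \<oplus>\<^bsub>polar_rep N\<^esub>
        120 \<odot>\<^bsub>polar_rep N\<^esub> coordinate N 4 2 (act N X1 (\<phi> 0 v))"
      using raise[of 0] v xM by (simp add: expand del: polar_rep_simps)
    show "\<phi> 3 v = \<phi> 0 v" "\<phi> 4 (act M X1 v) = act N X1 (\<phi> 0 v)"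
      using fun_cong[OF *, of "unit_vector 3 1"] fun_cong[OF *, of "unit_vector 4 2"] v\<phi>
      by (auto simp: N.coordinate_unit dest!: N.scale_cancel)
    have *: "6 \<odot>\<^bsub>polar_rep N\<^esub> coordinate N 3 0 (\<phi> 3 v) \<oplus>\<^bsub>polar_rep N\<^esub>
        (12 \<odot>\<^bsub>polar_rep N\<^esub> coordinate N 4 1 (\<phi> 4 v) \<oplus>\<^bsub>polar_rep N\<^esub>
        120 \<odot>\<^bsub>polar_rep N\<^esub> coordinate N 5 2 (\<phi> 5 (act M X2 v))) =
      6 \<odot>\<^bsub>polar_rep N\<^esub> coordinate N 3 0 (\<phi> 1 v) \<oplus>\<^bsub>polar_rep N\<^esub>
        (12 \<odot>\<^bsub>polar_rep N\<^esub> coordinate N 4 1 (\<phi> 1 v) \<oplus>\<^bsub>polar_rep N\<^esub>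
        120 \<odot>\<^bsub>polar_rep N\<^esub> coordinate N 5 2 (act N X2 (\<phi> 1 v)))"
      using raise[of 1] v xM by (simp add: expand del: polar_rep_simps One_nat_def)
    show "\<phi> 3 v = \<phi> 1 v" "\<phi> 4 v = \<phi> 1 v" "\<phi> 5 (act M X2 v) = act N X2 (\<phi> 1 v)"
      using fun_cong[OF *, of "unit_vector 3 0"] fun_cong[OF *, of "unit_vector 4 1"]
        fun_cong[OF *, of "unit_vector 5 2"] v\<phi>
      by (auto simp: N.coordinate_unit dest!: N.scale_cancel)
    have *: "6 \<odot>\<^bsub>polar_rep N\<^esub> coordinate N 4 0 (\<phi> 4 v) \<oplus>\<^bsub>polar_rep N\<^esub>
        12 \<odot>\<^bsub>polar_rep N\<^esub> coordinate N 5 1 (\<phi> 5 v) =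
      6 \<odot>\<^bsub>polar_rep N\<^esub> coordinate N 4 0 (\<phi> 2 v) \<oplus>\<^bsub>polar_rep N\<^esub>
        12 \<odot>\<^bsub>polar_rep N\<^esub> coordinate N 5 1 (\<phi> 2 v)"
      using raise[of 2] v xM by (simp add: expand del: polar_rep_simps)
    show "\<phi> 4 v = \<phi> 2 v" "\<phi> 5 v = \<phi> 2 v"
      using fun_cong[OF *, of "unit_vector 4 0"] fun_cong[OF *, of "unit_vector 5 1"] v\<phi>
      by (auto simp: N.coordinate_unit dest!: N.scale_cancel)
  qed
  have same: "\<phi> k v = \<phi> 0 v" if v: "v \<in> carrier M" and k: "k < 6" for k v
  proof -
    have "k \<in> {0, 1, 2, 3, 4, 5}" using k by auto
    then show ?thesis using \<phi>0[OF v] \<phi>1[OF v] \<phi>2[OF v] by auto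
  qed
  define f where "f = (\<lambda>v\<in>carrier M. \<phi> 0 v)"
  have f: "f \<in> rep_hom M N"
  proof (rule rep_homI)
    fix i v assume v: "v \<in> carrier M"
    then have xM: "act M i v \<in> carrier M" for i by simp
    show "f (act M i v) = act N i (f v)"
      using v xM \<phi>0(2)[OF v] \<phi>1(3)[OF v] same[OF xM, of 4] same[OF xM, of 5] same[OF v, of 1]
      by (cases i) (simp_all add: f_def)
  qed (auto simp: f_def \<phi>N \<phi>add \<phi>vector_scale)
  have "subrep (polar_rep M) {w \<in> carrier (polar_rep M). polar_map M f w = \<Psi> w}"
    by (rule subrep_equalizer[OF polar_map_hom[OF f M N] \<Psi> M.polar_rep_is_rep N.polar_rep_is_rep])
  then have "{w \<in> carrier (polar_rep M). polar_map M f w = \<Psi> w} = functionals M"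
  proof (rule M.polar_rep_generated)
    fix k v assume k: "k < (6 :: nat)" and v: "v \<in> carrier M"
    have "polar_map M f (coordinate M k 0 v) = coordinate N k 0 (f v)"
      using cM[OF v k] v by (simp add: polar_map_def) (simp add: coordinate_def rep_homD(5)[OF f])
    then show "coordinate M k 0 v \<in> {w \<in> carrier (polar_rep M). polar_map M f w = \<Psi> w}"
      using cM[OF v k, of 0] \<Psi>0[OF v k] same[OF v k] v by (simp add: f_def)
  qed
  then have "polar_map M f w = \<Psi> w" if "w \<in> carrier (polar_rep M)" for w
    using that by auto
  then have "polar_map M f = \<Psi>"
    by (rule rep_hom_eqI[OF polar_map_hom[OF f M N] \<Psi>])
  then show ?thesis using f by blast
qed

lemma polar_fully_faithful:
  assumes nondeg: "\<And>j m. j < 6 \<Longrightarrow> of_nat m + 2 * wt j \<noteq> 0"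
  shows "fully_faithful (fd_free_reps :: (free_gen, 'v) rep set) polar_rep (\<lambda>M N. polar_map M)"
  unfolding fully_faithful_def bij_betw_def
proof (intro ballI conjI)
  fix M N :: "(free_gen, 'v) rep"
  assume "M \<in> fd_free_reps" "N \<in> fd_free_reps"
  then have M: "is_rep M" and N: "is_rep N" by (auto simp: fd_free_reps_def)
  interpret M: polar_at \<nu> M by (rule polar_at[OF M])
  interpret N: polar_at \<nu> N by (rule polar_at[OF N])
  show "inj_on (polar_map M) (rep_hom M N)"
  proof (rule inj_onI)
    fix f g assume f: "f \<in> rep_hom M N" and g: "g \<in> rep_hom M N" and eq: "polar_map M f = polar_map M g"
    show "f = g"
    proof (rule rep_hom_eqI[OF f g])
      fix v assume v: "v \<in> carrier M"
      then show "f v = g v"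
        using fun_cong[OF fun_cong[OF eq, of "coordinate M 0 0 v"], of "unit_vector 0 0"]
        by (simp add: polar_map_def M.coordinate_unit)
    qed
  qed
  show "polar_map M ` rep_hom M N = rep_hom (polar_rep M) (polar_rep N)"
    using polar_map_hom[OF _ M N] polar_full[OF M N nondeg] by blast
qed

end

section \<open>Wildness of the block\<close>

text \<open>
  A functional is determined by its values on the unit vectors, and each value is a sequence of complex
  numbers because the representation is finite dimensional. Countably many sequences are interleaved
  into one.
\<close>

lemma functionals_embedding:
  fixes M :: "(free_gen, 'v) rep" and \<iota> :: "(nat \<Rightarrow> complex) \<Rightarrow> 'v"
  assumes M: "M \<in> fd_free_reps" and \<iota>: "inj \<iota>"
  shows "\<exists>j :: ((nat \<Rightarrow> complex poly) \<Rightarrow> 'v) \<Rightarrow> 'v. inj_on j (functionals M)"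
proof -
  interpret representation M using M by unfold_locales (simp add: fd_free_reps_def)
  obtain \<gamma> :: "'v \<Rightarrow> nat \<Rightarrow> complex" where \<gamma>: "inj_on \<gamma> (carrier M)"
    using finite_dim_embedding[OF is_rep] M by (auto simp: fd_free_reps_def)
  define code where "code w i = (case prod_decode i of (k, r) \<Rightarrow>
    case prod_decode r of (m, s) \<Rightarrow> \<gamma> (w (unit_vector k m)) s)" for w and i
  have "inj_on (\<lambda>w. \<iota> (code w)) (functionals M)"
  proof (rule inj_onI, rule functional_eqI)
    fix u w and k m :: nat assume u: "u \<in> functionals M" and w: "w \<in> functionals M" and "\<iota> (code u) = \<iota> (code w)"
    then have eq: "code u = code w" using injD[OF \<iota>] by blast
    have "\<gamma> (u (unit_vector k m)) s = \<gamma> (w (unit_vector k m)) s" for s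
      using fun_cong[OF eq, of "prod_encode (k, prod_encode (m, s))"] by (simp add: code_def)
    then have "\<gamma> (u (unit_vector k m)) = \<gamma> (w (unit_vector k m))" ..
    then show "u (unit_vector k m) = w (unit_vector k m)"
      using inj_onD[OF \<gamma>] functionalsD(1)[OF u] functionalsD(1)[OF w] by blast
  qed
  then show ?thesis by blast
qed

theorem theorem3p14:
  fixes \<mu> :: complex
    and \<iota> :: "(nat \<Rightarrow> complex) \<Rightarrow> 'v"
  assumes "inj \<iota>"
  shows "wild (block_O \<mu> :: (complex poly, 'v) rep set)"
proof -
  \<comment> \<open>The shift by 6 makes \<open>Re (wt j)\<close> positive in all six slots, so \<open>d 1\<close> is nondegenerate.\<close>
  define K where "K = \<lceil>Re \<mu>\<rceil> + 6"
  interpret polar "of_int K - \<mu>" .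
  let ?C = "fd_free_reps :: (free_gen, 'v) rep set"
  have nondeg: "of_nat m + 2 * wt j \<noteq> 0" if "j < 6" for j m
  proof -
    have "real j \<le> 5" using that by simp
    moreover have "Re \<mu> + 6 \<le> of_int K" by (simp add: K_def)
    ultimately have "Re (of_nat m + 2 * wt j) > 0" by (simp add: wt_def)
    then show ?thesis by (metis less_irrefl zero_complex.sel(1))
  qed
  define j :: "(free_gen, 'v) rep \<Rightarrow> ((nat \<Rightarrow> complex poly) \<Rightarrow> 'v) \<Rightarrow> 'v"
    where "j M = (SOME j. inj_on j (functionals M))" for M
  have j: "inj_on (j M) (functionals M)" if "M \<in> ?C" for M
    unfolding j_def using functionals_embedding[OF that assms] by (rule someI_ex)
  let ?F = "\<lambda>M. transport (j M) (polar_rep M)"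
  have iso: "isomorphism (restrict (j M) (carrier (polar_rep M))) (polar_rep M) (?F M)" if "M \<in> ?C" for M
    using that j[OF that] polar_at.polar_rep_is_rep[OF polar_at]
    by (intro transport_isomorphism) (auto simp: fd_free_reps_def)
  have block: "?F M \<in> block_O \<mu>" if "M \<in> ?C" for M
  proof -
    interpret M: polar_at "of_int K - \<mu>" M using that by (intro polar_at) (simp add: fd_free_reps_def)
    have "polar_rep M \<in> block_O \<mu>"
      using that by (intro M.polar_rep_in_block) (auto simp: fd_free_reps_def)
    then show ?thesis by (rule block_O_isomorphism[OF iso[OF that]])
  qed
  have repC: "is_rep M" if "M \<in> ?C" for M using that by (simp add: fd_free_reps_def)
  note F = exact_functor_isomorphism[OF polar_exact_functor[OF refl] polar_fully_faithful[OF nondeg]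
      repC iso block]
  have rep: "is_rep N" if "N \<in> block_O \<mu>" for N :: "(complex poly, 'v) rep"
    using that by (simp add: block_O_def category_O_def witt_module_def)
  show ?thesis by (rule wild_if_fully_faithful[OF F rep])
qed

end
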